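(* Every Halin snark has perfect matching index at least $5$; that is, the edges of a Halin snark cannot be covered with four perfect matchings.
   Context: Graphs are finite. The perfect matching index $\pi(G)$ of a cubic graph $G$ is the minimum number of perfect matchings whose union is $E(G)$; $\pi(G)\ge 5$ means that $E(G)$ is not a union of four (not necessarily distinct) perfect matchings. Multipoles. A multipole consists of vertices and edges; each edge has two ends, each of which may or may not be incident with a vertex; a free end is called a semiedge. All vertices of multipoles considered have degree 3. The junction of two semiedges identifies these free ends, merging their edges into one edge. A $(2,2)$-pole has exactly four semiedges, divided into an input connector and an output connector of size 2 each; a $(2,2;1)$-pole has in addition one residual semiedge. If $uwv$ is a path of length 2 in a cubic graph $G$, then $G_{uwv}$ is the $(2,2;1)$-pole obtained by removing the path $uwv$ (its vertices and edges) and keeping as semiedges the remaining edge ends formerly incident with $u,w,v$; those formerly incident with $u$ form the input connector, those with $v$ the output connector, and the one with $w$ is residual. It is called bipartite if $G$ is bipartite. The join $M_1\circ M_2$ is formed by performing junctions of the two semiedges of the output connector of $M_1$ with the two semiedges of the input connector of $M_2$ (in either of the two possible ways); its input is that of $M_1$, its output that of $M_2$, and residual semiedges are kept. Tetrahedral flows. Let $p_1,\dots,p_4$ be a basis of $\mathbb{F}_2^4$. The tetrahedron $T$ has as points the vectors $p_i$ and $p_i+p_j$ $(i<j)$ and as lines the triples $\{p_i,p_i+p_j,p_j\}$. A $T$-flow on a multipole assigns to each edge a point of $T$ so that at each vertex the three values form a line of $T$. A decollineator is a $(2,2)$-pole that has no $T$-flow for which both the pair of values on the input connector and the pair of values on the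 output connector consist of two distinct points lying on a common line of $T$ (this does not depend on the choice of $T$). Halin snarks. A Halin fragment is a $(2,2;1)$-pole $F=D\circ B$ where $D$ is a decollineator and $B$ is a bipartite $(2,2;1)$-pole. A cubic Halin graph $H=C\cup S$ consists of a plane tree $S$ all of whose non-leaf vertices have degree 3 (with at least one such vertex) together with a circuit $C=(v_0v_1\cdots v_{k-1})$ (the perimeter circuit) passing through all leaves of $S$ so that $H$ is embedded in the plane, with $C$ bounding the outer face. Given Halin fragments $F_0,\dots,F_{k-1}$, a Halin snark $H^{\sharp}$ is obtained by performing, for each $i$ modulo $k$, junctions of the output connector of $F_i$ with the input connector of $F_{i+1}$ (in either of the two possible ways), adding the tree $S-\{v_0,\dots,v_{k-1}\}$, and attaching the residual semiedge of each $F_i$ to the vertex $v_i'$ that is the neighbour of $v_i$ in $S$. *)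

theory Defs
  imports "HOL-Analysis.Analysis" "HOL-Library.Z2"
begin

section \<open>Multipoles and cubic graphs\<close>

text \<open>
  A multipole is given by its vertices and its edge ends.  The involution \<open>mate\<close> sends an edge end
  to the other end of the same edge, and \<open>inc\<close> gives the vertex incident with an edge end,
  if there is one.  Loops, parallel edges and edges without any incident vertex are representable.
\<close>

record ('v, 'd) multipole =
  verts :: "'v set"
  ends :: "'d set"
  mate :: "'d \<Rightarrow> 'd"
  inc :: "'d \<Rightarrow> 'v option"

definition ends_at :: "('v, 'd, 'm) multipole_scheme \<Rightarrow> 'v \<Rightarrow> 'd set" where
  "ends_at M v = {d \<in> ends M. inc M d = Some v}"

definition semiedges :: "('v, 'd, 'm) multipole_scheme \<Rightarrow> 'd set" where
  "semiedges M = {d \<in> ends M. inc M d = None}"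

definition edge_ends :: "('v, 'd, 'm) multipole_scheme \<Rightarrow> 'd \<Rightarrow> 'd set" where
  "edge_ends M d = {d, mate M d}"

definition edges :: "('v, 'd, 'm) multipole_scheme \<Rightarrow> 'd set set" where
  "edges M = edge_ends M ` ends M"

definition cubic_multipole :: "('v, 'd, 'm) multipole_scheme \<Rightarrow> bool" where
  "cubic_multipole M \<longleftrightarrow>
     finite (verts M) \<and> finite (ends M) \<and>
     (\<forall>d \<in> ends M. mate M d \<in> ends M \<and> mate M d \<noteq> d \<and> mate M (mate M d) = d) \<and>
     (\<forall>d \<in> ends M. \<forall>v. inc M d = Some v \<longrightarrow> v \<in> verts M) \<and>
     (\<forall>v \<in> verts M. card (ends_at M v) = 3)"

definition cubic_graph :: "('v, 'd, 'm) multipole_scheme \<Rightarrow> bool" where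
  "cubic_graph G \<longleftrightarrow> cubic_multipole G \<and> semiedges G = {}"

definition bipartite :: "('v, 'd, 'm) multipole_scheme \<Rightarrow> bool" where
  "bipartite G \<longleftrightarrow>
     (\<exists>A. \<forall>d \<in> ends G. \<forall>x y. inc G d = Some x \<longrightarrow> inc G (mate G d) = Some y \<longrightarrow>
        (x \<in> A \<longleftrightarrow> y \<notin> A))"

definition edge_between :: "('v, 'd, 'm) multipole_scheme \<Rightarrow> 'd set \<Rightarrow> 'v \<Rightarrow> 'v \<Rightarrow> bool" where
  "edge_between G e x y \<longleftrightarrow>
     (\<exists>d \<in> ends G. e = edge_ends G d \<and> inc G d = Some x \<and> inc G (mate G d) = Some y)"


section \<open>Perfect matchings\<close>

text \<open>Counting ends at a vertex, rather than edges, excludes loops from perfect matchings.\<close>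

definition perfect_matching :: "('v, 'd, 'm) multipole_scheme \<Rightarrow> 'd set set \<Rightarrow> bool" where
  "perfect_matching G P \<longleftrightarrow>
     P \<subseteq> edges G \<and> (\<forall>v \<in> verts G. \<exists>!d. d \<in> ends_at G v \<and> edge_ends G d \<in> P)"

text \<open>The index is \<open>\<infinity>\<close> if the perfect matchings do not cover all edges.\<close>

definition perfect_matching_index :: "('v, 'd, 'm) multipole_scheme \<Rightarrow> enat" where
  "perfect_matching_index G =
     Inf {enat (card \<P>) | \<P>. finite \<P> \<and> (\<forall>P \<in> \<P>. perfect_matching G P) \<and> \<Union> \<P> = edges G}"


section \<open>Poles, junctions and joins\<close>

record ('v, 'd) pole = "('v, 'd) multipole" +
  inputs :: "'d set"
  outputs :: "'d set"
  residuals :: "'d set"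

definition pole_2_2_r :: "nat \<Rightarrow> ('v, 'd) pole \<Rightarrow> bool" where
  "pole_2_2_r r M \<longleftrightarrow>
     cubic_multipole M \<and>
     semiedges M = inputs M \<union> outputs M \<union> residuals M \<and>
     inputs M \<inter> outputs M = {} \<and> (inputs M \<union> outputs M) \<inter> residuals M = {} \<and>
     card (inputs M) = 2 \<and> card (outputs M) = 2 \<and> card (residuals M) = r"

abbreviation pole_2_2 :: "('v, 'd) pole \<Rightarrow> bool" where
  "pole_2_2 \<equiv> pole_2_2_r 0"

abbreviation pole_2_2_1 :: "('v, 'd) pole \<Rightarrow> bool" where
  "pole_2_2_1 \<equiv> pole_2_2_r 1"

text \<open>
  The pole \<open>G\<^sub>u\<^sub>w\<^sub>v\<close> for the path with vertices \<open>u\<close>, \<open>w\<close>, \<open>v\<close> and edges \<open>e\<close>, \<open>f\<close>.  The edges have to be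
  named because \<open>G\<close> may have parallel edges.
\<close>

definition is_path2 ::
    "('v, 'd) multipole \<Rightarrow> 'v \<Rightarrow> 'd set \<Rightarrow> 'v \<Rightarrow> 'd set \<Rightarrow> 'v \<Rightarrow> bool" where
  "is_path2 G u e w f v \<longleftrightarrow>
     distinct [u, w, v] \<and> edge_between G e u w \<and> edge_between G f w v"

definition remove_path ::
    "('v, 'd) multipole \<Rightarrow> 'v \<Rightarrow> 'd set \<Rightarrow> 'v \<Rightarrow> 'd set \<Rightarrow> 'v \<Rightarrow> ('v, 'd) pole" where
  "remove_path G u e w f v =
     \<lparr>verts = verts G - {u, w, v},
      ends = ends G - (e \<union> f),
      mate = mate G,
      inc = (\<lambda>d. if inc G d \<in> {Some u, Some w, Some v} then None else inc G d),
      inputs = ends_at G u - (e \<union> f),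
      outputs = ends_at G v - (e \<union> f),
      residuals = ends_at G w - (e \<union> f)\<rparr>"

definition bipartite_pole :: "('v, 'd) pole \<Rightarrow> bool" where
  "bipartite_pole B \<longleftrightarrow>
     (\<exists>G u e w f v. cubic_graph G \<and> bipartite G \<and> is_path2 G u e w f v \<and>
        B = remove_path G u e w f v)"

text \<open>
  The junction of the semiedges \<open>s\<close> and \<open>t\<close>: both free ends disappear and the edges containing them
  become one edge, whose ends are the mates of \<open>s\<close> and \<open>t\<close>.  If \<open>s\<close> and \<open>t\<close> are the two ends of the
  same edge, that edge (which would become a closed curve without vertices) disappears;
  this never happens in the formation of a Halin snark, since an edge of a bipartite pole
  has at most one end in the two connectors.
\<close>

definition junction ::
    "'d \<times> 'd \<Rightarrow> ('v, 'd, 'm) multipole_scheme \<Rightarrow> ('v, 'd, 'm) multipole_scheme" where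
  "junction st M = (case st of (s, t) \<Rightarrow>
     M\<lparr>ends := ends M - {s, t},
       mate := (mate M)(mate M s := mate M t, mate M t := mate M s)\<rparr>)"

definition disjoint_sum ::
    "('v, 'd) pole \<Rightarrow> ('w, 'e) pole \<Rightarrow> ('v + 'w, 'd + 'e) pole" where
  "disjoint_sum M N =
     \<lparr>verts = verts M <+> verts N,
      ends = ends M <+> ends N,
      mate = map_sum (mate M) (mate N),
      inc = case_sum (map_option Inl \<circ> inc M) (map_option Inr \<circ> inc N),
      inputs = Inl ` inputs M,
      outputs = Inr ` outputs N,
      residuals = residuals M <+> residuals N\<rparr>"

text \<open>
  \<open>is_join M N K\<close> says that \<open>K\<close> is a join of \<open>M\<close> and \<open>N\<close>; the bijection \<open>\<sigma>\<close> selects one of the two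
  ways of matching the connectors, and \<open>js\<close> lists the junctions in some order.
\<close>

definition is_join ::
    "('v, 'd) pole \<Rightarrow> ('w, 'e) pole \<Rightarrow> ('v + 'w, 'd + 'e) pole \<Rightarrow> bool" where
  "is_join M N K \<longleftrightarrow>
     (\<exists>\<sigma> js. bij_betw \<sigma> (outputs M) (inputs N) \<and>
        distinct js \<and> set js = {(Inl b, Inr (\<sigma> b)) | b. b \<in> outputs M} \<and>
        K = fold junction js (disjoint_sum M N))"


section \<open>Tetrahedral flows\<close>

definition is_basis :: "(4 \<Rightarrow> bit ^ 4) \<Rightarrow> bool" where
  "is_basis p \<longleftrightarrow> inj p \<and> vec.independent (range p) \<and> vec.span (range p) = UNIV"

definition tetra_points :: "(4 \<Rightarrow> bit ^ 4) \<Rightarrow> (bit ^ 4) set" where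
  "tetra_points p = {p i | i. True} \<union> {p i + p j | i j. i \<noteq> j}"

definition tetra_lines :: "(4 \<Rightarrow> bit ^ 4) \<Rightarrow> (bit ^ 4) set set" where
  "tetra_lines p = {{p i, p i + p j, p j} | i j. i \<noteq> j}"

text \<open>
  A line has three different points, so the second condition implies that
  the three ends at a vertex carry three different values.
\<close>

definition tetra_flow ::
    "(4 \<Rightarrow> bit ^ 4) \<Rightarrow> ('v, 'd, 'm) multipole_scheme \<Rightarrow> ('d set \<Rightarrow> bit ^ 4) \<Rightarrow> bool" where
  "tetra_flow p M \<phi> \<longleftrightarrow>
     (\<forall>e \<in> edges M. \<phi> e \<in> tetra_points p) \<and>
     (\<forall>v \<in> verts M. (\<lambda>d. \<phi> (edge_ends M d)) ` ends_at M v \<in> tetra_lines p)"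

definition collinear_pair ::
    "(4 \<Rightarrow> bit ^ 4) \<Rightarrow> ('v, 'd, 'm) multipole_scheme \<Rightarrow> ('d set \<Rightarrow> bit ^ 4) \<Rightarrow> 'd set \<Rightarrow> bool" where
  "collinear_pair p M \<phi> A \<longleftrightarrow>
     (\<exists>a b. A = {a, b} \<and> \<phi> (edge_ends M a) \<noteq> \<phi> (edge_ends M b) \<and>
        (\<exists>l \<in> tetra_lines p. \<phi> (edge_ends M a) \<in> l \<and> \<phi> (edge_ends M b) \<in> l))"

definition decollineator :: "(4 \<Rightarrow> bit ^ 4) \<Rightarrow> ('v, 'd) pole \<Rightarrow> bool" where
  "decollineator p D \<longleftrightarrow>
     pole_2_2 D \<and>
     (\<nexists>\<phi>. tetra_flow p D \<phi> \<and> collinear_pair p D \<phi> (inputs D) \<and> collinear_pair p D \<phi> (outputs D))"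

definition halin_fragment ::
    "(4 \<Rightarrow> bit ^ 4) \<Rightarrow> ('v + 'w, 'd + 'e) pole \<Rightarrow> bool" where
  "halin_fragment p F \<longleftrightarrow> (\<exists>D B. decollineator p D \<and> bipartite_pole B \<and> is_join D B F)"


section \<open>Cubic Halin graphs\<close>

text \<open>Halin graphs and their trees are simple graphs, given by vertices and two-element edges.\<close>

definition simple_graph :: "'t set \<Rightarrow> 't set set \<Rightarrow> bool" where
  "simple_graph V E \<longleftrightarrow> finite V \<and> (\<forall>e \<in> E. e \<subseteq> V \<and> card e = 2)"

definition degree :: "'t set set \<Rightarrow> 't \<Rightarrow> nat" where
  "degree E x = card {e \<in> E. x \<in> e}"

definition circuit_edges :: "'t list \<Rightarrow> 't set set" where
  "circuit_edges vs = {{vs ! i, vs ! (Suc i mod length vs)} | i. i < length vs}"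

definition is_circuit :: "'t set set \<Rightarrow> 't list \<Rightarrow> bool" where
  "is_circuit E vs \<longleftrightarrow> 3 \<le> length vs \<and> distinct vs \<and> circuit_edges vs \<subseteq> E"

definition is_tree :: "'t set \<Rightarrow> 't set set \<Rightarrow> bool" where
  "is_tree V E \<longleftrightarrow>
     simple_graph V E \<and> V \<noteq> {} \<and>
     (\<forall>x \<in> V. \<forall>y \<in> V. (x, y) \<in> {(a, b). {a, b} \<in> E}\<^sup>*) \<and>
     (\<nexists>vs. is_circuit E vs)"

text \<open>
  A drawing of a simple graph in the plane represents the vertices by points (\<open>pos\<close>) and the edges by
  arcs (\<open>\<gamma>\<close>) which meet each other and the vertices only in their common ends.
\<close>

definition plane_drawing ::
    "'t set \<Rightarrow> 't set set \<Rightarrow> ('t \<Rightarrow> complex) \<Rightarrow> ('t set \<Rightarrow> real \<Rightarrow> complex) \<Rightarrow> bool" where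
  "plane_drawing V E pos \<gamma> \<longleftrightarrow>
     inj_on pos V \<and>
     (\<forall>e \<in> E. arc (\<gamma> e) \<and> {pathstart (\<gamma> e), pathfinish (\<gamma> e)} = pos ` e \<and>
        path_image (\<gamma> e) \<inter> pos ` V = pos ` e) \<and>
     (\<forall>e \<in> E. \<forall>e' \<in> E. e \<noteq> e' \<longrightarrow>
        path_image (\<gamma> e) \<inter> path_image (\<gamma> e') = pos ` (e \<inter> e'))"

definition drawing_image ::
    "'t set \<Rightarrow> 't set set \<Rightarrow> ('t \<Rightarrow> complex) \<Rightarrow> ('t set \<Rightarrow> real \<Rightarrow> complex) \<Rightarrow> complex set" where
  "drawing_image V E pos \<gamma> = pos ` V \<union> (\<Union>e \<in> E. path_image (\<gamma> e))"

text \<open>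
  \<open>cubic_halin V E vs\<close> says that the union of the tree \<open>S = (V, E)\<close> and the circuit on the list \<open>vs\<close>
  is a cubic Halin graph.  The outer face of a drawing is the constant \<open>outside\<close> of its image.
\<close>

definition cubic_halin :: "'t set \<Rightarrow> 't set set \<Rightarrow> 't list \<Rightarrow> bool" where
  "cubic_halin V E vs \<longleftrightarrow>
     is_tree V E \<and>
     (\<forall>x \<in> V. degree E x = 1 \<or> degree E x = 3) \<and> (\<exists>x \<in> V. degree E x = 3) \<and>
     3 \<le> length vs \<and> distinct vs \<and> set vs = {x \<in> V. degree E x = 1} \<and>
     (\<exists>pos \<gamma>. plane_drawing V (E \<union> circuit_edges vs) pos \<gamma> \<and>
        frontier (outside (drawing_image V (E \<union> circuit_edges vs) pos \<gamma>)) =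
          drawing_image (set vs) (circuit_edges vs) pos \<gamma>)"


section \<open>Halin snarks\<close>

definition leaf_neighbour :: "'t set set \<Rightarrow> 't \<Rightarrow> 't" where
  "leaf_neighbour E x = (THE y. {x, y} \<in> E)"

text \<open>
  The disjoint union of the fragments \<open>F i\<close> and of the tree \<open>S\<close> without its leaves \<open>vs\<close>, with
  the residual semiedge of \<open>F i\<close> attached to the neighbour of the leaf \<open>vs ! i\<close>.  The ends of a tree
  edge between \<open>x\<close> and \<open>y\<close> are the pairs \<open>(x, y)\<close>, incident with \<open>x\<close>, and \<open>(y, x)\<close>,
  incident with \<open>y\<close>.
\<close>

definition halin_sum ::
    "'t set \<Rightarrow> 't set set \<Rightarrow> 't list \<Rightarrow> (nat \<Rightarrow> ('v, 'd) pole) \<Rightarrow>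
     (nat \<times> 'v + 't, nat \<times> 'd + 't \<times> 't) multipole" where
  "halin_sum V E vs F =
     \<lparr>verts = (SIGMA i : {..<length vs}. verts (F i)) <+> (V - set vs),
      ends = (SIGMA i : {..<length vs}. ends (F i)) <+>
        {(x, y). {x, y} \<in> E \<and> x \<notin> set vs \<and> y \<notin> set vs},
      mate = map_sum (\<lambda>(i, d). (i, mate (F i) d)) (\<lambda>(x, y). (y, x)),
      inc = case_sum
        (\<lambda>(i, d). if d \<in> residuals (F i) then Some (Inr (leaf_neighbour E (vs ! i)))
                  else map_option (\<lambda>v. Inl (i, v)) (inc (F i) d))
        (\<lambda>(x, y). Some (Inr x))\<rparr>"

definition halin_snark ::
    "(4 \<Rightarrow> bit ^ 4) \<Rightarrow>
     (nat \<times> ('v + 'w) + 't, nat \<times> ('d + 'e) + 't \<times> 't) multipole \<Rightarrow> bool" where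
  "halin_snark p H \<longleftrightarrow>
     (\<exists>V E vs F \<sigma> js.
        cubic_halin V E vs \<and>
        (\<forall>i < length vs. halin_fragment p (F i)) \<and>
        (\<forall>i < length vs. bij_betw (\<sigma> i) (outputs (F i)) (inputs (F (Suc i mod length vs)))) \<and>
        distinct js \<and>
        set js = {(Inl (i, b), Inl (Suc i mod length vs, \<sigma> i b)) | i b.
                    i < length vs \<and> b \<in> outputs (F i)} \<and>
        H = fold junction js (halin_sum V E vs F))"

end

theory Submission
  imports Defs
begin

text \<open>
  Label every edge by the set of those of the four perfect matchings which contain it; the three labels at a
  vertex partition the four indices.  Only two numbers matter at a connector: the sum of the sizes of its two
  labels (\<open>weight\<close>) and their symmetric difference (\<open>odd_part\<close>).  A decollineator preserves the symmetric
  difference, by parity, and a double count over the two colour classes shows that each index occurs in the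
  connectors of a bipartite pole exactly once more than in its residual label.  This leaves few possible
  transitions of a Halin fragment.  Merging two consecutive fragments at a tree vertex leaves even fewer, and
  these are closed under further merging, but no closed sequence of them around the perimeter exists.

  Planarity enters only through the fact that the leaves on one side of a tree edge are consecutive on the
  perimeter circuit: otherwise two disjoint paths of the tree would cross inside a closed curve, against
  the theta curve theorem.
\<close>

section \<open>Counting labels at a connector\<close>

text \<open>The labels are T-flows in disguise: three nonempty labels that partition four indices
  have sizes 1, 1, 2, and sending {i} to \<open>p i\<close> and a pair to the sum of the two points
  outside it turns such a partition into a line. So the defining property of a decollineator applies
  to them. It excludes only that both connectors are collinear, but with parity this forbids the
  type (3, 3) at the input of a fragment; as every output is joined to the next input, that type
  disappears from the whole perimeter. A residual label of size 1 lowers the weight by exactly one.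
  Two of them in a row run through 4, 3, 2, which makes a double label obtained by merging rigid.
  The final contradiction compares the two stretches of the perimeter cut off by one tree edge: they
  carry the same label and have exchanged ends. One stretch has to be a merged one, because the
  other may be a single fragment, which obeys only the weaker relation. Since junctions change the
  set of edges, labels are put on edge ends and pulled back through the junctions one at a
  time.\<close>

definition weight :: "(4 \<Rightarrow> nat) \<Rightarrow> nat" where
  "weight c = sum c UNIV"

definition odd_part :: "(4 \<Rightarrow> nat) \<Rightarrow> 4 set" where
  "odd_part c = {i. odd (c i)}"

definition pair_count :: "4 set \<Rightarrow> 4 set \<Rightarrow> 4 \<Rightarrow> nat" where
  "pair_count A B i = of_bool (i \<in> A) + of_bool (i \<in> B)"

definition connector_count :: "(4 \<Rightarrow> nat) \<Rightarrow> bool" where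
  "connector_count c \<longleftrightarrow> (\<exists>A B. card A \<in> {1, 2} \<and> card B \<in> {1, 2} \<and> c = pair_count A B)"

definition collinear_count :: "(4 \<Rightarrow> nat) \<Rightarrow> bool" where
  "collinear_count c \<longleftrightarrow> weight c = 3 \<and> card (odd_part c) = 3 \<or> weight c = 2 \<and> card (odd_part c) = 2"

text \<open>
  In terms of the tetrahedron, the pair (\<open>weight\<close>, \<open>card odd_part\<close>) of a connector is (2, 2) for two points
  \<open>p\<^sub>i\<close>, \<open>p\<^sub>j\<close>, (3, 3) for \<open>p\<^sub>i\<close>, \<open>p\<^sub>i + p\<^sub>j\<close>, (3, 1) for \<open>p\<^sub>i\<close>, \<open>p\<^sub>j + p\<^sub>k\<close>, (4, 2) for \<open>p\<^sub>i + p\<^sub>k\<close>, \<open>p\<^sub>j + p\<^sub>k\<close>,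
  (4, 4) for \<open>p\<^sub>i + p\<^sub>j\<close>, \<open>p\<^sub>k + p\<^sub>l\<close>, and (2, 0) or (4, 0) for a repeated point; the first two are the
  collinear ones.  In \<open>transition\<close>, the sets \<open>R\<close> of size 1 and 2 are the labels of single and double edges.
\<close>

definition transition :: "(4 \<Rightarrow> nat) \<Rightarrow> (4 \<Rightarrow> nat) \<Rightarrow> 4 set \<Rightarrow> bool" where
  "transition c d R \<longleftrightarrow>
     connector_count c \<and> connector_count d \<and> card (odd_part c) \<noteq> 3 \<and> card (odd_part d) \<noteq> 3 \<and>
     (\<forall>i. odd (c i + d i) \<longleftrightarrow> i \<notin> R) \<and>
     (card R = 1 \<and>
        (weight c = 3 \<and> weight d = 2 \<or> weight c = 4 \<and> card (odd_part c) = 2 \<and> weight d = 3) \<or>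
      card R = 2 \<and>
        (weight c = 3 \<longleftrightarrow> weight d = 3) \<and>
        (weight d = 4 \<and> card (odd_part d) = 2 \<longrightarrow>
           weight c = 4 \<and> card (odd_part c) = 2 \<or> odd_part c = {}) \<and>
        (weight c = 2 \<and> card (odd_part c) = 2 \<longrightarrow> weight d = 2))"

text \<open>The relation left after two stretches meet at a tree vertex. A double label on the third
  edge then comes from two single ones, which fixes the types at both ends of the merged
  stretch.\<close>

definition strong_transition :: "(4 \<Rightarrow> nat) \<Rightarrow> (4 \<Rightarrow> nat) \<Rightarrow> 4 set \<Rightarrow> bool" where
  "strong_transition c d R \<longleftrightarrow>
     transition c d R \<and>
     (card R = 2 \<longrightarrow> weight c = 4 \<and> card (odd_part c) = 2 \<and> weight d = 2 \<and> card (odd_part d) = 2)"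

section \<open>Connector types and the transitions between them\<close>

lemma weight_pair_count: "weight (pair_count A B) = card A + card B"
  by (simp add: weight_def pair_count_def sum.distrib)

text \<open>The complement of \<open>R\<close> is the symmetric difference of the two odd parts, so
  their intersection lies in \<open>R\<close>. Here \<open>k\<close> is the size of the
  intersection, and \<open>l\<close>, \<open>m\<close> are the sizes of the two differences; this
  turns the later case analyses into arithmetic.\<close>

lemma odd_part_cards:
  assumes "\<forall>i. odd (c i + d i) \<longleftrightarrow> i \<notin> R"
  obtains k l m where "card (odd_part c) = k + l" "card (odd_part d) = k + m"
    "l + m + card R = 4" "k \<le> card R"
proof
  let ?X = "odd_part c" and ?Y = "odd_part d"
  show "card ?X = card (?X \<inter> ?Y) + card (?X - ?Y)" "card ?Y = card (?X \<inter> ?Y) + card (?Y - ?X)"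
    by (metis card_Int_Diff finite, metis Int_commute card_Int_Diff finite)
  have R: "- R = (?X - ?Y) \<union> (?Y - ?X)"
    using assms by (auto simp: odd_part_def)
  have "card (?X - ?Y) + card (?Y - ?X) = card (- R)"
    unfolding R by (intro card_Un_disjoint[symmetric]) auto
  moreover have "card (R \<union> - R) = card R + card (- R)"
    by (intro card_Un_disjoint) auto
  ultimately show "card (?X - ?Y) + card (?Y - ?X) + card R = 4"
    by simp
  show "card (?X \<inter> ?Y) \<le> card R"
    using R by (intro card_mono) auto
qed

text \<open>With x common indices and y, z indices in only one of the two labels, the weight is 2x +
  y + z and the odd part has size y + z, where x + y and x + z are 1 or 2.\<close>

lemma connector_countE:
  assumes "connector_count c"
  obtains "weight c = 2" "card (odd_part c) \<in> {0, 2}"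
  | "weight c = 3" "card (odd_part c) \<in> {1, 3}"
  | "weight c = 4" "card (odd_part c) \<in> {0, 2, 4}"
proof -
  obtain A B where AB: "card A \<in> {1, 2}" "card B \<in> {1, 2}" "c = pair_count A B"
    using assms unfolding connector_count_def by blast
  have odd: "odd_part c = (A - B) \<union> (B - A)"
    by (auto simp: AB odd_part_def pair_count_def)
  have "card (odd_part c) = card (A - B) + card (B - A)"
    unfolding odd by (intro card_Un_disjoint) auto
  moreover have "card A = card (A \<inter> B) + card (A - B)" "card B = card (A \<inter> B) + card (B - A)"
    by (metis card_Int_Diff finite, metis Int_commute card_Int_Diff finite)
  moreover have "weight c = card A + card B"
    by (simp add: AB(3) weight_pair_count)
  moreover obtain x y z where "card (A \<inter> B) = x" "card (A - B) = y" "card (B - A) = z"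
    by blast
  ultimately have "card (odd_part c) = y + z" "weight c = 2 * x + y + z"
    "x + y = 1 \<or> x + y = 2" "x + z = 1 \<or> x + z = 2"
    using AB(1,2) by auto
  moreover from this have "x = 0 \<or> x = 1 \<or> x = 2"
    by linarith
  ultimately have "weight c = 2 \<and> (card (odd_part c) = 0 \<or> card (odd_part c) = 2) \<or>
      weight c = 3 \<and> (card (odd_part c) = 1 \<or> card (odd_part c) = 3) \<or>
      weight c = 4 \<and> (card (odd_part c) = 0 \<or> card (odd_part c) = 2 \<or> card (odd_part c) = 4)"
    by (elim disjE) simp_all
  then show thesis
    using that by blast
qed

text \<open>An odd part of size 3 occurs only at weight 3. Parity gives the other connector the same
  odd part, so both connectors would be collinear.\<close>

lemma no_half_line_input:
  assumes "\<forall>i. even (c i + d i)" "\<not> (collinear_count c \<and> collinear_count d)"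
    "connector_count c" "connector_count d"
  shows "card (odd_part c) \<noteq> 3"
proof -
  have "odd_part c = odd_part d"
    using assms(1) by (auto simp: odd_part_def)
  then show ?thesis
    using assms(2-4) by (auto elim!: connector_countE simp: collinear_count_def)
qed

text \<open>Here \<open>c\<close> is the input of the decollineator, \<open>d\<close> the connector
  between it and the bipartite pole, and \<open>e\<close> the output of that pole. Parity ties
  \<open>c\<close> to \<open>d\<close>, and the count ties \<open>d\<close> to \<open>e\<close>: the
  weights of \<open>d\<close> and \<open>e\<close> add up to 4 plus the size of \<open>R\<close>.
  The last hypothesis comes from the next fragment, whose input is joined to
  \<open>e\<close>.\<close>

lemma fragment_transition:
  assumes "\<forall>i. even (c i + d i)" "\<not> (collinear_count c \<and> collinear_count d)"
    and "\<forall>i. d i + e i = 1 + of_bool (i \<in> R)"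
    and "connector_count c" "connector_count d" "connector_count e"
    and "card R \<in> {1, 2}" "card (odd_part e) \<noteq> 3"
  shows "transition c e R"
proof -
  have cd: "odd_part c = odd_part d"
    using assms(1) by (auto simp: odd_part_def)
  have odd_ce: "\<forall>i. odd (c i + e i) \<longleftrightarrow> i \<notin> R"
  proof
    fix i
    have "even (c i + d i)" "d i + e i = 1 + of_bool (i \<in> R)"
      using assms(1,3) by auto
    then show "odd (c i + e i) \<longleftrightarrow> i \<notin> R"
      by (cases "i \<in> R") (auto; presburger)+
  qed
  have "weight d + weight e = (\<Sum>i\<in>UNIV. d i + e i)"
    by (simp add: weight_def sum.distrib)
  also have "\<dots> = 4 + card R"
    using assms(3) by (simp add: sum.distrib del: One_nat_def plus_1_eq_Suc)
  finally have w: "weight d + weight e = 4 + card R" .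
  have c3: "card (odd_part c) \<noteq> 3"
    using no_half_line_input assms by blast
  obtain k l m where klm: "card (odd_part c) = k + l" "card (odd_part e) = k + m"
    "l + m + card R = 4" "k \<le> card R"
    using odd_part_cards[OF odd_ce] .
  have coll: "\<not> (weight c = 2 \<and> weight d = 2 \<and> card (odd_part c) = 2)"
    using assms(2) cd by (auto simp: collinear_count_def)
  have e0: "odd_part c = {} \<longleftrightarrow> card (odd_part c) = 0"
    by simp
  have ty: "weight f = 2 \<and> (card (odd_part f) = 0 \<or> card (odd_part f) = 2) \<or>
      weight f = 3 \<and> card (odd_part f) = 1 \<or>
      weight f = 4 \<and> (card (odd_part f) = 0 \<or> card (odd_part f) = 2 \<or> card (odd_part f) = 4)"
    if "connector_count f" "card (odd_part f) \<noteq> 3" for f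
    using that by (auto elim: connector_countE)
  note c = ty[OF assms(4) c3] and d = ty[OF assms(5) c3[unfolded cd]] and e = ty[OF assms(6,8)]
  have we: "weight e = 2 \<or> weight e = 3 \<or> weight e = 4"
    and wd: "weight d = 2 \<or> weight d = 3 \<or> weight d = 4"
    using d e by metis+
  have "weight c = 3 \<longleftrightarrow> card (odd_part c) = 1"
    using c by (elim disjE conjE) simp_all
  moreover have "weight d = 3 \<longleftrightarrow> card (odd_part d) = 1"
    using d by (elim disjE conjE) simp_all
  ultimately have w3: "weight c = 3 \<longleftrightarrow> weight d = 3"
    using cd by simp
  have "card (odd_part c) = 0 \<or> card (odd_part c) = 2" if "weight c = 2"
    using c that by (elim disjE conjE) simp_all
  then have c2: "weight d = 2 \<Longrightarrow> weight c = 2 \<Longrightarrow> card (odd_part c) = 0"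
    using coll by metis
  have single: "weight c = 3 \<and> weight e = 2 \<or> weight c = 4 \<and> card (odd_part c) = 2 \<and> weight e = 3"
    if R: "card R = 1"
  proof -
    consider "weight d = 3" "weight e = 2" | "weight d = 2" "weight e = 3"
      using wd we w R by linarith
    then show ?thesis
    proof cases
      case 1
      then show ?thesis
        using w3 by simp
    next
      case 2
      then have "card (odd_part e) = 1"
        using e by simp
      \<comment> \<open>The overlap is 0 or 1, which leaves an odd part of size 2 or 4 at
        \<open>c\<close>; size 4 is impossible because \<open>d\<close> has the same odd part and
        weight 2. Then \<open>c\<close> has type (4, 2), since type (2, 2) would make both
        connectors collinear.\<close>
      then have "card (odd_part c) \<noteq> 0" "card (odd_part c) \<noteq> 4"
        using klm R 2 d cd by auto
      then show ?thesis
        using 2 c w3 c2 by (elim disjE conjE) simp_all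
    qed
  qed
  have double: "(weight c = 3 \<longleftrightarrow> weight e = 3) \<and>
        (weight e = 4 \<and> card (odd_part e) = 2 \<longrightarrow>
           weight c = 4 \<and> card (odd_part c) = 2 \<or> card (odd_part c) = 0) \<and>
        (weight c = 2 \<and> card (odd_part c) = 2 \<longrightarrow> weight e = 2)" if R: "card R = 2"
  proof -
    \<comment> \<open>The total 6 splits as 2 + 4, 3 + 3 or 4 + 2. An output of weight 4 means
      weight 2 at \<open>d\<close>, which excludes (4, 4) at \<open>c\<close> by the common odd part
      and (2, 2) by collinearity.\<close>
    have ed: "weight e = 6 - weight d"
      using w R by simp
    have "card (odd_part c) \<noteq> 4" if "weight d = 2"
      using that d cd by auto
    then show ?thesis
      using ed wd c w3 c2 by (elim disjE conjE) simp_all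
  qed
  consider "card R = 1" | "card R = 2"
    using assms(7) by blast
  then show ?thesis
  proof cases
    case 1
    then show ?thesis
      unfolding transition_def e0 using single assms(4,6,8) odd_ce c3 by simp
  next
    case 2
    then show ?thesis
      unfolding transition_def e0 using double assms(4,6,8) odd_ce c3 by simp
  qed
qed

text \<open>\<open>R\<close>, \<open>S\<close>, \<open>T\<close> are the labels at a tree vertex, so
  their sizes are 1, 1, 2 in some order. Two single transitions descend from weight 4 through 3 to
  2; a single one combined with a double one gives again a descent by one, because the double one
  preserves the weights that can occur next to it.\<close>

lemma transition_comp:
  assumes "transition c d R" "transition d e S"
    and "R \<inter> S = {}" "R \<inter> T = {}" "S \<inter> T = {}" "R \<union> S \<union> T = UNIV" "T \<noteq> {}"
  shows "strong_transition c e T"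
proof -
  have cd: "\<forall>i. odd (c i + d i) \<longleftrightarrow> i \<notin> R" and de: "\<forall>i. odd (d i + e i) \<longleftrightarrow> i \<notin> S"
    using assms(1,2) by (auto simp: transition_def)
  have ce: "\<forall>i. odd (c i + e i) \<longleftrightarrow> i \<notin> T"
  proof
    fix i
    show "odd (c i + e i) \<longleftrightarrow> i \<notin> T"
      using cd[rule_format, of i] de[rule_format, of i] assms(3-6) by auto
  qed
  have "card R + card S + card T = card (R \<union> S \<union> T)"
    using assms(3-5) by (subst card_Un_disjoint; (subst card_Un_disjoint)?) auto
  then have card4: "card R + card S + card T = 4"
    using assms(6) by simp
  have T0: "card T \<noteq> 0"
    using assms(7) by simp
  obtain k l m where klm: "card (odd_part c) = k + l" "card (odd_part e) = k + m"
    "l + m + card T = 4" "k \<le> card T"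
    using odd_part_cards[OF ce] .
  have empty: "odd_part c = {} \<longleftrightarrow> card (odd_part c) = 0"
    "odd_part d = {} \<longleftrightarrow> card (odd_part d) = 0"
    by simp_all
  note trc = assms(1)[unfolded transition_def empty] and trd = assms(2)[unfolded transition_def empty]
  note tr = trc trd
  have conn: "connector_count c" "connector_count d" "connector_count e"
    and no3: "card (odd_part c) \<noteq> 3" "card (odd_part d) \<noteq> 3" "card (odd_part e) \<noteq> 3"
    and RS: "card R = 1 \<or> card R = 2" "card S = 1 \<or> card S = 2"
    using tr by blast+
  have d: "weight d = 2 \<and> (card (odd_part d) = 0 \<or> card (odd_part d) = 2) \<or>
      weight d = 3 \<and> card (odd_part d) = 1 \<or>
      weight d = 4 \<and> (card (odd_part d) = 0 \<or> card (odd_part d) = 2 \<or> card (odd_part d) = 4)"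
    using conn(2) no3(2) by (auto elim: connector_countE)
  have c: "weight c = 2 \<and> (card (odd_part c) = 0 \<or> card (odd_part c) = 2) \<or>
      weight c = 3 \<and> card (odd_part c) = 1 \<or>
      weight c = 4 \<and> (card (odd_part c) = 0 \<or> card (odd_part c) = 2 \<or> card (odd_part c) = 4)"
    using conn(1) no3(1) by (auto elim: connector_countE)
  have e: "weight e = 2 \<and> (card (odd_part e) = 0 \<or> card (odd_part e) = 2) \<or>
      weight e = 3 \<and> card (odd_part e) = 1 \<or>
      weight e = 4 \<and> (card (odd_part e) = 0 \<or> card (odd_part e) = 2 \<or> card (odd_part e) = 4)"
    using conn(3) no3(3) by (auto elim: connector_countE)
  obtain k1 l1 m1 where klm1: "card (odd_part c) = k1 + l1" "card (odd_part d) = k1 + m1"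
      "l1 + m1 + card R = 4" "k1 \<le> card R"
    using odd_part_cards[OF cd] .
  obtain k2 l2 m2 where klm2: "card (odd_part d) = k2 + l2" "card (odd_part e) = k2 + m2"
      "l2 + m2 + card S = 4" "k2 \<le> card S"
    using odd_part_cards[OF de] .
  \<comment> \<open>Nonemptiness of \<open>T\<close> rules out that \<open>R\<close> and
    \<open>S\<close> are both double.\<close>
  consider "card R = 1" "card S = 1" | "card R = 1" "card S = 2" | "card R = 2" "card S = 1"
    using RS card4 T0 by linarith
  then show ?thesis
  proof cases
    case 1
    then have "weight c = 3 \<and> weight d = 2 \<or> weight c = 4 \<and> card (odd_part c) = 2 \<and> weight d = 3"
      "weight d = 3 \<and> weight e = 2 \<or> weight d = 4 \<and> card (odd_part d) = 2 \<and> weight e = 3"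
      using trc trd by simp_all
    then have w: "weight c = 4" "card (odd_part c) = 2" "weight d = 3" "weight e = 2"
      by (elim disjE conjE; simp)+
    moreover have "card (odd_part e) = 2"
      using 1 w(3,4) d e klm2 by (elim disjE conjE) simp_all
    ultimately show ?thesis
      using 1 conn no3 ce card4 unfolding strong_transition_def transition_def empty
      by simp
  next
    case 2
    have "weight c = 3 \<and> weight d = 2 \<or> weight c = 4 \<and> card (odd_part c) = 2 \<and> weight d = 3"
      using 2 trc by simp
    moreover have "card (odd_part d) = 2" if "weight c = 3" "weight d = 2"
      using 2 that c d klm1 by (elim disjE conjE) simp_all
    moreover have "weight d = 2 \<Longrightarrow> card (odd_part d) = 2 \<Longrightarrow> weight e = 2"
      "weight d = 3 \<longleftrightarrow> weight e = 3"
      using trd 2 by simp_all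
    ultimately have "weight c = 3 \<and> weight e = 2 \<or>
        weight c = 4 \<and> card (odd_part c) = 2 \<and> weight e = 3"
      by metis
    then show ?thesis
      using 2 conn no3 ce card4 unfolding strong_transition_def transition_def empty
      by simp
  next
    case 3
    have "weight d = 3 \<and> weight e = 2 \<or> weight d = 4 \<and> card (odd_part d) = 2 \<and> weight e = 3"
      using 3 trd by simp
    moreover have "weight c = 3 \<longleftrightarrow> weight d = 3"
      "weight d = 4 \<Longrightarrow> card (odd_part d) = 2 \<Longrightarrow>
         weight c = 4 \<and> card (odd_part c) = 2 \<or> card (odd_part c) = 0"
      using trc 3 by simp_all
    \<comment> \<open>An output of weight 3 has one odd index; as \<open>T\<close> is single, the
      odd part of \<open>c\<close> has size 2 or 4, so the alternative of an empty odd part drops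
      out.\<close>
    moreover have "card (odd_part c) \<noteq> 0" if "weight e = 3"
      using that 3 card4 klm e by (elim disjE conjE) simp_all
    ultimately have "weight c = 3 \<and> weight e = 2 \<or>
        weight c = 4 \<and> card (odd_part c) = 2 \<and> weight e = 3"
      by metis
    then show ?thesis
      using 3 conn no3 ce card4 unfolding strong_transition_def transition_def empty
      by simp
  qed
qed

text \<open>A single label would lower the weight in both directions. With a double label the strong
  relation goes from (4, 2) to (2, 2), and a double transition starting at (2, 2) cannot leave
  weight 2.\<close>

lemma strong_transition_closed:
  assumes "strong_transition c d R" "transition d c R"
  shows False
proof -
  note cd = assms(1)[unfolded strong_transition_def transition_def]
    and dc = assms(2)[unfolded transition_def]
  consider "card R = 1" | "card R = 2"
    using dc by blast
  then show False
  proof cases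
    case 1
    then have "weight c = 3 \<and> weight d = 2 \<or> weight c = 4 \<and> weight d = 3"
      "weight d = 3 \<and> weight c = 2 \<or> weight d = 4 \<and> weight c = 3"
      using cd dc by (metis one_eq_numeral_iff semiring_norm(83))+
    then show False
      by (elim disjE conjE) simp_all
  next
    case 2
    then have "weight c = 4" "weight d = 2" "card (odd_part d) = 2"
      using cd by simp_all
    moreover have "weight c = 2" if "weight d = 2" "card (odd_part d) = 2"
      using dc 2 that by simp
    ultimately show False
      by simp
  qed
qed

section \<open>Crossing paths in a plane drawing\<close>

fun path_edges :: "'a list \<Rightarrow> 'a set set" where
  "path_edges (x # y # zs) = insert {x, y} (path_edges (y # zs))"
| "path_edges _ = {}"

lemma path_edges_append: "path_edges (xs @ y # ys) = path_edges (xs @ [y]) \<union> path_edges (y # ys)"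
  by (induction xs rule: path_edges.induct) (auto simp: neq_Nil_conv)

lemma path_edges_subset: "e \<in> path_edges xs \<Longrightarrow> e \<subseteq> set xs"
  by (induction xs rule: path_edges.induct) auto

lemma path_edges_nth: "path_edges xs = {{xs ! i, xs ! Suc i} | i. Suc i < length xs}"
proof (induction xs rule: path_edges.induct)
  case (1 x y zs)
  have "{{(x # y # zs) ! i, (x # y # zs) ! Suc i} | i. Suc i < length (x # y # zs)} =
      insert {x, y} {{(y # zs) ! i, (y # zs) ! Suc i} | i. Suc i < length (y # zs)}"
    (is "?A = insert _ ?B")
  proof (intro equalityI subsetI)
    fix e assume "e \<in> ?A"
    then obtain i where i: "e = {(x # y # zs) ! i, (x # y # zs) ! Suc i}" "Suc i < length (x # y # zs)"
      by blast
    then show "e \<in> insert {x, y} ?B"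
      by (cases i) auto
  next
    fix e assume "e \<in> insert {x, y} ?B"
    then consider "e = {x, y}" | i where "e = {(y # zs) ! i, (y # zs) ! Suc i}" "Suc i < length (y # zs)"
      by blast
    then show "e \<in> ?A"
    proof cases
      case 1
      then show ?thesis
        by (intro CollectI exI[of _ 0]) simp
    next
      case (2 i)
      then show ?thesis
        by (intro CollectI exI[of _ "Suc i"]) simp
    qed
  qed
  then show ?case
    using 1 by simp
qed auto

lemma circuit_edges_eq:
  assumes "vs \<noteq> []"
  shows "circuit_edges vs = path_edges (vs @ [hd vs])"
proof -
  have "(vs @ [hd vs]) ! i = vs ! i" "(vs @ [hd vs]) ! Suc i = vs ! (Suc i mod length vs)"
    if "i < length vs" for i
    using that assms by (cases "Suc i = length vs"; auto simp: nth_append hd_conv_nth)+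
  then show ?thesis
    unfolding circuit_edges_def path_edges_nth by (intro Collect_cong ex_cong1) auto
qed

text \<open>Two vertices cut the circuit into the two arcs that later form the outer boundary of a
  theta curve. If \<open>as\<close> is empty, the second arc closes up at \<open>a\<close>
  itself.\<close>

lemma circuit_edges_split:
  "circuit_edges (as @ a # bs @ b # cs) = path_edges (a # bs @ [b]) \<union> path_edges (b # cs @ as @ [a])"
proof (cases as)
  case Nil
  have "path_edges ((a # bs) @ b # cs @ [a]) = path_edges ((a # bs) @ [b]) \<union> path_edges (b # cs @ [a])"
    by (rule path_edges_append)
  with Nil show ?thesis
    by (simp add: circuit_edges_eq)
next
  case (Cons h as')
  have "path_edges (as @ a # bs @ b # cs @ [h]) =
      path_edges (as @ [a]) \<union> path_edges ((a # bs) @ b # cs @ [h])"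
    using path_edges_append[of as a "bs @ b # cs @ [h]"] by simp
  also have "\<dots> = path_edges (as @ [a]) \<union> path_edges (a # bs @ [b]) \<union> path_edges (b # cs @ [h])"
    using path_edges_append[of "a # bs" b "cs @ [h]"] by auto
  finally show ?thesis
    using Cons path_edges_append[of "b # cs" h "as' @ [a]"] by (auto simp: circuit_edges_eq)
qed

lemma plane_drawing_Int:
  assumes "plane_drawing V E pos \<gamma>" "e \<in> E" "f \<in> E" "e \<noteq> f"
  shows "path_image (\<gamma> e) \<inter> path_image (\<gamma> f) = pos ` (e \<inter> f)"
  using assms by (simp add: plane_drawing_def)

lemma plane_drawing_ends:
  assumes "plane_drawing V E pos \<gamma>" "e \<in> E"
  shows "arc (\<gamma> e)" "pos ` e \<subseteq> path_image (\<gamma> e)"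
proof -
  have "arc (\<gamma> e)" "path_image (\<gamma> e) \<inter> pos ` V = pos ` e"
    using assms by (simp_all add: plane_drawing_def)
  then show "arc (\<gamma> e)" "pos ` e \<subseteq> path_image (\<gamma> e)"
    by blast+
qed

text \<open>Edge curves may be parametrized in either direction, hence the reversal. Joining keeps
  an arc: the first vertex does not recur, so the first edge meets the remaining ones only in its
  second vertex.\<close>

lemma plane_drawing_arc:
  assumes "plane_drawing V E pos \<gamma>" "distinct xs" "2 \<le> length xs" "path_edges xs \<subseteq> E"
  obtains c where "arc c" "pathstart c = pos (hd xs)" "pathfinish c = pos (last xs)"
    "path_image c = (\<Union>e \<in> path_edges xs. path_image (\<gamma> e))"
proof -
  have edge: "\<exists>c. arc c \<and> pathstart c = pos x \<and> pathfinish c = pos y \<and> path_image c = path_image (\<gamma> {x, y})"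
    if "{x, y} \<in> E" for x y
  proof -
    have "arc (\<gamma> {x, y})" "{pathstart (\<gamma> {x, y}), pathfinish (\<gamma> {x, y})} = {pos x, pos y}"
      using assms(1) that unfolding plane_drawing_def by auto
    then show ?thesis
      by (auto simp: doubleton_eq_iff intro: exI[of _ "\<gamma> {x, y}"] exI[of _ "reversepath (\<gamma> {x, y})"]
          arc_reversepath)
  qed
  have "\<exists>c. arc c \<and> pathstart c = pos (hd xs) \<and> pathfinish c = pos (last xs) \<and>
      path_image c = (\<Union>e \<in> path_edges xs. path_image (\<gamma> e))"
    using assms(2-4)
  proof (induction xs rule: path_edges.induct)
    case (1 x y zs)
    obtain c where c: "arc c" "pathstart c = pos x" "pathfinish c = pos y"
        "path_image c = path_image (\<gamma> {x, y})"
      using edge[of x y] "1.prems" by auto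
    show ?case
    proof (cases zs)
      case Nil
      with c show ?thesis
        by auto
    next
      case (Cons z zs')
      obtain d where d: "arc d" "pathstart d = pos y" "pathfinish d = pos (last (y # zs))"
          "path_image d = (\<Union>e \<in> path_edges (y # zs). path_image (\<gamma> e))"
        using "1.IH" "1.prems" Cons by auto
      have "path_image (\<gamma> {x, y}) \<inter> path_image (\<gamma> e) \<subseteq> {pos y}" if e: "e \<in> path_edges (y # zs)" for e
      proof -
        have "e \<subseteq> set (y # zs)"
          using path_edges_subset[OF e] .
        then have "x \<notin> e"
          using "1.prems"(1) by auto
        moreover from this have "{x, y} \<noteq> e" "{x, y} \<in> E" "e \<in> E"
          using e "1.prems"(3) by auto
        then have "path_image (\<gamma> {x, y}) \<inter> path_image (\<gamma> e) = pos ` ({x, y} \<inter> e)"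
          using plane_drawing_Int[OF assms(1)] by simp
        ultimately show ?thesis
          by auto
      qed
      then have "path_image c \<inter> path_image d \<subseteq> {pathstart d}"
        unfolding c d by blast
      then have "arc (c +++ d)"
        using c d by (intro arc_join) auto
      then show ?thesis
        using c d by (intro exI[of _ "c +++ d"]) (auto simp: path_image_join)
    qed
  qed auto
  then show thesis
    using that by blast
qed

lemma plane_drawing_paths_Int:
  assumes "plane_drawing V E pos \<gamma>" "path_edges xs \<subseteq> E" "path_edges ys \<subseteq> E"
    "path_edges xs \<inter> path_edges ys = {}"
  shows "(\<Union>e \<in> path_edges xs. path_image (\<gamma> e)) \<inter> (\<Union>e \<in> path_edges ys. path_image (\<gamma> e))
    \<subseteq> pos ` (set xs \<inter> set ys)"
proof
  fix z
  assume "z \<in> (\<Union>e \<in> path_edges xs. path_image (\<gamma> e)) \<inter> (\<Union>e \<in> path_edges ys. path_image (\<gamma> e))"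
  then obtain e f where ef: "e \<in> path_edges xs" "f \<in> path_edges ys"
      "z \<in> path_image (\<gamma> e) \<inter> path_image (\<gamma> f)"
    by blast
  moreover from this have "e \<noteq> f" "e \<in> E" "f \<in> E"
    using assms by auto
  ultimately have "z \<in> pos ` (e \<inter> f)"
    using plane_drawing_Int[OF assms(1), of e f] by blast
  then show "z \<in> pos ` (set xs \<inter> set ys)"
    using path_edges_subset ef(1,2) by blast
qed

section \<open>The theta curve argument\<close>

lemma closure_arc_endless:
  fixes q :: "real \<Rightarrow> complex"
  assumes "arc q"
  shows "path_image q \<subseteq> closure (path_image q - {pathstart q, pathfinish q})"
proof -
  have "path_image q = q ` closure {0<..<1}"
    by (simp add: path_image_def)
  also have "\<dots> \<subseteq> closure (q ` {0<..<1})"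
    using arc_imp_path[OF assms]
    by (intro image_closure_subset closure_subset) (simp_all add: path_def)
  finally show ?thesis
    using simple_path_endless[OF arc_imp_simple_path[OF assms]] by simp
qed

text \<open>The arc \<open>p\<close> splits the inside of the closed curve into two regions. If
  \<open>q\<close> missed \<open>p\<close>, then \<open>q\<close> without its ends, being connected,
  would lie in one of them, say the one bounded by \<open>c1\<close> and \<open>p\<close>. Its end
  \<open>y\<close> would be in the closure of that region but off its boundary curve, hence inside
  the closed curve although it lies on it.\<close>

lemma crossing_arcs_intersect:
  fixes c1 c2 p q :: "real \<Rightarrow> complex"
  assumes "arc c1" "pathstart c1 = a" "pathfinish c1 = b"
    and "arc c2" "pathstart c2 = a" "pathfinish c2 = b"
    and "arc p" "pathstart p = a" "pathfinish p = b"
    and "arc q" "pathstart q = x" "pathfinish q = y"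
    and "path_image c1 \<inter> path_image c2 = {a, b}"
    and "path_image c1 \<inter> path_image p = {a, b}"
    and "path_image c2 \<inter> path_image p = {a, b}"
    and x: "x \<in> path_image c1" and y: "y \<in> path_image c2"
    and p: "path_image p - {a, b} \<subseteq> inside (path_image c1 \<union> path_image c2)"
    and q: "path_image q - {x, y} \<subseteq> inside (path_image c1 \<union> path_image c2)"
  shows "path_image p \<inter> path_image q \<noteq> {}"
proof
  assume pq: "path_image p \<inter> path_image q = {}"
  let ?I = "inside (path_image c1 \<union> path_image c2)"
  let ?I1 = "inside (path_image c1 \<union> path_image p)" and ?I2 = "inside (path_image c2 \<union> path_image p)"
  let ?q = "path_image q - {x, y}"
  note simple = arc_imp_simple_path
  have "a \<noteq> b"
    using arc_distinct_ends[OF assms(1)] assms(2,3) by simp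
  have pne: "path_image p - {a, b} \<noteq> {}"
    using nonempty_simple_path_endless[OF simple[OF assms(7)]] assms(8,9) by simp
  then have "path_image p \<inter> ?I \<noteq> {}"
    using p by blast
  then have disj: "?I1 \<inter> ?I2 = {}" and un: "?I1 \<union> ?I2 \<union> (path_image p - {a, b}) = ?I"
    using split_inside_simple_closed_curve[OF simple[OF assms(1)] assms(2,3) simple[OF assms(4)]
        assms(5,6) simple[OF assms(7)] assms(8,9) \<open>a \<noteq> b\<close> assms(13-15)] by blast+
  have qI: "?q \<subseteq> ?I1 \<union> ?I2"
    using q pq un by blast
  have conn: "connected ?q"
    using connected_simple_path_endless[OF simple[OF assms(10)]] assms(11,12) by simp
  have closed: "closed (path_image c1 \<union> path_image p)" "closed (path_image c2 \<union> path_image p)"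
    using assms(1,4,7) by (auto intro!: closed_Un closed_path_image arc_imp_path)
  have ends: "x \<in> closure ?q" "y \<in> closure ?q"
    using closure_arc_endless[OF assms(10)] assms(11,12) pathstart_in_path_image[of q]
      pathfinish_in_path_image[of q] by auto
  have xy: "x \<notin> path_image p" "y \<notin> path_image p"
    using pq assms(11,12) pathstart_in_path_image[of q] pathfinish_in_path_image[of q] by auto
  have xy': "x \<notin> path_image c2" "y \<notin> path_image c1"
    using assms(13-15) x y xy by blast+
  have "?I1 \<inter> ?q = {} \<or> ?I2 \<inter> ?q = {}"
    using connectedD[OF conn open_inside[OF closed(1)] open_inside[OF closed(2)] _ qI] disj by simp
  then have "?q \<subseteq> ?I1 \<or> ?q \<subseteq> ?I2"
    using qI by blast
  then have "y \<in> ?I1 \<or> x \<in> ?I2"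
  proof
    assume "?q \<subseteq> ?I1"
    then have "y \<in> closure ?I1"
      using ends closure_mono by blast
    then show ?thesis
      using closure_inside_subset[OF closed(1)] xy xy' by blast
  next
    assume "?q \<subseteq> ?I2"
    then have "x \<in> closure ?I2"
      using ends closure_mono by blast
    then show ?thesis
      using closure_inside_subset[OF closed(2)] xy xy' by blast
  qed
  then have "x \<in> ?I \<or> y \<in> ?I"
    using un by blast
  then show False
    using x y inside_no_overlap by blast
qed

text \<open>\<open>outside J\<close> is connected and contains \<open>outside K\<close>. If they
  differed, \<open>outside J\<close> would meet the frontier of \<open>outside K\<close>, which is
  \<open>J\<close>; this is impossible.\<close>

lemma inside_of_outer_face:
  fixes J K :: "complex set"
  assumes "bounded K" "J \<subseteq> K" "frontier (outside K) = J"
  shows "K \<subseteq> J \<union> inside J"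
proof -
  have "outside J \<subseteq> outside K"
  proof (rule ccontr)
    assume "\<not> outside J \<subseteq> outside K"
    moreover have "outside K \<noteq> {}" "outside K \<subseteq> outside J"
      using assms outside_bounded_nonempty outside_mono by blast+
    moreover have "connected (outside J)"
      using assms by (intro connected_outside) (auto intro: bounded_subset)
    ultimately have "outside J \<inter> frontier (outside K) \<noteq> {}"
      by (intro connected_Int_frontier) auto
    then show False
      using assms(3) outside_no_overlap by blast
  qed
  then have "K \<inter> outside J = {}"
    using outside_no_overlap by blast
  then show ?thesis
    unfolding union_with_inside by blast
qed

text \<open>\<open>P\<close> and the two perimeter arcs between its ends form a theta curve, and the
  ends of \<open>Q\<close> lie on different perimeter arcs. Since the perimeter bounds the outer
  face, both tree paths run inside it.\<close>

lemma halin_paths_cross: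
  assumes "finite V" "finite E"
    and pd: "plane_drawing V (E \<union> circuit_edges vs) pos \<gamma>"
    and fr: "frontier (outside (drawing_image V (E \<union> circuit_edges vs) pos \<gamma>)) =
      drawing_image (set vs) (circuit_edges vs) pos \<gamma>"
    and "distinct vs" "set vs \<subseteq> V" "E \<inter> circuit_edges vs = {}"
    and vs: "vs = as @ a # bs @ b # cs" and "x \<in> set bs" "y \<in> set cs \<union> set as"
    and P: "distinct P" "hd P = a" "last P = b" "path_edges P \<subseteq> E" "set P \<inter> set vs = {a, b}"
    and Q: "distinct Q" "hd Q = x" "last Q = y" "path_edges Q \<subseteq> E" "set Q \<inter> set vs = {x, y}"
  shows "set P \<inter> set Q \<noteq> {}"
proof
  assume PQ: "set P \<inter> set Q = {}"
  let ?C = "circuit_edges vs"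
  let ?im = "\<lambda>xs. \<Union>e \<in> path_edges xs. path_image (\<gamma> e)"
  \<comment> \<open>The second arc is reversed so that both run from \<open>a\<close> to
    \<open>b\<close>.\<close>
  let ?xs = "a # bs @ [b]" and ?ys = "rev (b # cs @ as @ [a])"
  have rev: "path_edges (rev xs) = path_edges xs" for xs :: "'a list"
  proof (induction xs rule: path_edges.induct)
    case (1 u v zs)
    then show ?case
      using path_edges_append[of "rev zs" v "[u]"] by auto
  qed auto
  have C: "?C = path_edges ?xs \<union> path_edges ?ys"
    unfolding vs circuit_edges_split rev by simp
  have len: "2 \<le> length P" "2 \<le> length Q"
  proof -
    have "2 \<le> length R" if "hd R \<noteq> last R" "R \<noteq> []" for R :: "'a list"
      using that by (cases R rule: path_edges.cases) auto
    moreover have "P \<noteq> []" "Q \<noteq> []"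
      using P(5) Q(5) by auto
    moreover have "hd P \<noteq> last P" "hd Q \<noteq> last Q"
      using P(2,3) Q(2,3) assms(5,9,10) vs by auto
    ultimately show "2 \<le> length P" "2 \<le> length Q"
      by blast+
  qed
  obtain c1 where c1: "arc c1" "pathstart c1 = pos a" "pathfinish c1 = pos b" "path_image c1 = ?im ?xs"
    using plane_drawing_arc[OF pd, of ?xs] C assms(5) vs by auto
  obtain c2 where c2: "arc c2" "pathstart c2 = pos a" "pathfinish c2 = pos b" "path_image c2 = ?im ?ys"
  proof -
    have "distinct ?ys"
      using assms(5) vs by auto
    then show ?thesis
      using plane_drawing_arc[OF pd, of ?ys] C that by auto
  qed
  obtain p where p: "arc p" "pathstart p = pos a" "pathfinish p = pos b" "path_image p = ?im P"
    using plane_drawing_arc[OF pd P(1) len(1)] P by auto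
  obtain q where q: "arc q" "pathstart q = pos x" "pathfinish q = pos y" "path_image q = ?im Q"
    using plane_drawing_arc[OF pd Q(1) len(2)] Q by auto
  have inj: "inj_on pos V" 
    using pd unfolding plane_drawing_def by auto
  have PV: "set P \<inter> set ?xs = {a, b}" "set P \<inter> set ?ys = {a, b}"
    using P(5) vs by auto
  have QV: "set Q \<inter> set vs = {x, y}"
    using Q(5) vs by auto
  have disj: "path_edges ?xs \<inter> path_edges P = {}" "path_edges ?ys \<inter> path_edges P = {}"
    "path_edges P \<inter> path_edges Q = {}"
  proof -
    show "path_edges ?xs \<inter> path_edges P = {}" "path_edges ?ys \<inter> path_edges P = {}"
      using P(4) assms(7) C by auto
    show "path_edges P \<inter> path_edges Q = {}"
    proof (rule ccontr)
      assume "path_edges P \<inter> path_edges Q \<noteq> {}"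
      then obtain e where e: "e \<in> path_edges P" "e \<in> path_edges Q"
        by blast
      then have "e = {}"
        using path_edges_subset PQ by blast
      then show False
        using e(1) unfolding path_edges_nth by auto
    qed
  qed
  \<comment> \<open>A common edge could only join \<open>a\<close> and \<open>b\<close>. As
    \<open>bs\<close> contains \<open>x\<close>, every edge of the first arc has an end strictly
    between them.\<close>
  have "path_edges ?xs \<inter> path_edges ?ys = {}"
  proof (rule ccontr)
    assume "path_edges ?xs \<inter> path_edges ?ys \<noteq> {}"
    then obtain e where e: "e \<in> path_edges ?xs" "e \<in> path_edges ?ys"
      by blast
    have "e \<subseteq> set ?xs \<inter> set ?ys"
      using path_edges_subset e by blast
    moreover have "set ?xs \<inter> set ?ys = {a, b}"
      using assms(5) vs by auto
    ultimately have "e \<subseteq> {a, b}"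
      by simp
    obtain i where i: "e = {?xs ! i, ?xs ! Suc i}" "Suc i < length ?xs"
      using e(1) unfolding path_edges_nth by blast
    have dx: "distinct ?xs"
      using assms(5) vs by auto
    have "\<exists>j. 0 < j \<and> Suc j < length ?xs \<and> ?xs ! j \<in> e"
    proof (cases i)
      case 0
      then show ?thesis
        using i assms(9) by (intro exI[of _ 1]) (auto simp: nth_append)
    next
      case (Suc k)
      then show ?thesis
        using i by (intro exI[of _ i]) auto
    qed
    then obtain j where j: "0 < j" "Suc j < length ?xs" "?xs ! j \<in> {a, b}"
      using \<open>e \<subseteq> {a, b}\<close> by blast
    then have "?xs ! j = ?xs ! 0 \<or> ?xs ! j = ?xs ! (length ?xs - 1)"
      by (auto simp: nth_append)
    then have "j = 0 \<or> j = length ?xs - 1"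
      using nth_eq_iff_index_eq[OF dx, of j 0] nth_eq_iff_index_eq[OF dx, of j "length ?xs - 1"] j(2)
      by (metis Suc_lessD diff_less length_greater_0_conv list.distinct(1) zero_less_one)
    then show False
      using j by auto
  qed
  note disj = disj this
  have sub: "path_edges ?xs \<subseteq> E \<union> ?C" "path_edges ?ys \<subseteq> E \<union> ?C" "path_edges P \<subseteq> E \<union> ?C"
    "path_edges Q \<subseteq> E \<union> ?C"
    using C P Q by auto
  have "path_image c1 \<inter> path_image c2 \<subseteq> pos ` (set ?xs \<inter> set ?ys)"
    unfolding c1 c2 using plane_drawing_paths_Int[OF pd sub(1,2)] disj by simp
  moreover have "pos ` (set ?xs \<inter> set ?ys) = {pos a, pos b}"
  proof -
    have "set ?xs \<inter> set ?ys = {a, b}"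
      using assms(5) vs by auto
    then show ?thesis
      by (simp only: image_insert image_empty)
  qed
  ultimately have sub12: "path_image c1 \<inter> path_image c2 \<subseteq> {pos a, pos b}"
    by (rule subset_trans[OF _ equalityD1])
  have sub1p: "path_image c1 \<inter> path_image p \<subseteq> {pos a, pos b}"
    using plane_drawing_paths_Int[OF pd sub(1,3)] disj PV unfolding c1 p by auto
  have sub2p: "path_image c2 \<inter> path_image p \<subseteq> {pos a, pos b}"
    using plane_drawing_paths_Int[OF pd sub(2,3)] disj PV unfolding c2 p by auto
  have ends: "{pos a, pos b} \<subseteq> path_image c1" "{pos a, pos b} \<subseteq> path_image c2"
    "{pos a, pos b} \<subseteq> path_image p"
  proof -
    have "{pathstart c, pathfinish c} \<subseteq> path_image c" for c :: "real \<Rightarrow> complex"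
      by (simp add: pathstart_in_path_image pathfinish_in_path_image)
    from this[of c1] this[of c2] this[of p] show "{pos a, pos b} \<subseteq> path_image c1"
      "{pos a, pos b} \<subseteq> path_image c2" "{pos a, pos b} \<subseteq> path_image p"
      unfolding c1(2,3) c2(2,3) p(2,3) by simp_all
  qed
  have Int: "path_image c1 \<inter> path_image c2 = {pos a, pos b}"
    "path_image c1 \<inter> path_image p = {pos a, pos b}" "path_image c2 \<inter> path_image p = {pos a, pos b}"
    by (intro equalityI Int_greatest sub12 sub1p sub2p ends)+
  have pq: "path_image p \<inter> path_image q = {}"
    using plane_drawing_paths_Int[OF pd sub(3,4) disj(3)] PQ unfolding p q by simp
  have vertex: "pos v \<in> ?im xs" if "v \<in> set xs" "2 \<le> length xs" "path_edges xs \<subseteq> E \<union> ?C" for v xs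
  proof -
    have "\<exists>e \<in> path_edges xs. v \<in> e"
      using that(1,2)
    proof (induction xs rule: path_edges.induct)
      case (1 u w zs)
      then show ?case
        by (cases zs) auto
    qed auto
    then obtain e where e: "e \<in> path_edges xs" "v \<in> e"
      by blast
    then have "pos ` e \<subseteq> path_image (\<gamma> e)"
      using plane_drawing_ends(2)[OF pd] that(3) by blast
    then show ?thesis
      using e by blast
  qed
  have J: "drawing_image (set vs) ?C pos \<gamma> = path_image c1 \<union> path_image c2"
  proof -
    have "pos v \<in> path_image c1 \<union> path_image c2" if "v \<in> set vs" for v
    proof -
      have "v \<in> set ?xs \<or> v \<in> set ?ys"
        using that vs by auto
      then show ?thesis
        using vertex[of v ?xs] vertex[of v ?ys] sub unfolding c1(4) c2(4) by auto
    qed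
    then have "pos ` set vs \<subseteq> path_image c1 \<union> path_image c2"
      by blast
    moreover have "(\<Union>e \<in> ?C. path_image (\<gamma> e)) = path_image c1 \<union> path_image c2"
      unfolding C c1(4) c2(4) by blast
    ultimately show ?thesis
      unfolding drawing_image_def by blast
  qed
  have arcs: "compact (path_image (\<gamma> e))" if "e \<in> E \<union> ?C" for e
    using plane_drawing_ends(1)[OF pd that] by (intro compact_path_image arc_imp_path)
  have "finite (E \<union> ?C)"
    using assms(2) by (simp add: circuit_edges_def)
  then have "compact (drawing_image V (E \<union> ?C) pos \<gamma>)"
    unfolding drawing_image_def using arcs assms(1)
    by (intro compact_Un compact_UN) (simp_all add: finite_imp_compact)
  then have bnd: "bounded (drawing_image V (E \<union> ?C) pos \<gamma>)"
    by (rule compact_imp_bounded)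
  have "drawing_image (set vs) ?C pos \<gamma> \<subseteq> drawing_image V (E \<union> ?C) pos \<gamma>"
    using assms(6) unfolding drawing_image_def by blast
  note inner = inside_of_outer_face[OF bnd this fr, unfolded J]
  have "path_image p \<union> path_image q \<subseteq> drawing_image V (E \<union> ?C) pos \<gamma>"
    using sub unfolding drawing_image_def p q by blast
  then have pin: "path_image p \<union> path_image q \<subseteq> path_image c1 \<union> path_image c2 \<union> inside (path_image c1 \<union> path_image c2)"
    using inner by blast
  \<comment> \<open>Tree edges are not perimeter edges, so the curves meet only in common vertices,
    and the path \<open>Q\<close> has no perimeter vertices except its ends.\<close>
  have "path_image q \<inter> path_image c1 \<subseteq> pos ` (set Q \<inter> set ?xs)"
    unfolding q c1 using Q(4) C assms(7) by (intro plane_drawing_paths_Int[OF pd sub(4,1)]) blast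
  moreover have "path_image q \<inter> path_image c2 \<subseteq> pos ` (set Q \<inter> set ?ys)"
    unfolding q c2 using Q(4) C assms(7) by (intro plane_drawing_paths_Int[OF pd sub(4,2)]) blast
  moreover have "set Q \<inter> set ?xs \<subseteq> {x, y}" "set Q \<inter> set ?ys \<subseteq> {x, y}"
    using QV vs by auto
  ultimately have "path_image q \<inter> (path_image c1 \<union> path_image c2) \<subseteq> {pos x, pos y}"
    by blast
  then have "path_image q - {pos x, pos y} \<subseteq> inside (path_image c1 \<union> path_image c2)"
    using pin by blast
  moreover have "path_image p - {pos a, pos b} \<subseteq> inside (path_image c1 \<union> path_image c2)"
    using pin Int by blast
  moreover have "pos x \<in> path_image c1" "pos y \<in> path_image c2"
    using vertex[of x ?xs] vertex[of y ?ys] sub assms(9,10) unfolding c1(4) c2(4) by auto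
  ultimately have "path_image p \<inter> path_image q \<noteq> {}"
    using crossing_arcs_intersect[OF c1(1-3) c2(1-3) p(1-3) q(1-3) Int] by blast
  then show False
    using pq by blast
qed

section \<open>Sides of tree edges\<close>

definition side :: "'t set set \<Rightarrow> 't \<Rightarrow> 't \<Rightarrow> 't set" where
  "side E x y = {z. (x, z) \<in> {(a, b). {a, b} \<in> E - {{x, y}}}\<^sup>*}"

lemma side_refl: "x \<in> side E x y"
  by (simp add: side_def)

lemma side_step: "z \<in> side E x y \<Longrightarrow> {z, w} \<in> E \<Longrightarrow> {z, w} \<noteq> {x, y} \<Longrightarrow> w \<in> side E x y"
  by (auto simp: side_def intro: rtrancl_into_rtrancl)

lemma side_induct [consumes 1, case_names refl step]:
  assumes "z \<in> side E x y" "P x"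
    and "\<And>u v. u \<in> side E x y \<Longrightarrow> P u \<Longrightarrow> {u, v} \<in> E \<Longrightarrow> {u, v} \<noteq> {x, y} \<Longrightarrow> P v"
  shows "P z"
proof -
  have "(x, z) \<in> {(a, b). {a, b} \<in> E - {{x, y}}}\<^sup>*"
    using assms(1) by (simp add: side_def)
  then show ?thesis
    by (induction rule: rtrancl_induct) (auto simp: side_def assms(2) intro: assms(3))
qed

lemma rtrancl_path:
  assumes "(x, y) \<in> {(a, b). {a, b} \<in> E}\<^sup>*"
  obtains xs where "distinct xs" "xs \<noteq> []" "hd xs = x" "last xs = y" "path_edges xs \<subseteq> E"
    "\<And>v. v \<in> set xs \<Longrightarrow> (x, v) \<in> {(a, b). {a, b} \<in> E}\<^sup>*"
proof -
  have "\<exists>xs. distinct xs \<and> xs \<noteq> [] \<and> hd xs = x \<and> last xs = y \<and> path_edges xs \<subseteq> E \<and>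
      (\<forall>v \<in> set xs. (x, v) \<in> {(a, b). {a, b} \<in> E}\<^sup>*)"
    using assms
  proof (induction rule: rtrancl_induct)
    case base
    show ?case
      by (intro exI[of _ "[x]"]) simp
  next
    case (step y z)
    then obtain xs where xs: "distinct xs" "xs \<noteq> []" "hd xs = x" "last xs = y" "path_edges xs \<subseteq> E"
        "\<forall>v \<in> set xs. (x, v) \<in> {(a, b). {a, b} \<in> E}\<^sup>*"
      by blast
    show ?case
    proof (cases "z \<in> set xs")
      case True
      \<comment> \<open>When the walk returns to a vertex of the path, the path is cut back to that
        vertex and stays free of repetitions.\<close>
      then obtain us ws where us: "xs = us @ z # ws"
        by (meson split_list)
      then have "path_edges (us @ [z]) \<subseteq> E"
        using path_edges_append[of us z ws] xs(5) by blast
      then show ?thesis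
        using xs us by (intro exI[of _ "us @ [z]"]) (auto simp: hd_append split: if_splits)
    next
      case False
      obtain us where us: "xs = us @ [y]"
        using xs by (metis append_butlast_last_id)
      have "path_edges (xs @ [z]) \<subseteq> E"
        using path_edges_append[of us y "[z]"] xs(5) step(2) us by auto
      moreover have "(x, z) \<in> {(a, b). {a, b} \<in> E}\<^sup>*"
        using step(1,2) by (rule rtrancl_into_rtrancl)
      ultimately show ?thesis
        using xs False by (intro exI[of _ "xs @ [z]"]) auto
    qed
  qed
  then show thesis
    using that by blast
qed

lemma side_path:
  assumes "u \<in> side E x y" "v \<in> side E x y"
  obtains xs where "distinct xs" "xs \<noteq> []" "hd xs = u" "last xs = v" "path_edges xs \<subseteq> E - {{x, y}}"
    "set xs \<subseteq> side E x y"
proof -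
  let ?R = "{(a, b). {a, b} \<in> E - {{x, y}}}"
  have "sym (?R\<^sup>*)"
    by (intro sym_rtrancl symI) (auto simp: insert_commute)
  then have "(u, x) \<in> ?R\<^sup>*" "(x, v) \<in> ?R\<^sup>*" and u: "(x, u) \<in> ?R\<^sup>*"
    using assms by (auto simp: side_def dest: symD)
  then have "(u, v) \<in> ?R\<^sup>*"
    by (meson rtrancl_trans)
  then show thesis
  proof (rule rtrancl_path)
    fix xs
    assume xs: "distinct xs" "xs \<noteq> []" "hd xs = u" "last xs = v" "path_edges xs \<subseteq> E - {{x, y}}"
      and reach: "\<And>w. w \<in> set xs \<Longrightarrow> (u, w) \<in> ?R\<^sup>*"
    have "set xs \<subseteq> side E x y"
    proof
      fix w assume "w \<in> set xs"
      from rtrancl_trans[OF u reach[OF this]] show "w \<in> side E x y"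
        by (simp add: side_def)
    qed
    with xs show thesis
      by (rule that)
  qed
qed

lemma tree_edge:
  assumes "is_tree V E" "{x, y} \<in> E"
  shows "x \<in> V" "y \<in> V" "x \<noteq> y"
  using assms unfolding is_tree_def simple_graph_def by force+

lemma tree_finite:
  assumes "is_tree V E"
  shows "finite V" "finite E"
proof -
  show "finite V"
    using assms by (simp add: is_tree_def simple_graph_def)
  moreover have "E \<subseteq> Pow V"
    using assms by (auto simp: is_tree_def simple_graph_def)
  ultimately show "finite E"
    using finite_subset by blast
qed

text \<open>A path from \<open>x\<close> to \<open>y\<close> that avoids the edge closes up with it
  to a circuit; it has at least three vertices, since \<open>[x, y]\<close> itself would use the
  edge.\<close>

lemma side_opposite:
  assumes "is_tree V E" "{x, y} \<in> E"
  shows "y \<notin> side E x y"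
proof
  assume "y \<in> side E x y"
  then obtain xs where xs: "distinct xs" "xs \<noteq> []" "hd xs = x" "last xs = y"
      "path_edges xs \<subseteq> E - {{x, y}}"
    using side_path[OF side_refl] by metis
  have "x \<noteq> y"
    using tree_edge assms by metis
  with xs obtain ys where ys: "xs = x # ys" "ys \<noteq> []"
    by (cases xs) (auto split: if_splits)
  moreover have "ys \<noteq> [y]"
    using xs(5) ys by auto
  ultimately have "3 \<le> length xs"
    using xs(4) by (cases ys rule: path_edges.cases) auto
  moreover have "circuit_edges xs \<subseteq> E"
  proof -
    obtain us where "xs = us @ [y]"
      using xs by (metis append_butlast_last_id)
    then show ?thesis
      using path_edges_append[of us y "[x]"] xs assms(2)
      by (auto simp: circuit_edges_eq insert_commute)
  qed
  ultimately show False
    using assms(1) xs(1) unfolding is_tree_def is_circuit_def by blast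
qed

text \<open>A walk starting at \<open>y\<close> never enters the other side: the step by which it
  enters, taken backwards, would show that it had been there before.\<close>

lemma side_disjoint:
  assumes "is_tree V E" "{x, y} \<in> E"
  shows "side E x y \<inter> side E y x = {}"
proof (rule ccontr)
  assume "side E x y \<inter> side E y x \<noteq> {}"
  then obtain z where z: "z \<in> side E y x" "z \<in> side E x y"
    by blast
  from z(1) have "z \<notin> side E x y"
  proof (induction rule: side_induct)
    case refl
    show ?case
      by (rule side_opposite[OF assms])
  next
    case (step u v)
    then show ?case
      using side_step[of v E x y u] by (auto simp: insert_commute)
  qed
  with z(2) show False
    by blast
qed

lemma side_Un:
  assumes "is_tree V E" "{x, y} \<in> E"
  shows "side E x y \<union> side E y x = V"
proof (intro equalityI subsetI)
  have *: "z \<in> V" if "z \<in> side E u v" "u \<in> V" for z u v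
    using that by (induction rule: side_induct) (use tree_edge(2)[OF assms(1)] in auto)
  fix z assume "z \<in> side E x y \<union> side E y x"
  then show "z \<in> V"
    using * tree_edge[OF assms] by blast
next
  fix z assume "z \<in> V"
  then have "(x, z) \<in> {(a, b). {a, b} \<in> E}\<^sup>*"
    using assms tree_edge[OF assms] unfolding is_tree_def by blast
  then show "z \<in> side E x y \<union> side E y x"
  proof (induction rule: rtrancl_induct)
    case base
    show ?case
      by (simp add: side_refl)
  next
    case (step u v)
    then have uv: "{u, v} \<in> E"
      by simp
    show ?case
    proof (cases "{u, v} = {x, y}")
      case True
      then show ?thesis
        by (auto simp: doubleton_eq_iff side_refl)
    next
      case False
      then have "{u, v} \<noteq> {y, x}"
        by (simp add: insert_commute)
      with False step(3) uv show ?thesis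
        using side_step[of u E x y v] side_step[of u E y x v] by blast
    qed
  qed
qed

text \<open>The recursion behind all inductions on the size of a side: the side of \<open>x\<close>
  consists of \<open>x\<close> and the sides of its other neighbours. Those sides do not contain
  \<open>x\<close>, so walks in them never use the deleted edge.\<close>

lemma side_eq_neighbours:
  assumes "is_tree V E" "{x, y} \<in> E"
  shows "side E x y = insert x (\<Union>a \<in> {a. {x, a} \<in> E \<and> a \<noteq> y}. side E a x)"
proof (intro equalityI subsetI)
  fix z assume "z \<in> side E x y"
  then show "z \<in> insert x (\<Union>a \<in> {a. {x, a} \<in> E \<and> a \<noteq> y}. side E a x)"
  proof (induction rule: side_induct)
    case (step u v)
    then consider "u = x" | a where "{x, a} \<in> E" "a \<noteq> y" "u \<in> side E a x"
      by blast
    then show ?case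
    proof cases
      case 1
      then show ?thesis
        using step side_refl[of v E x] by auto
    next
      case (2 a)
      show ?thesis
      proof (cases "{u, v} = {a, x}")
        case True
        then have "v = a \<or> v = x"
          by (auto simp: doubleton_eq_iff)
        moreover have "a \<in> (\<Union>a \<in> {a. {x, a} \<in> E \<and> a \<noteq> y}. side E a x)"
          using 2(1,2) by (intro UN_I[of a]) (simp_all add: side_refl)
        ultimately show ?thesis
          by (elim disjE) simp_all
      next
        case False
        have "v \<in> side E a x"
          by (rule side_step[OF 2(3) step.hyps(2) False])
        with 2(1,2) show ?thesis
          by (intro insertI2 UN_I[of a]) simp_all
      qed
    qed
  qed simp
next
  fix z assume "z \<in> insert x (\<Union>a \<in> {a. {x, a} \<in> E \<and> a \<noteq> y}. side E a x)"
  then consider "z = x" | a where "{x, a} \<in> E" "a \<noteq> y" "z \<in> side E a x"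
    by blast
  then show "z \<in> side E x y"
  proof cases
    case 1
    then show ?thesis
      by (simp add: side_refl)
  next
    case (2 a)
    have x: "x \<notin> side E a x"
      using side_opposite[OF assms(1), of a x] 2 by (simp add: insert_commute)
    from 2(3) show ?thesis
    proof (induction rule: side_induct)
      case refl
      show ?case
        using 2 tree_edge[OF assms(1)] by (intro side_step[OF side_refl]) (auto simp: doubleton_eq_iff)
    next
      case (step u v)
      have "v \<in> side E a x"
        by (rule side_step[OF step.hyps])
      then have "{u, v} \<noteq> {x, y}"
        using step.hyps(1) x by (auto simp: doubleton_eq_iff)
      then show ?case
        by (rule side_step[OF step.IH step.hyps(2)])
    qed
  qed
qed

text \<open>From a common vertex one can walk back to \<open>a\<close> within the side of
  \<open>a\<close>, never meeting \<open>x\<close> and hence staying in the side of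
  \<open>b\<close>. One more step leads from \<open>a\<close> to \<open>x\<close>, which is not in
  that side.\<close>

lemma neighbour_sides_disjoint:
  assumes "is_tree V E" "{x, a} \<in> E" "{x, b} \<in> E" "a \<noteq> b"
  shows "side E a x \<inter> side E b x = {}"
proof (rule ccontr)
  have xa: "x \<notin> side E a x" and xb: "x \<notin> side E b x"
    using side_opposite[OF assms(1), of a x] side_opposite[OF assms(1), of b x] assms(2,3)
    by (auto simp: insert_commute)
  assume "side E a x \<inter> side E b x \<noteq> {}"
  then obtain z where z: "z \<in> side E a x" "z \<in> side E b x"
    by blast
  from z have "a \<in> side E b x"
  proof (induction rule: side_induct)
    case (step u v)
    have "v \<in> side E a x"
      by (rule side_step[OF step.hyps])
    then have vu: "{v, u} \<noteq> {b, x}" "{v, u} \<in> E"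
      using step.hyps xa by (auto simp: doubleton_eq_iff insert_commute)
    show ?case
      by (rule step.IH, rule side_step[OF step.prems vu(2,1)])
  qed
  then have "x \<in> side E b x"
    using assms(2,4) side_step[of a E b x x] by (auto simp: insert_commute doubleton_eq_iff)
  with xb show False
    by blast
qed

text \<open>Ensures that a tree path between two leaves meets the perimeter in no further
  leaf.\<close>

lemma degree_path_interior:
  assumes "finite E" "distinct xs" "path_edges xs \<subseteq> E" "v \<in> set xs" "v \<noteq> hd xs" "v \<noteq> last xs"
  shows "2 \<le> degree E v"
proof -
  obtain us ws where xs: "xs = us @ v # ws"
    using assms(4) by (meson split_list)
  with assms(5,6) obtain us' u w ws' where "us = us' @ [u]" "ws = w # ws'"
    by (cases us rule: rev_cases; cases ws) auto
  with xs have xs: "xs = us' @ u # v # w # ws'"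
    by simp
  have "{{u, v}, {v, w}} \<subseteq> {e \<in> E. v \<in> e}"
    using assms(3) path_edges_append[of us' u "v # w # ws'"] unfolding xs by auto
  moreover have "{u, v} \<noteq> {v, w}"
    using assms(2) xs by (auto simp: doubleton_eq_iff)
  then have "card {{u, v}, {v, w}} = 2"
    by simp
  moreover have "finite {e \<in> E. v \<in> e}"
    using assms(1) by simp
  ultimately show ?thesis
    unfolding degree_def using card_mono by metis
qed

section \<open>Leaves and cubic vertices of the tree\<close>

lemma leaf_edges:
  assumes "degree E x = 1" "{x, y} \<in> E"
  shows "{e \<in> E. x \<in> e} = {{x, y}}"
proof -
  obtain e where e: "{e \<in> E. x \<in> e} = {e}"
    using card_1_singletonE[OF assms(1)[unfolded degree_def]] by metis
  have "{x, y} \<in> {e \<in> E. x \<in> e}"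
    using assms(2) by simp
  with e show ?thesis
    by simp
qed

lemma leaf_neighbour_unique:
  assumes "degree E x = 1" "{x, y} \<in> E" "{x, z} \<in> E"
  shows "y = z"
proof -
  have "{x, z} \<in> {e \<in> E. x \<in> e}"
    using assms(3) by simp
  then have "{x, z} \<in> {{x, y}}"
    unfolding leaf_edges[OF assms(1,2)] .
  then show ?thesis
    by (auto simp: doubleton_eq_iff)
qed

lemma leaf_side:
  assumes "is_tree V E" "degree E x = 1" "{x, y} \<in> E"
  shows "side E x y = {x}"
  using side_eq_neighbours[OF assms(1,3)] leaf_neighbour_unique[OF assms(2,3)] by blast

lemma cubic_neighbours:
  assumes "is_tree V E" "degree E x = 3" "{x, y} \<in> E"
  obtains a b where "a \<noteq> b" "a \<noteq> y" "b \<noteq> y" "{z. {x, z} \<in> E} = {y, a, b}"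
proof -
  have inj: "inj_on (\<lambda>z. {x, z}) {z. {x, z} \<in> E}"
    by (auto simp: inj_on_def doubleton_eq_iff)
  have im: "(\<lambda>z. {x, z}) ` {z. {x, z} \<in> E} = {e \<in> E. x \<in> e}"
  proof (intro equalityI subsetI)
    fix e assume e: "e \<in> {e \<in> E. x \<in> e}"
    then have "card e = 2"
      using assms(1) by (auto simp: is_tree_def simple_graph_def)
    with e obtain z where "e = {x, z}"
      by (auto simp: card_2_iff)
    moreover from this e have "{x, z} \<in> E"
      by simp
    ultimately show "e \<in> (\<lambda>z. {x, z}) ` {z. {x, z} \<in> E}"
      by simp
  qed auto
  have "card {z. {x, z} \<in> E} = 3"
    using card_image[OF inj] assms(2) unfolding im degree_def by simp
  then obtain u v w where uvw: "{z. {x, z} \<in> E} = {u, v, w}" "u \<noteq> v" "u \<noteq> w" "v \<noteq> w"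
    by (auto simp: card_3_iff)
  moreover have "y \<in> {u, v, w}"
    using assms(3) uvw(1) by blast
  ultimately show thesis
    using that[of u v] that[of u w] that[of v w] by (auto simp: insert_commute)
qed

text \<open>Two adjacent leaves would be the whole tree, leaving no vertex of degree 3. Consequently
  tree edges and perimeter edges are disjoint as sets of vertex pairs.\<close>

lemma halin_no_leaf_edge:
  assumes "cubic_halin V E vs" "{x, y} \<in> E" "x \<in> set vs"
  shows "y \<notin> set vs"
proof
  assume "y \<in> set vs"
  then have deg: "degree E x = 1" "degree E y = 1" and tree: "is_tree V E"
    using assms unfolding cubic_halin_def by auto
  have "{y, x} \<in> E"
    using assms(2) by (simp add: insert_commute)
  then have "V = {x, y}"
    using side_Un[OF tree assms(2)] leaf_side[OF tree] deg assms(2) by auto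
  then show False
    using assms(1) deg unfolding cubic_halin_def by auto
qed

text \<open>With two exits, the leaves at the exits and their successors alternate on the perimeter.
  A tree path within one side joins the former, a path within the other side joins the latter; the
  two would have to cross, but the sides are disjoint.\<close>

lemma unique_exit:
  assumes halin: "cubic_halin V E vs" and xy: "{x, y} \<in> E"
    and i: "i < length vs" "vs ! i \<in> side E x y" "vs ! (Suc i mod length vs) \<notin> side E x y"
    and j: "j < length vs" "vs ! j \<in> side E x y" "vs ! (Suc j mod length vs) \<notin> side E x y"
  shows "i = j"
proof -
  have False if "i < j"
      and i: "i < length vs" "vs ! i \<in> side E x y" "vs ! (Suc i mod length vs) \<notin> side E x y"
      and j: "j < length vs" "vs ! j \<in> side E x y" "vs ! (Suc j mod length vs) \<notin> side E x y" for i j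
  proof -
    let ?k = "length vs"
    have tree: "is_tree V E" and dist: "distinct vs" and leaves: "set vs = {x \<in> V. degree E x = 1}"
      using halin unfolding cubic_halin_def by auto
    obtain pos \<gamma> where pd: "plane_drawing V (E \<union> circuit_edges vs) pos \<gamma>"
      "frontier (outside (drawing_image V (E \<union> circuit_edges vs) pos \<gamma>)) =
        drawing_image (set vs) (circuit_edges vs) pos \<gamma>"
      using halin unfolding cubic_halin_def by blast
    have E: "E \<inter> circuit_edges vs = {}"
    proof (rule ccontr)
      assume "E \<inter> circuit_edges vs \<noteq> {}"
      then obtain l where l: "l < ?k" "{vs ! l, vs ! (Suc l mod ?k)} \<in> E"
        unfolding circuit_edges_def by blast
      moreover have "Suc l mod ?k < ?k"
        using l(1) by (intro mod_less_divisor) linarith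
      ultimately show False
        using halin_no_leaf_edge[OF halin l(2)] by simp
    qed
    let ?a = "vs ! i" and ?b = "vs ! j"
    let ?as = "take i vs" and ?bs = "take (j - Suc i) (drop (Suc i) vs)" and ?cs = "drop (Suc j) vs"
    \<comment> \<open>The successor of \<open>i\<close> is outside the side and \<open>j\<close>
      inside, so there is a leaf strictly between them, as the crossing argument requires.\<close>
    have "Suc i \<noteq> j"
      using i(3) j(1,2) by auto
    then have ij: "Suc i < j"
      using \<open>i < j\<close> by simp
    have "vs = ?as @ ?a # drop (Suc i) vs"
      using i(1) by (rule id_take_nth_drop)
    moreover have "drop (Suc i) vs = ?bs @ ?b # ?cs"
      using id_take_nth_drop[of "j - Suc i" "drop (Suc i) vs"] \<open>i < j\<close> j(1) by simp
    ultimately have vs: "vs = ?as @ ?a # ?bs @ ?b # ?cs"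
      by simp
    have sides: "z \<in> side E y x" if "z \<in> set vs" "z \<notin> side E x y" for z
      using that leaves side_Un[OF tree xy] by blast
    define u where "u = vs ! (Suc i mod ?k)"
    define w where "w = vs ! (Suc j mod ?k)"
    have u: "u \<in> set ?bs"
    proof -
      have "u = ?bs ! 0" "0 < length ?bs"
        using ij j(1) by (simp_all add: u_def)
      then show ?thesis
        by (metis nth_mem)
    qed
    have w: "w \<in> set ?cs \<union> set ?as"
    proof (cases "Suc j < ?k")
      case True
      then have "w = ?cs ! 0" "0 < length ?cs"
        by (simp_all add: w_def)
      then show ?thesis
        by (metis UnI1 nth_mem)
    next
      case False
      then have "Suc j = ?k"
        using j(1) by simp
      \<comment> \<open>If \<open>j\<close> is the last index, its successor wraps around to 0. That
        leaf is off the side while the leaf at \<open>i\<close> is on it, so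
        \<open>take i vs\<close> is nonempty.\<close>
      then have w0: "w = vs ! 0" "i \<noteq> 0"
        using i(2) j(3) by (auto simp: w_def intro: ccontr)
      then have "w = ?as ! 0" "0 < length ?as"
        using i(1) by simp_all
      then show ?thesis
        by (metis UnI2 nth_mem)
    qed
    have uw: "u \<in> set vs" "w \<in> set vs"
      using u w by (auto dest: in_set_takeD in_set_dropD)
    have uwS: "u \<in> side E y x" "w \<in> side E y x"
      using sides uw i(3) j(3) by (auto simp: u_def w_def)
    obtain P where P: "distinct P" "P \<noteq> []" "hd P = ?a" "last P = ?b" "path_edges P \<subseteq> E - {{x, y}}"
        "set P \<subseteq> side E x y"
      using side_path[OF i(2) j(2)] .
    obtain Q where Q: "distinct Q" "Q \<noteq> []" "hd Q = u" "last Q = w" "path_edges Q \<subseteq> E - {{y, x}}"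
        "set Q \<subseteq> side E y x"
      using side_path[OF uwS] .
    have int: "set R \<inter> set vs = {hd R, last R}"
      if "distinct R" "R \<noteq> []" "hd R \<in> set vs" "last R \<in> set vs" "path_edges R \<subseteq> E" for R
    proof -
      have "v = hd R \<or> v = last R" if "v \<in> set R" "v \<in> set vs" for v
      proof (rule ccontr)
        assume "\<not> ?thesis"
        then have "2 \<le> degree E v"
          using degree_path_interior[OF tree_finite(2)[OF tree] \<open>distinct R\<close> \<open>path_edges R \<subseteq> E\<close> that(1)]
          by simp
        then show False
          using leaves that(2) by simp
      qed
      then show ?thesis
        using that by auto
    qed
    have PE: "path_edges P \<subseteq> E" "path_edges Q \<subseteq> E"
      using P(5) Q(5) by blast+
    have PQ: "set P \<inter> set vs = {?a, ?b}" "set Q \<inter> set vs = {u, w}"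
      using int[OF P(1,2) _ _ PE(1)] int[OF Q(1,2) _ _ PE(2)] P(3,4) Q(3,4) uw i(1) j(1) by simp_all
    have "set P \<inter> set Q \<noteq> {}"
      using leaves
      by (intro halin_paths_cross[OF tree_finite[OF tree] pd dist _ E vs u w P(1,3,4) PE(1) PQ(1)
            Q(1,3,4) PE(2) PQ(2)]) auto
    then show False
      using P(6) Q(6) side_disjoint[OF tree xy] by blast
  qed
  from this[of i j] this[of j i] show ?thesis
    using i j by (metis nat_neq_iff)
qed

section \<open>Intervals of the perimeter cut off by tree edges\<close>

lemma cyclic_exit:
  assumes "m < k" "P m" "l < k" "\<not> P l"
  obtains i where "i < k" "P i" "\<not> P (Suc i mod k)"
proof -
  have "\<exists>i<k. P i \<and> \<not> P (Suc i mod k)"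
  proof (rule ccontr)
    assume *: "\<not> ?thesis"
    have "P ((m + n) mod k)" for n
    proof (induction n)
      case (Suc n)
      have "(m + n) mod k < k"
        using assms(1) by (intro mod_less_divisor) linarith
      then have "P (Suc ((m + n) mod k) mod k)"
        using * Suc by blast
      then show ?case
        by (simp add: mod_Suc_eq)
    qed (use assms in simp)
    \<comment> \<open>The number of steps from \<open>m\<close> to \<open>l\<close> with one full
      turn added, so that the subtraction on natural numbers is exact.\<close>
    from this[of "l + k - m"] show False
      using assms by simp
  qed
  then show thesis
    using that by blast
qed

text \<open>An interval of leaves is recorded without choosing a start on the circuit: its last leaf
  is the exit of its side, and its first leaf is the successor of the exit of the opposite
  side.\<close>

definition side_exit :: "'t set set \<Rightarrow> 't list \<Rightarrow> 't \<Rightarrow> 't \<Rightarrow> nat \<Rightarrow> bool" where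
  "side_exit E vs x y i \<longleftrightarrow>
     i < length vs \<and> vs ! i \<in> side E x y \<and> vs ! (Suc i mod length vs) \<notin> side E x y"

lemma side_exit_unique:
  assumes "cubic_halin V E vs" "{x, y} \<in> E" "side_exit E vs x y i" "side_exit E vs x y j"
  shows "i = j"
  using unique_exit[OF assms(1,2)] assms(3,4) unfolding side_exit_def by blast

lemma opposite_side_leaf:
  assumes "cubic_halin V E vs" "{x, y} \<in> E" "i < length vs"
  shows "vs ! i \<in> side E y x \<longleftrightarrow> vs ! i \<notin> side E x y"
proof -
  have tree: "is_tree V E" and "vs ! i \<in> V"
    using assms(1) nth_mem[OF assms(3)] unfolding cubic_halin_def by auto
  then show ?thesis
    using side_disjoint[OF tree assms(2)] side_Un[OF tree assms(2)] by blast
qed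

lemma side_smaller:
  assumes "is_tree V E" "{x, y} \<in> E" "{x, a} \<in> E" "a \<noteq> y"
  shows "side E a x \<subseteq> side E x y" "card (side E a x) < card (side E x y)"
proof -
  show sub: "side E a x \<subseteq> side E x y"
    using side_eq_neighbours[OF assms(1,2)] assms(3,4) by blast
  have "{a, x} \<in> E"
    using assms(3) by (simp add: insert_commute)
  then have "x \<notin> side E a x"
    by (rule side_opposite[OF assms(1)])
  then have "side E a x \<subset> side E x y"
    using sub side_refl[of x E y] by blast
  moreover have "finite (side E x y)"
    using side_Un[OF assms(1,2)] tree_finite(1)[OF assms(1)] by (metis finite_Un)
  ultimately show "card (side E a x) < card (side E x y)"
    by (simp add: psubset_card_mono)
qed

lemma halin_degree:
  assumes "cubic_halin V E vs" "{x, y} \<in> E"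
  shows "x \<in> set vs \<and> degree E x = 1 \<or> x \<in> V - set vs \<and> degree E x = 3"
proof -
  have "is_tree V E"
    using assms(1) unfolding cubic_halin_def by simp
  from tree_edge(1)[OF this assms(2)] show ?thesis
    using assms(1) unfolding cubic_halin_def by auto
qed

text \<open>Moving from an inner vertex to a neighbour other than \<open>y\<close> strictly shrinks
  the side, so a leaf is reached.\<close>

lemma side_contains_leaf:
  assumes halin: "cubic_halin V E vs" and "{x, y} \<in> E"
  shows "\<exists>i<length vs. vs ! i \<in> side E x y"
  using assms(2)
proof (induction "card (side E x y)" arbitrary: x y rule: less_induct)
  case less
  have tree: "is_tree V E"
    using halin unfolding cubic_halin_def by simp
  from halin_degree[OF halin less.prems] show ?case
  proof
    assume "x \<in> set vs \<and> degree E x = 1"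
    then obtain m where "m < length vs" "vs ! m = x"
      by (auto simp: in_set_conv_nth)
    then show ?thesis
      using side_refl[of x E y] by (intro exI[of _ m]) simp
  next
    assume "x \<in> V - set vs \<and> degree E x = 3"
    then obtain a b where "a \<noteq> y" "{z. {x, z} \<in> E} = {y, a, b}"
      using cubic_neighbours[OF tree _ less.prems] by metis
    then have a: "{x, a} \<in> E" "{a, x} \<in> E" "a \<noteq> y"
      by (auto simp: insert_commute)
    from less.hyps[OF side_smaller(2)[OF tree less.prems a(1,3)] a(2)]
    show ?thesis
      using side_smaller(1)[OF tree less.prems a(1,3)] by blast
  qed
qed

lemma side_exit_exists:
  assumes "cubic_halin V E vs" "{x, y} \<in> E"
  obtains i where "side_exit E vs x y i"
proof -
  have "{y, x} \<in> E"
    using assms(2) by (simp add: insert_commute)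
  then obtain m l where m: "m < length vs" "vs ! m \<in> side E x y"
    and l: "l < length vs" "vs ! l \<in> side E y x"
    using side_contains_leaf[OF assms(1)] assms(2) by metis
  from l have "vs ! l \<notin> side E x y"
    using opposite_side_leaf[OF assms] by blast
  then show thesis
    using cyclic_exit[of m "length vs" "\<lambda>i. vs ! i \<in> side E x y" l] m l(1) that
    unfolding side_exit_def by blast
qed

text \<open>
  The leaves on the \<open>x\<close>-side of the edge \<open>xy\<close> form an interval of the perimeter circuit; the fragments of
  this interval, joined along the tree, act as one big fragment with residual value \<open>l x y\<close>.
\<close>

definition side_transition ::
    "((4 \<Rightarrow> nat) \<Rightarrow> (4 \<Rightarrow> nat) \<Rightarrow> 4 set \<Rightarrow> bool) \<Rightarrow> 't set set \<Rightarrow> 't list \<Rightarrow> (nat \<Rightarrow> 4 \<Rightarrow> nat) \<Rightarrow>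
      ('t \<Rightarrow> 't \<Rightarrow> 4 set) \<Rightarrow> 't \<Rightarrow> 't \<Rightarrow> bool" where
  "side_transition T E vs t l x y \<longleftrightarrow>
     (\<exists>i j. side_exit E vs y x i \<and> side_exit E vs x y j \<and>
        T (t (Suc i mod length vs)) (t (Suc j mod length vs)) (l x y))"

text \<open>The last hypothesis says that the perimeter enters the side of \<open>x\<close> through
  the side of \<open>a\<close>. Uniqueness of exits then forces the interval of \<open>a\<close> to
  be followed directly by that of \<open>b\<close>, where the perimeter leaves; so the two
  transitions share their middle connector.\<close>

lemma side_transition_merge_ordered:
  assumes halin: "cubic_halin V E vs"
    and nb: "a \<noteq> b" "a \<noteq> y" "b \<noteq> y" "{z. {x, z} \<in> E} = {y, a, b}"
    and a: "side_transition transition E vs t l a x" and b: "side_transition transition E vs t l b x"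
    and l: "l a x \<inter> l b x = {}" "l a x \<inter> l x y = {}" "l b x \<inter> l x y = {}"
      "l a x \<union> l b x \<union> l x y = UNIV" "l x y \<noteq> {}"
    and e: "side_exit E vs y x e" "vs ! (Suc e mod length vs) \<in> side E a x"
  shows "side_transition strong_transition E vs t l x y"
proof -
  let ?nxt = "\<lambda>i. Suc i mod length vs"
  have tree: "is_tree V E"
    using halin unfolding cubic_halin_def by simp
  have edges: "{x, y} \<in> E" "{y, x} \<in> E" "{x, a} \<in> E" "{a, x} \<in> E" "{x, b} \<in> E" "{b, x} \<in> E"
    using nb(4) by (auto simp: insert_commute)
  have xV: "x \<notin> set vs"
    using halin_degree[OF halin edges(1)] leaf_neighbour_unique[OF _ edges(1,3)] nb(2) by blast
  have k: "?nxt i < length vs" if "i < length vs" for i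
    using that by (intro mod_less_divisor) linarith
  have S: "vs ! i \<in> side E x y \<longleftrightarrow> vs ! i \<in> side E a x \<or> vs ! i \<in> side E b x" if "i < length vs" for i
  proof -
    have "side E x y = insert x (side E a x \<union> side E b x)"
      using side_eq_neighbours[OF tree edges(1)] nb edges by (auto simp: set_eq_iff)
    moreover have "vs ! i \<noteq> x"
      using that xV nth_mem by metis
    ultimately show ?thesis
      by simp
  qed
  have dis: "side E a x \<inter> side E b x = {}"
    by (rule neighbour_sides_disjoint[OF tree edges(3,5) nb(1)])
  note opp = opposite_side_leaf[OF halin]
  obtain i1 j1 where 1: "side_exit E vs x a i1" "side_exit E vs a x j1"
      "transition (t (?nxt i1)) (t (?nxt j1)) (l a x)"
    using a unfolding side_transition_def by blast
  obtain i2 j2 where 2: "side_exit E vs x b i2" "side_exit E vs b x j2"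
      "transition (t (?nxt i2)) (t (?nxt j2)) (l b x)"
    using b unfolding side_transition_def by blast
  have e': "e < length vs" "vs ! e \<notin> side E x y" "vs ! ?nxt e \<in> side E x y"
    using e(1) opp[OF edges(1)] k unfolding side_exit_def by auto
  have i1: "i1 < length vs" "vs ! i1 \<notin> side E a x" "vs ! ?nxt i1 \<in> side E a x"
    using 1(1) opp[OF edges(4)] k unfolding side_exit_def by auto
  have i2: "i2 < length vs" "vs ! i2 \<notin> side E b x" "vs ! ?nxt i2 \<in> side E b x"
    using 2(1) opp[OF edges(6)] k unfolding side_exit_def by auto
  have "side_exit E vs x a e"
    using e' e(2) S opp[OF edges(4)] k unfolding side_exit_def by auto
  then have e1: "e = i1"
    using side_exit_unique[OF halin edges(3)] 1(1) by blast
  \<comment> \<open>Otherwise the interval of \<open>b\<close> would be entered from outside the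
    side of \<open>x\<close>, hence at \<open>e\<close>, but there the interval of \<open>a\<close>
    begins.\<close>
  have "vs ! i2 \<in> side E a x"
  proof (rule ccontr)
    assume "vs ! i2 \<notin> side E a x"
    then have "vs ! i2 \<notin> side E x y" "vs ! ?nxt i2 \<in> side E x y"
      using S i2 k by auto
    then have "side_exit E vs y x i2"
      using i2 k opp[OF edges(1)] unfolding side_exit_def by auto
    then have "i2 = e"
      using side_exit_unique[OF halin edges(2) _ e(1)] by blast
    then show False
      using i2(3) e(2) dis by blast
  qed
  then have "side_exit E vs a x i2"
    using i2 dis unfolding side_exit_def by blast
  then have ij: "i2 = j1"
    using side_exit_unique[OF halin edges(4) _ 1(2)] by blast
  obtain f where f: "side_exit E vs x y f"
    using side_exit_exists[OF halin edges(1)] .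
  have f': "f < length vs" "vs ! f \<in> side E x y" "vs ! ?nxt f \<notin> side E a x" "vs ! ?nxt f \<notin> side E b x"
    using f S k unfolding side_exit_def by auto
  \<comment> \<open>Leaving from the side of \<open>a\<close> would make \<open>f\<close> the exit
    of that side, whose successor is already known to lie in the side of \<open>b\<close>.\<close>
  have "vs ! f \<notin> side E a x"
  proof
    assume "vs ! f \<in> side E a x"
    then have "side_exit E vs a x f"
      using f' unfolding side_exit_def by blast
    then have "f = i2"
      using side_exit_unique[OF halin edges(4) _ 1(2)] ij by blast
    then show False
      using f'(4) i2(3) by blast
  qed
  then have "side_exit E vs b x f"
    using f' S unfolding side_exit_def by blast
  then have "f = j2"
    using side_exit_unique[OF halin edges(6) _ 2(2)] by blast
  moreover have "strong_transition (t (?nxt i1)) (t (?nxt j2)) (l x y)"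
    using transition_comp[OF 1(3) 2(3)[unfolded ij] l] .
  ultimately show ?thesis
    unfolding side_transition_def using e(1) f e1 by blast
qed

text \<open>Either neighbour may come first along the perimeter; the conditions on the labels are
  symmetric in the two.\<close>

lemma side_transition_merge:
  assumes halin: "cubic_halin V E vs"
    and nb: "a \<noteq> b" "a \<noteq> y" "b \<noteq> y" "{z. {x, z} \<in> E} = {y, a, b}"
    and a: "side_transition transition E vs t l a x" and b: "side_transition transition E vs t l b x"
    and l: "l a x \<inter> l b x = {}" "l a x \<inter> l x y = {}" "l b x \<inter> l x y = {}"
      "l a x \<union> l b x \<union> l x y = UNIV" "l x y \<noteq> {}"
  shows "side_transition strong_transition E vs t l x y"
proof -
  have tree: "is_tree V E"
    using halin unfolding cubic_halin_def by simp
  have edges: "{x, y} \<in> E" "{y, x} \<in> E" "{x, a} \<in> E" "{x, b} \<in> E"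
    using nb(4) by (auto simp: insert_commute)
  obtain e where e: "side_exit E vs y x e"
    using side_exit_exists[OF halin edges(2)] .
  let ?u = "vs ! (Suc e mod length vs)"
  have k: "Suc e mod length vs < length vs"
    using e unfolding side_exit_def by (intro mod_less_divisor) linarith
  then have "?u \<in> side E x y"
    using e opposite_side_leaf[OF halin edges(1)] unfolding side_exit_def by blast
  moreover have "?u \<noteq> x"
  proof -
    have "x \<notin> set vs"
      using halin_degree[OF halin edges(1)] leaf_neighbour_unique[OF _ edges(1,3)] nb(2) by blast
    then show ?thesis
      using nth_mem[OF k] by auto
  qed
  moreover have "side E x y = insert x (side E a x \<union> side E b x)"
    using side_eq_neighbours[OF tree edges(1)] nb edges by (auto simp: set_eq_iff)
  ultimately consider "?u \<in> side E a x" | "?u \<in> side E b x"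
    by blast
  then show ?thesis
  proof cases
    case 1
    show ?thesis
      by (rule side_transition_merge_ordered[OF halin nb a b l e 1])
  next
    case 2
    show ?thesis
      by (rule side_transition_merge_ordered[OF halin nb(1)[symmetric] nb(3,2) _ b a _ l(3,2) _ l(5) e 2])
        (use nb(4) l(1,4) in auto)
  qed
qed

text \<open>Here \<open>t i\<close> stands for the count at the input of the fragment with index
  \<open>i\<close>, and \<open>l x y\<close> for the label of the tree edge. Induction on the size
  of sides gives every tree edge a transition in both directions; when the near end is an inner
  vertex, the transition is a strong one.\<close>

lemma no_halin_transitions:
  assumes halin: "cubic_halin V E vs"
    and leaf: "\<And>i y. i < length vs \<Longrightarrow> {vs ! i, y} \<in> E \<Longrightarrow>
      transition (t i) (t (Suc i mod length vs)) (l (vs ! i) y)"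
    and comm: "\<And>x y. x \<in> V - set vs \<Longrightarrow> {x, y} \<in> E \<Longrightarrow> l x y = l y x"
    and nonempty: "\<And>x y. x \<in> V - set vs \<Longrightarrow> {x, y} \<in> E \<Longrightarrow> l x y \<noteq> {}"
    and vertex: "\<And>x n. x \<in> V - set vs \<Longrightarrow> \<exists>!y. {x, y} \<in> E \<and> n \<in> l x y"
  shows False
proof -
  have tree: "is_tree V E" and dist: "distinct vs" and len: "3 \<le> length vs"
    using halin unfolding cubic_halin_def by auto
  have merge: "side_transition strong_transition E vs t l x y"
    if x: "x \<in> V - set vs" and xy: "{x, y} \<in> E" and nb: "a \<noteq> b" "a \<noteq> y" "b \<noteq> y" "{z. {x, z} \<in> E} = {y, a, b}"
      and ab: "side_transition transition E vs t l a x" "side_transition transition E vs t l b x"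
    for x y a b
  proof -
    have xab: "{x, a} \<in> E" "{x, b} \<in> E"
      using nb by auto
    have uniq: "u = v" if "{x, u} \<in> E" "{x, v} \<in> E" "n \<in> l x u" "n \<in> l x v" for u v n
      using vertex[OF x, of n] that by blast
    have "l x a \<inter> l x b = {}" "l x a \<inter> l x y = {}" "l x b \<inter> l x y = {}"
      using uniq xy xab nb(1-3) by blast+
    moreover have "l x a \<union> l x b \<union> l x y = UNIV"
    proof -
      have "n \<in> l x a \<union> l x b \<union> l x y" for n
      proof -
        obtain z where "{x, z} \<in> E" "n \<in> l x z"
          using vertex[OF x, of n] by blast
        moreover from this have "z \<in> {y, a, b}"
          using nb(4) by blast
        ultimately show ?thesis
          by blast
      qed
      then show ?thesis
        by blast
    qed
    moreover have "l x a = l a x" "l x b = l b x"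
      using comm[OF x] xab by blast+
    ultimately show ?thesis
      using side_transition_merge[OF halin nb ab] nonempty[OF x xy] by metis
  qed
  have all: "side_transition transition E vs t l x y" if "{x, y} \<in> E" for x y
    using that
  proof (induction "card (side E x y)" arbitrary: x y rule: less_induct)
    case less
    have yx: "{y, x} \<in> E"
      using less.prems by (simp add: insert_commute)
    from halin_degree[OF halin less.prems] show ?case
    proof
      assume x: "x \<in> set vs \<and> degree E x = 1"
      then obtain m where m: "m < length vs" "x = vs ! m"
        by (auto simp: in_set_conv_nth)
      have side: "side E x y = {x}"
        using leaf_side[OF tree _ less.prems] x by blast
      obtain i where i: "side_exit E vs y x i"
        using side_exit_exists[OF halin yx] .
      obtain j where j: "side_exit E vs x y j"
        using side_exit_exists[OF halin less.prems] .
      \<comment> \<open>The interval of a leaf consists of that leaf alone, so the perimeter enters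
        and leaves it at the same index.\<close>
      have "Suc i mod length vs < length vs"
        using len by (intro mod_less_divisor) linarith
      moreover from this have "vs ! (Suc i mod length vs) = vs ! m"
        using i opposite_side_leaf[OF halin less.prems] side m unfolding side_exit_def by blast
      ultimately have im: "Suc i mod length vs = m"
        using dist m(1) nth_eq_iff_index_eq by metis
      have "vs ! j = vs ! m" "j < length vs"
        using j side m unfolding side_exit_def by simp_all
      then have "j = m"
        using dist m(1) nth_eq_iff_index_eq by metis
      then show ?thesis
        unfolding side_transition_def using i j im leaf[OF m(1)] less.prems m(2) by blast
    next
      assume x: "x \<in> V - set vs \<and> degree E x = 3"
      then obtain a b where nb: "a \<noteq> b" "a \<noteq> y" "b \<noteq> y" "{z. {x, z} \<in> E} = {y, a, b}"
        using cubic_neighbours[OF tree _ less.prems] by metis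
      then have "{x, a} \<in> E" "{x, b} \<in> E"
        by auto
      then have "{a, x} \<in> E" "{b, x} \<in> E" "card (side E a x) < card (side E x y)"
          "card (side E b x) < card (side E x y)"
        using side_smaller(2)[OF tree less.prems] nb(2,3) by (simp_all add: insert_commute)
      then have "side_transition strong_transition E vs t l x y"
        using merge[OF _ less.prems nb] less.hyps x by blast
      then show ?thesis
        unfolding side_transition_def strong_transition_def by blast
    qed
  qed
  obtain x where x: "x \<in> V" "degree E x = 3"
    using halin unfolding cubic_halin_def by blast
  then have xV: "x \<in> V - set vs"
    using halin unfolding cubic_halin_def by auto
  obtain y where xy: "{x, y} \<in> E"
    using vertex[OF xV] by blast
  then have yx: "{y, x} \<in> E"
    by (simp add: insert_commute)
  obtain a b where nb: "a \<noteq> b" "a \<noteq> y" "b \<noteq> y" "{z. {x, z} \<in> E} = {y, a, b}"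
    using cubic_neighbours[OF tree x(2) xy] by metis
  then have "{x, a} \<in> E" "{x, b} \<in> E"
    by auto
  then have "{a, x} \<in> E" "{b, x} \<in> E"
    by (simp_all add: insert_commute)
  then obtain i j where 1: "side_exit E vs y x i" "side_exit E vs x y j"
      "strong_transition (t (Suc i mod length vs)) (t (Suc j mod length vs)) (l x y)"
    using merge[OF xV xy nb] all unfolding side_transition_def by blast
  obtain i' j' where 2: "side_exit E vs x y i'" "side_exit E vs y x j'"
      "transition (t (Suc i' mod length vs)) (t (Suc j' mod length vs)) (l y x)"
    using all[OF yx] unfolding side_transition_def by blast
  \<comment> \<open>The two stretches are complementary: each begins where the other ends.\<close>
  have "i' = j" "j' = i"
    using side_exit_unique[OF halin] xy yx 1 2 by blast+
  then show False
    using strong_transition_closed[OF 1(3)] 2(3) comm[OF xV xy] by simp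
qed

section \<open>Labellings and junctions\<close>

text \<open>The condition of \<open>cubic_multipole\<close> on edge ends alone, isolated because it
  has to be carried through sums and junctions.\<close>

definition involutive :: "('v, 'd, 'm) multipole_scheme \<Rightarrow> bool" where
  "involutive M \<longleftrightarrow>
     (\<forall>d \<in> ends M. mate M d \<in> ends M \<and> mate M d \<noteq> d \<and> mate M (mate M d) = d)"

text \<open>A labelling of edges, written on their ends: ends keep their identity under a junction,
  while edges as sets of ends do not.\<close>

definition mate_labelling :: "('v, 'd, 'm) multipole_scheme \<Rightarrow> ('d \<Rightarrow> 'l) \<Rightarrow> bool" where
  "mate_labelling M g \<longleftrightarrow> (\<forall>d \<in> ends M. g (mate M d) = g d)"

definition proper_labelling :: "('v, 'd, 'm) multipole_scheme \<Rightarrow> ('d \<Rightarrow> 4 set) \<Rightarrow> bool" where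
  "proper_labelling M g \<longleftrightarrow>
     mate_labelling M g \<and> (\<forall>v \<in> verts M. \<forall>n. \<exists>!d. d \<in> ends_at M v \<and> n \<in> g d)"

definition end_count :: "'d set \<Rightarrow> ('d \<Rightarrow> 4 set) \<Rightarrow> 4 \<Rightarrow> nat" where
  "end_count I g n = card {d \<in> I. n \<in> g d}"

text \<open>Each end takes part in at most one junction, so every junction in the list finds both of
  its ends still present.\<close>

definition junctionable :: "('d \<times> 'd) list \<Rightarrow> 'd set \<Rightarrow> bool" where
  "junctionable js S \<longleftrightarrow>
     distinct js \<and> inj_on fst (set js) \<and> inj_on snd (set js) \<and>
     fst ` set js \<inter> snd ` set js = {} \<and> fst ` set js \<union> snd ` set js \<subseteq> S"

section \<open>Pulling labellings back through junctions\<close>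

lemma junction_simps [simp]:
  "verts (junction (s, t) M) = verts M"
  "inc (junction (s, t) M) = inc M"
  "ends (junction (s, t) M) = ends M - {s, t}"
  "mate (junction (s, t) M) = (mate M)(mate M s := mate M t, mate M t := mate M s)"
  by (simp_all add: junction_def)

lemma fold_junction_simps [simp]:
  "verts (fold junction js M) = verts M"
  "inc (fold junction js M) = inc M"
  "ends (fold junction js M) = ends M - (fst ` set js \<union> snd ` set js)"
  by (induction js arbitrary: M) auto

lemma fold_junction_pole [simp]:
  fixes M :: "('v, 'd) pole"
  shows "inputs (fold junction js M) = inputs M"
    "outputs (fold junction js M) = outputs M"
    "residuals (fold junction js M) = residuals M"
  by (induction js arbitrary: M) (auto simp: junction_def split: prod.splits)

lemma involutive_junction:
  assumes "involutive M" "s \<in> ends M" "t \<in> ends M" "s \<noteq> t"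
  shows "involutive (junction (s, t) M)"
proof -
  have mate: "mate M d \<in> ends M" "mate M d \<noteq> d" "mate M (mate M d) = d" if "d \<in> ends M" for d
    using assms(1) that unfolding involutive_def by blast+
  have inj: "mate M c = mate M d \<longleftrightarrow> c = d" if "c \<in> ends M" "d \<in> ends M" for c d
    using mate(3) that by metis
  show ?thesis
    unfolding involutive_def
  proof
    fix d assume "d \<in> ends (junction (s, t) M)"
    then have d: "d \<in> ends M" "d \<noteq> s" "d \<noteq> t"
      by auto
    show "mate (junction (s, t) M) d \<in> ends (junction (s, t) M) \<and> mate (junction (s, t) M) d \<noteq> d \<and>
      mate (junction (s, t) M) (mate (junction (s, t) M) d) = d"
    proof (cases "mate M s = t")
      case True
      then have "mate M t = s"
        using mate(3)[OF assms(2)] by simp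
      moreover have "mate M d \<noteq> s" "mate M d \<noteq> t"
        using True calculation inj[OF d(1)] assms d by metis+
      ultimately show ?thesis
        using True d mate[OF d(1)] by simp
    next
      case False
      then have ts: "mate M t \<noteq> s"
        using mate(3)[OF assms(3)] by auto
      consider "d = mate M s" | "d = mate M t" "d \<noteq> mate M s"
        | "d \<noteq> mate M s" "d \<noteq> mate M t"
        by blast
      then show ?thesis
      proof cases
        case 1
        then show ?thesis
          using mate[OF assms(2)] mate[OF assms(3)] ts False inj[OF assms(2,3)] assms(4) by auto
      next
        case 2
        then show ?thesis
          using mate[OF assms(2)] mate[OF assms(3)] ts False inj[OF assms(2,3)] assms(4) by auto
      next
        case 3
        have "mate M d \<noteq> s" "mate M d \<noteq> t"
          using 3 mate(3)[OF d(1)] by auto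
        moreover have "mate M d \<noteq> mate M s" "mate M d \<noteq> mate M t"
          using inj[OF d(1)] assms(2,3) d(2,3) by auto
        ultimately show ?thesis
          using 3 d mate[OF d(1)] by simp
      qed
    qed
  qed
qed

lemma junctionable_Cons:
  assumes "junctionable ((s, t) # js) S"
  shows "s \<in> S" "t \<in> S" "s \<noteq> t" "junctionable js (S - {s, t})"
proof -
  show "s \<in> S" "t \<in> S" "s \<noteq> t"
    using assms unfolding junctionable_def by auto
  have "s \<noteq> fst x \<and> t \<noteq> fst x \<and> s \<noteq> snd x \<and> t \<noteq> snd x" if "x \<in> set js" for x
    using assms that unfolding junctionable_def inj_on_def by force
  then show "junctionable js (S - {s, t})"
    using assms unfolding junctionable_def by (auto simp: inj_on_def)
qed

lemma involutive_fold_junction: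
  assumes "involutive M" "junctionable js (ends M)"
  shows "involutive (fold junction js M)"
  using assms
proof (induction js arbitrary: M)
  case (Cons st js)
  obtain s t where st: "st = (s, t)"
    by force
  note J = junctionable_Cons[OF Cons.prems(2)[unfolded st]]
  show ?case
    using Cons.IH[of "junction st M"] involutive_junction[OF Cons.prems(1) J(1-3)] J(4) by (simp add: st)
qed simp

text \<open>Undoing a junction gives both halves of the merged edge its label. The bound on the
  range lets nonemptiness of labels pass to the multipole before the junctions.\<close>

lemma fold_junction_labelling:
  assumes "involutive M" "junctionable js (ends M)" "mate_labelling (fold junction js M) g"
  obtains h where "mate_labelling M h" "\<forall>d \<in> ends (fold junction js M). h d = g d"
    "\<forall>(s, t) \<in> set js. h s = h t" "h ` ends M \<subseteq> insert x (g ` ends (fold junction js M))"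
proof -
  have "\<exists>h. mate_labelling M h \<and> (\<forall>d \<in> ends (fold junction js M). h d = g d) \<and>
    (\<forall>(s, t) \<in> set js. h s = h t) \<and> h ` ends M \<subseteq> insert x (g ` ends (fold junction js M))"
    using assms
  proof (induction js arbitrary: M)
    case Nil
    then show ?case
      by (intro exI[of _ g]) auto
  next
    case (Cons st js)
    obtain s t where st: "st = (s, t)"
      by force
    note J = junctionable_Cons[OF Cons.prems(2)[unfolded st]]
    let ?M = "junction (s, t) M"
    have mate: "mate M d \<in> ends M" "mate M d \<noteq> d" "mate M (mate M d) = d" if "d \<in> ends M" for d
      using Cons.prems(1) that unfolding involutive_def by blast+
    have "\<exists>h. mate_labelling ?M h \<and> (\<forall>d \<in> ends (fold junction js ?M). h d = g d) \<and>
      (\<forall>(s, t) \<in> set js. h s = h t) \<and> h ` ends ?M \<subseteq> insert x (g ` ends (fold junction js ?M))"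
      using Cons.prems J by (intro Cons.IH involutive_junction) (simp_all add: st)
    then obtain h where h: "mate_labelling ?M h" "\<forall>d \<in> ends (fold junction js ?M). h d = g d"
        "\<forall>(s, t) \<in> set js. h s = h t" "h ` ends ?M \<subseteq> insert x (g ` ends (fold junction js ?M))"
      by blast
    \<comment> \<open>If \<open>s\<close> and \<open>t\<close> are the two ends of one edge, the
      junction deletes that edge and nothing remains to read a label from; \<open>x\<close> is the
      default for this case.\<close>
    define v where "v = (if mate M s = t then x else h (mate M s))"
    define h' where "h' = h(s := v, t := v)"
    have vt: "v = h (mate M t)" if "mate M s \<noteq> t"
    proof -
      have "mate M s \<in> ends ?M"
        using that mate[OF J(1)] by simp
      then have "h (mate ?M (mate M s)) = h (mate M s)"
        using h(1) unfolding mate_labelling_def by blast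
      then show ?thesis
        using that by (auto simp: v_def split: if_splits)
    qed
    have lab: "h' (mate M d) = h' d" if d: "d \<in> ends M" for d
    proof -
      have eq: "mate M d = c \<longleftrightarrow> d = mate M c" if "c \<in> ends M" for c
        using mate(3)[OF d] mate(3)[OF that] by metis
      consider "d = s" | "d = t" | "d \<noteq> s" "d \<noteq> t" "mate M d = s" | "d \<noteq> s" "d \<noteq> t" "mate M d = t"
        | "d \<noteq> s" "d \<noteq> t" "mate M d \<noteq> s" "mate M d \<noteq> t"
        by blast
      then show ?thesis
      proof cases
        case 1
        then show ?thesis
          using mate(2)[OF J(1)] by (auto simp: h'_def v_def)
      next
        case 2
        then show ?thesis
          using mate(2)[OF J(2)] eq[OF J(1)] vt by (auto simp: h'_def)
      next
        case 3
        then show ?thesis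
          using eq[OF J(1)] by (auto simp: h'_def v_def)
      next
        case 4
        then have "mate M s \<noteq> t"
          using mate(3)[OF J(1)] eq[OF J(2)] by auto
        then show ?thesis
          using 4 eq[OF J(2)] vt by (auto simp: h'_def)
      next
        case 5
        then have "d \<noteq> mate M s" "d \<noteq> mate M t"
          using eq[OF J(1)] eq[OF J(2)] by auto
        moreover have "h (mate ?M d) = h d"
          using h(1) d 5 unfolding mate_labelling_def by simp
        ultimately show ?thesis
          using 5 by (simp add: h'_def)
      qed
    qed
    have "v \<in> insert x (h ` ends ?M)"
      using mate[OF J(1)] by (auto simp: v_def)
    then have "h' ` ends M \<subseteq> insert x (g ` ends (fold junction js ?M))"
      using h(4) by (auto simp: h'_def)
    moreover have "\<forall>d \<in> ends (fold junction js ?M). h' d = g d"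
      using h(2) by (auto simp: h'_def)
    moreover have "\<forall>(a, b) \<in> set (st # js). h' a = h' b"
    proof -
      have "h' a = h' b" if "(a, b) \<in> set js" for a b
      proof -
        have "a \<in> ends M - {s, t}" "b \<in> ends M - {s, t}"
          using J(4) that unfolding junctionable_def by force+
        then show ?thesis
          using h(3) that by (auto simp: h'_def)
      qed
      then show ?thesis
        by (auto simp: st h'_def)
    qed
    moreover have "mate_labelling M h'"
      using lab unfolding mate_labelling_def by blast
    ultimately show ?case
      by (intro exI[of _ h']) (simp add: st)
  qed
  then obtain h where "mate_labelling M h" "\<forall>d \<in> ends (fold junction js M). h d = g d"
    "\<forall>(s, t) \<in> set js. h s = h t" "h ` ends M \<subseteq> insert x (g ` ends (fold junction js M))"
    by blast
  then show thesis
    using that by blast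
qed

lemma ends_at_fold_junction:
  assumes "\<And>s t. (s, t) \<in> set js \<Longrightarrow> inc M s = None \<and> inc M t = None"
  shows "ends_at (fold junction js M) v = ends_at M v"
  using assms by (fastforce simp: ends_at_def)

section \<open>Counting ends at vertices and at semiedges\<close>

lemma even_card_involution:
  assumes "\<And>x. x \<in> A \<Longrightarrow> f x \<in> A" "\<And>x. x \<in> A \<Longrightarrow> f x \<noteq> x" "\<And>x. x \<in> A \<Longrightarrow> f (f x) = x"
  shows "even (card A)"
proof -
  have "(of_nat n :: bit) = of_bool (odd n)" for n
    by (induction n) simp_all
  moreover have "(of_nat (card A) :: bit) = 0"
    using sum_involution_eq_0[of A "\<lambda>_. 1 :: bit" f] assms by simp
  ultimately show ?thesis
    by simp
qed

lemma card_ends: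
  assumes "finite (verts M)" "finite (ends M)" "\<And>d v. d \<in> ends M \<Longrightarrow> inc M d = Some v \<Longrightarrow> v \<in> verts M"
  shows "card {d \<in> ends M. P d} =
    (\<Sum>v \<in> verts M. card {d \<in> ends_at M v. P d}) + card {d \<in> semiedges M. P d}"
proof -
  have "{d \<in> ends M. P d} = (\<Union>v \<in> verts M. {d \<in> ends_at M v. P d}) \<union> {d \<in> semiedges M. P d}"
  proof (intro equalityI subsetI)
    fix d assume "d \<in> {d \<in> ends M. P d}"
    then show "d \<in> (\<Union>v \<in> verts M. {d \<in> ends_at M v. P d}) \<union> {d \<in> semiedges M. P d}"
      using assms(3)[of d] by (cases "inc M d") (auto simp: ends_at_def semiedges_def)
  qed (auto simp: ends_at_def semiedges_def)
  moreover have "card (\<Union>v \<in> verts M. {d \<in> ends_at M v. P d}) = (\<Sum>v \<in> verts M. card {d \<in> ends_at M v. P d})"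
    using assms(1,2) by (intro card_UN_disjoint) (auto simp: ends_at_def)
  moreover have "finite (\<Union>v \<in> verts M. {d \<in> ends_at M v. P d})" "finite {d \<in> semiedges M. P d}"
    using assms(1,2) by (auto simp: ends_at_def semiedges_def)
  moreover have "(\<Union>v \<in> verts M. {d \<in> ends_at M v. P d}) \<inter> {d \<in> semiedges M. P d} = {}"
    by (auto simp: ends_at_def semiedges_def)
  ultimately show ?thesis
    by (simp add: card_Un_disjoint)
qed

lemma card_unique: "\<exists>!d. d \<in> S \<and> P d \<Longrightarrow> card {d \<in> S. P d} = 1"
  by (auto simp: card_1_singleton_iff; metis)

text \<open>The number of all ends is even and equals three times the number of vertices plus four,
  so the number of vertices is even. The ends whose label contains \<open>n\<close> are also even in
  number: one per vertex, and the rest in the connectors.\<close>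

lemma decollineator_parity:
  assumes pole: "pole_2_2 D" and h: "proper_labelling D h"
  shows "even (end_count (inputs D) h n + end_count (outputs D) h n)"
proof -
  have cub: "cubic_multipole D" and semi: "semiedges D = inputs D \<union> outputs D \<union> residuals D"
    and disj: "inputs D \<inter> outputs D = {}" and two: "card (inputs D) = 2" "card (outputs D) = 2"
    and res: "card (residuals D) = 0"
    using pole unfolding pole_2_2_r_def by auto
  have fin: "finite (verts D)" "finite (ends D)"
    and inc: "\<And>d v. d \<in> ends D \<Longrightarrow> inc D d = Some v \<Longrightarrow> v \<in> verts D"
    and three: "\<And>v. v \<in> verts D \<Longrightarrow> card (ends_at D v) = 3"
    and mate: "\<And>d. d \<in> ends D \<Longrightarrow> mate D d \<in> ends D \<and> mate D d \<noteq> d \<and> mate D (mate D d) = d"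
    using cub unfolding cubic_multipole_def by auto
  have fin': "finite (semiedges D)"
    using fin by (simp add: semiedges_def)
  then have semi: "semiedges D = inputs D \<union> outputs D"
    using semi res by auto
  have "even (card {d \<in> ends D. True})"
    using mate by (intro even_card_involution[of _ "mate D"]) auto
  moreover have "card {d \<in> ends D. True} = 3 * card (verts D) + card (semiedges D)"
    using three by (subst card_ends[OF fin inc]) auto
  moreover have "card (semiedges D) = 4"
    using fin' semi two disj by (simp add: card_Un_disjoint)
  ultimately have "even (card (verts D))"
    by simp
  moreover have "even (card {d \<in> ends D. n \<in> h d})"
    using mate h
    by (intro even_card_involution[of _ "mate D"]) (auto simp: proper_labelling_def mate_labelling_def)
  moreover have "card {d \<in> ends D. n \<in> h d} = card (verts D) + card {d \<in> semiedges D. n \<in> h d}"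
    using h by (subst card_ends[OF fin inc]) (auto simp: proper_labelling_def card_unique)
  moreover have "card {d \<in> semiedges D. n \<in> h d} = end_count (inputs D) h n + end_count (outputs D) h n"
  proof -
    have "{d \<in> semiedges D. n \<in> h d} = {d \<in> inputs D. n \<in> h d} \<union> {d \<in> outputs D. n \<in> h d}"
      using semi by auto
    then show ?thesis
      unfolding end_count_def using disj fin' semi by (simp add: card_Un_disjoint disjoint_iff)
  qed
  ultimately show ?thesis
    by simp
qed

lemma sum_partition_labels:
  assumes "finite S" "\<And>n::4. \<exists>!d. d \<in> S \<and> n \<in> g d"
  shows "(\<Sum>d \<in> S. card (g d)) = 4"
proof -
  have "UNIV = (\<Union>d \<in> S. g d)"
    using assms(2) by blast
  then have "card (\<Union>d \<in> S. g d) = CARD(4)"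
    by simp
  moreover have "card (\<Union>d \<in> S. g d) = (\<Sum>d \<in> S. card (g d))"
  proof (intro card_UN_disjoint ballI impI)
    fix c d assume "c \<in> S" "d \<in> S" "c \<noteq> d"
    then show "g c \<inter> g d = {}"
      using assms(2) by blast
  qed (use assms(1) in auto)
  ultimately show ?thesis
    by simp
qed

text \<open>Each of the other two labels takes at least one of the four indices.\<close>

lemma partition_labels_card:
  assumes "card S = 3" "\<And>n::4. \<exists>!d. d \<in> S \<and> n \<in> g d" "\<And>d. d \<in> S \<Longrightarrow> g d \<noteq> {}" "d \<in> S"
  shows "card (g d) \<in> {1, 2}"
proof -
  have fin: "finite S"
    using assms(1) by (metis card.infinite zero_neq_numeral)
  have pos: "1 \<le> card (g d)" if "d \<in> S" for d
    using assms(3)[OF that] by (simp add: Suc_le_eq card_gt_0_iff)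
  have "card (S - {d}) \<le> (\<Sum>d \<in> S - {d}. card (g d))"
    using sum_mono[of "S - {d}" "\<lambda>_. 1" "\<lambda>d. card (g d)"] pos by simp
  moreover have "card (S - {d}) = 2"
    using assms(1,4) by simp
  moreover have "card (g d) + (\<Sum>d \<in> S - {d}. card (g d)) = 4"
    using sum_partition_labels[OF fin assms(2)] sum.remove[OF fin assms(4), of "\<lambda>d. card (g d)"] by simp
  ultimately show ?thesis
    using pos[OF assms(4)] by auto
qed

text \<open>Labels of ends off the vertices are unconstrained; only there does this change a label.\<close>

definition trim :: "4 set \<Rightarrow> 4 set" where
  "trim A = (if card A \<in> {1, 2} then A else {0})"

lemma card_trim: "card (trim A) = 1 \<or> card (trim A) = 2"
  by (auto simp: trim_def)

text \<open>At a vertex the sizes are already 1 or 2. Only an edge without any vertex can be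
  affected, and a tetrahedral flow must assign a point to such an edge too.\<close>

lemma proper_trim:
  assumes "proper_labelling M g" "\<And>v. v \<in> verts M \<Longrightarrow> card (ends_at M v) = 3"
    "\<And>d. d \<in> ends M \<Longrightarrow> g d \<noteq> {}"
  shows "proper_labelling M (trim \<circ> g)"
proof -
  have "trim (g d) = g d" if "v \<in> verts M" "d \<in> ends_at M v" for v d
  proof -
    have "\<exists>!d. d \<in> ends_at M v \<and> n \<in> g d" for n
      using assms(1) that(1) unfolding proper_labelling_def by blast
    moreover have "g d \<noteq> {}" if "d \<in> ends_at M v" for d
      using assms(3) that unfolding ends_at_def by blast
    ultimately have "card (g d) \<in> {1, 2}"
      using partition_labels_card[OF assms(2)[OF that(1)]] that(2) by metis
    then show ?thesis
      by (simp add: trim_def)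
  qed
  then have "d \<in> ends_at M v \<and> n \<in> (trim \<circ> g) d \<longleftrightarrow> d \<in> ends_at M v \<and> n \<in> g d" if "v \<in> verts M" for v d n
    using that by auto
  moreover have "mate_labelling M (trim \<circ> g)"
    using assms(1) unfolding proper_labelling_def mate_labelling_def by simp
  ultimately show ?thesis
    using assms(1) unfolding proper_labelling_def by simp
qed

section \<open>Labels as points of the tetrahedron\<close>

lemma end_count_pair: "a \<noteq> b \<Longrightarrow> end_count {a, b} h = pair_count (h a) (h b)"
proof
  fix n assume "a \<noteq> b"
  have "{d \<in> {a, b}. n \<in> h d} = (if n \<in> h a then {a} else {}) \<union> (if n \<in> h b then {b} else {})"
    by auto
  then show "end_count {a, b} h n = pair_count (h a) (h b) n"
    using \<open>a \<noteq> b\<close> by (simp add: end_count_def pair_count_def)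
qed

text \<open>The complement is taken for pairs so that a partition {k}, {l}, {i, j} of the indices is
  sent to the line through \<open>p k\<close> and \<open>p l\<close>.\<close>

definition tetra_point :: "(4 \<Rightarrow> bit ^ 4) \<Rightarrow> 4 set \<Rightarrow> bit ^ 4" where
  "tetra_point p A = (if card A = 1 then sum p A else sum p (- A))"

lemma tetra_point_single: "tetra_point p {i} = p i"
  by (simp add: tetra_point_def)

lemma card_compl_4: "card A + card (- A) = 4" for A :: "4 set"
proof -
  have "card A + card (- A) = card (A \<union> - A)"
    by (subst card_Un_disjoint) auto
  then show ?thesis
    by simp
qed

lemma tetra_point_double:
  assumes "- A = {i, j}" "i \<noteq> j"
  shows "tetra_point p A = p i + p j"
proof -
  have "card A = 2"
    using assms card_compl_4[of A] by simp
  then show ?thesis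
    using assms by (simp add: tetra_point_def)
qed

lemma double_complement:
  fixes A :: "4 set"
  assumes "card A = 2"
  obtains i j where "- A = {i, j}" "i \<noteq> j"
proof -
  have "card (- A) = 2"
    using assms card_compl_4[of A] by simp
  then show thesis
    using that by (auto simp: card_2_iff)
qed

text \<open>Collinear counts come from two different singletons, or from a singleton {i} and a pair
  avoiding i. In the second case the complement of the pair is {i, j}, and the line through
  \<open>p i\<close> and \<open>p j\<close> contains both points.\<close>

lemma collinear_points:
  assumes p: "is_basis p" and cards: "card A \<in> {1, 2}" "card B \<in> {1, 2}"
    and coll: "collinear_count (pair_count A B)"
  shows "tetra_point p A \<noteq> tetra_point p B \<and>
    (\<exists>l \<in> tetra_lines p. tetra_point p A \<in> l \<and> tetra_point p B \<in> l)"
proof -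
  have p0: "p i \<noteq> 0" for i
  proof
    assume "p i = 0"
    then have "0 \<in> range p"
      by (metis rangeI)
    then show False
      using p vec.dependent_zero unfolding is_basis_def by blast
  qed
  have inj: "inj p"
    using p by (simp add: is_basis_def)
  have half_line: "p i \<noteq> tetra_point p B \<and> (\<exists>l \<in> tetra_lines p. p i \<in> l \<and> tetra_point p B \<in> l)"
    if "card B = 2" "i \<notin> B" for i B
  proof -
    obtain k j where kj: "- B = {k, j}" "k \<noteq> j"
      using double_complement[OF \<open>card B = 2\<close>] .
    then obtain j where j: "- B = {i, j}" "i \<noteq> j"
      using \<open>i \<notin> B\<close> by (metis ComplI doubleton_eq_iff insertE singletonD)
    then have "tetra_point p B = p i + p j"
      by (rule tetra_point_double)
    moreover have "{p i, p i + p j, p j} \<in> tetra_lines p"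
      using j(2) unfolding tetra_lines_def by blast
    ultimately show ?thesis
      using p0[of j] by (intro conjI bexI[of _ "{p i, p i + p j, p j}"]) auto
  qed
  have odd: "odd_part (pair_count A B) = (A - B) \<union> (B - A)"
    by (auto simp: odd_part_def pair_count_def)
  have odd_card: "card (odd_part (pair_count A B)) = card (A - B) + card (B - A)"
    unfolding odd by (intro card_Un_disjoint) auto
  have weight: "weight (pair_count A B) = card A + card B"
    by (rule weight_pair_count)
  consider "card A = 1" "card B = 1" | "card A = 1" "card B = 2" | "card A = 2" "card B = 1"
    using coll cards weight unfolding collinear_count_def by auto
  then show ?thesis
  proof cases
    case 1
    then obtain i j where ij: "A = {i}" "B = {j}"
      by (meson card_1_singletonE)
    moreover have "A \<noteq> B"
    proof
      assume "A = B"
      then show False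
        using coll odd_card unfolding collinear_count_def by simp
    qed
    ultimately have "i \<noteq> j"
      by blast
    then have "p i \<noteq> p j" "{p i, p i + p j, p j} \<in> tetra_lines p"
      using inj by (auto simp: inj_eq tetra_lines_def)
    then show ?thesis
      unfolding ij tetra_point_single by blast
  next
    case 2
    then obtain i where i: "A = {i}"
      by (meson card_1_singletonE)
    have "i \<notin> B"
    proof
      assume "i \<in> B"
      then have "A - B = {}" "card (B - A) = 1"
        using i 2 by simp_all
      then have "card (odd_part (pair_count A B)) = 1"
        unfolding odd_card by simp
      then show False
        using coll weight 2 unfolding collinear_count_def by simp
    qed
    then show ?thesis
      using half_line[OF 2(2)] unfolding i tetra_point_single by blast
  next
    case 3
    then obtain i where i: "B = {i}"
      by (meson card_1_singletonE)
    have "i \<notin> A"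
    proof
      assume "i \<in> A"
      then have "B - A = {}" "card (A - B) = 1"
        using i 3 by simp_all
      then have "card (odd_part (pair_count A B)) = 1"
        unfolding odd_card by simp
      then show False
        using coll weight 3 unfolding collinear_count_def by simp
    qed
    then show ?thesis
      using half_line[OF 3(1)] unfolding i tetra_point_single by metis
  qed
qed

lemma tetra_point_in_points:
  assumes "card A \<in> {1, 2}"
  shows "tetra_point p A \<in> tetra_points p"
proof (cases "card A = 1")
  case True
  then obtain i where "A = {i}"
    by (meson card_1_singletonE)
  then show ?thesis
    by (auto simp: tetra_points_def tetra_point_single)
next
  case False
  then obtain i j where "- A = {i, j}" "i \<noteq> j"
    using double_complement assms by blast
  then show ?thesis
    by (auto simp: tetra_points_def tetra_point_double)
qed

text \<open>Three sizes from 1 and 2 with sum 4 leave two singletons, and the third label is the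
  complement of their union.\<close>

lemma tetra_point_line:
  assumes "card S = 3" "\<And>n::4. \<exists>!d. d \<in> S \<and> n \<in> h d" "\<And>d. d \<in> S \<Longrightarrow> card (h d) \<in> {1, 2}"
  shows "(\<lambda>d. tetra_point p (h d)) ` S \<in> tetra_lines p"
proof -
  obtain a b c where S: "S = {a, b, c}" "a \<noteq> b" "a \<noteq> c" "b \<noteq> c"
    using assms(1) by (auto simp: card_3_iff)
  have line: "{tetra_point p (h a), tetra_point p (h b), tetra_point p (h c)} \<in> tetra_lines p"
    if abc: "S = {a, b, c}" "a \<noteq> b" "a \<noteq> c" "b \<noteq> c" "card (h a) = 1" "card (h b) = 1" for a b c
  proof -
    obtain k l where kl: "h a = {k}" "h b = {l}"
      using abc(5,6) by (meson card_1_singletonE)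
    have uniq: "d = e" if "d \<in> S" "e \<in> S" "n \<in> h d" "n \<in> h e" for d e n
      using assms(2)[of n] that by blast
    have "k \<noteq> l"
      using uniq[of a b k] abc(1,2) kl by auto
    moreover have "- h c = {k, l}"
    proof (intro equalityI subsetI)
      fix n assume "n \<in> - h c"
      then show "n \<in> {k, l}"
        using assms(2)[of n] abc(1) kl by auto
    next
      fix n assume "n \<in> {k, l}"
      then show "n \<in> - h c"
        using uniq[of a c n] uniq[of b c n] abc kl by auto
    qed
    ultimately show ?thesis
      unfolding kl tetra_point_single tetra_lines_def
      by (auto simp: tetra_point_double insert_commute intro: exI[of _ k] exI[of _ l])
  qed
  have "card (h a) + card (h b) + card (h c) = 4"
    using sum_partition_labels[of S h] assms(2) S by simp
  moreover have "card (h a) \<in> {1, 2}" "card (h b) \<in> {1, 2}" "card (h c) \<in> {1, 2}"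
    using assms(3) S(1) by blast+
  ultimately consider "card (h a) = 1" "card (h b) = 1" | "card (h a) = 1" "card (h c) = 1"
    | "card (h b) = 1" "card (h c) = 1"
    by auto
  then show ?thesis
  proof cases
    case 1
    then show ?thesis
      using line[of a b c] S by simp
  next
    case 2
    then show ?thesis
      using line[of a c b] S by (simp add: insert_commute)
  next
    case 3
    then show ?thesis
      using line[of b c a] S by (simp add: insert_commute)
  qed
qed

lemma decollineator_collinear:
  assumes p: "is_basis p" and D: "decollineator p D" and h: "proper_labelling D h"
    and cards: "\<And>d. d \<in> ends D \<Longrightarrow> card (h d) \<in> {1, 2}"
  shows "\<not> (collinear_count (end_count (inputs D) h) \<and> collinear_count (end_count (outputs D) h))"
proof
  assume coll: "collinear_count (end_count (inputs D) h) \<and> collinear_count (end_count (outputs D) h)"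
  \<comment> \<open>A flow takes edges as arguments, so an end of the edge is chosen; both ends
    carry the same label.\<close>
  define \<phi> where "\<phi> e = tetra_point p (h (SOME d. d \<in> e))" for e
  have pole: "cubic_multipole D" "semiedges D = inputs D \<union> outputs D \<union> residuals D"
    "card (inputs D) = 2" "card (outputs D) = 2"
    using D unfolding decollineator_def pole_2_2_r_def by auto
  have phi: "\<phi> (edge_ends D d) = tetra_point p (h d)" if "d \<in> ends D" for d
  proof -
    have "(SOME x. x \<in> edge_ends D d) \<in> edge_ends D d"
      by (rule someI[of _ d]) (simp add: edge_ends_def)
    then have "h (SOME x. x \<in> edge_ends D d) = h d"
      using h that unfolding proper_labelling_def mate_labelling_def edge_ends_def by auto
    then show ?thesis
      by (simp add: \<phi>_def)
  qed
  have "tetra_flow p D \<phi>"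
    unfolding tetra_flow_def
  proof (intro conjI ballI)
    fix e assume "e \<in> edges D"
    then show "\<phi> e \<in> tetra_points p"
      using phi tetra_point_in_points[OF cards] unfolding edges_def by auto
  next
    fix v assume v: "v \<in> verts D"
    have "(\<lambda>d. \<phi> (edge_ends D d)) ` ends_at D v = (\<lambda>d. tetra_point p (h d)) ` ends_at D v"
      using phi by (intro image_cong) (auto simp: ends_at_def)
    also have "\<dots> \<in> tetra_lines p"
      using pole(1) v h cards
      by (intro tetra_point_line) (auto simp: cubic_multipole_def proper_labelling_def ends_at_def)
    finally show "(\<lambda>d. \<phi> (edge_ends D d)) ` ends_at D v \<in> tetra_lines p" .
  qed
  moreover have "collinear_pair p D \<phi> I"
    if I: "card I = 2" "I \<subseteq> ends D" "collinear_count (end_count I h)" for I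
  proof -
    obtain a b where ab: "I = {a, b}" "a \<noteq> b"
      using I(1) by (auto simp: card_2_iff)
    then have "tetra_point p (h a) \<noteq> tetra_point p (h b) \<and>
        (\<exists>l \<in> tetra_lines p. tetra_point p (h a) \<in> l \<and> tetra_point p (h b) \<in> l)"
      using I cards by (intro collinear_points[OF p]) (auto simp: end_count_pair)
    moreover have "a \<in> ends D" "b \<in> ends D"
      using ab I(2) by auto
    ultimately show ?thesis
      unfolding collinear_pair_def using ab phi by (intro exI[of _ a] exI[of _ b]) simp
  qed
  moreover have "inputs D \<subseteq> ends D" "outputs D \<subseteq> ends D"
    using pole(2) unfolding semiedges_def by auto
  ultimately show False
    using D coll pole(3,4) unfolding decollineator_def by blast
qed

section \<open>Halin fragments\<close>

text \<open>\<open>S\<close> is the colour class of \<open>u\<close>. As \<open>u\<close> and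
  \<open>v\<close> have the same colour and \<open>w\<close> the other one, colour separates the
  connectors from the residual semiedge.\<close>

lemma bipartite_poleE:
  assumes "bipartite_pole B"
  obtains S where "pole_2_2_1 B" "inputs B \<union> outputs B = {d \<in> semiedges B. S d}"
    "residuals B = {d \<in> semiedges B. \<not> S d}"
    "\<forall>d \<in> ends B. S (mate B d) \<longleftrightarrow> \<not> S d"
    "\<forall>v \<in> verts B. (\<forall>d \<in> ends_at B v. S d) \<or> (\<forall>d \<in> ends_at B v. \<not> S d)"
proof -
  obtain G u e w f v where G: "cubic_graph G" "bipartite G" and path: "is_path2 G u e w f v"
    and B: "B = remove_path G u e w f v"
    using assms unfolding bipartite_pole_def by blast
  have distinct: "u \<noteq> w" "u \<noteq> v" "w \<noteq> v"
    using path unfolding is_path2_def by auto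
  have fin: "finite (verts G)" "finite (ends G)"
    and mate: "\<And>d. d \<in> ends G \<Longrightarrow> mate G d \<in> ends G \<and> mate G d \<noteq> d \<and> mate G (mate G d) = d"
    and inc: "\<And>d x. d \<in> ends G \<Longrightarrow> inc G d = Some x \<Longrightarrow> x \<in> verts G"
    and three: "\<And>x. x \<in> verts G \<Longrightarrow> card (ends_at G x) = 3"
    and nosemi: "\<And>d. d \<in> ends G \<Longrightarrow> inc G d \<noteq> None"
    using G(1) unfolding cubic_graph_def cubic_multipole_def semiedges_def by auto
  obtain A where "\<forall>d \<in> ends G. \<forall>x y. inc G d = Some x \<longrightarrow> inc G (mate G d) = Some y \<longrightarrow>
      (x \<in> A \<longleftrightarrow> y \<notin> A)"
    using G(2) unfolding bipartite_def by (elim exE)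
  then have A: "x \<in> A \<longleftrightarrow> y \<notin> A"
    if "d \<in> ends G" "inc G d = Some x" "inc G (mate G d) = Some y" for d x y
    using that by simp
  obtain c where c: "c \<in> ends G" "e = {c, mate G c}" "inc G c = Some u" "inc G (mate G c) = Some w"
    using path unfolding is_path2_def edge_between_def edge_ends_def by blast
  obtain d where d: "d \<in> ends G" "f = {d, mate G d}" "inc G d = Some w" "inc G (mate G d) = Some v"
    using path unfolding is_path2_def edge_between_def edge_ends_def by blast
  have uwv: "w \<in> A \<longleftrightarrow> u \<notin> A" "v \<in> A \<longleftrightarrow> u \<in> A"
    using A[OF c(1,3,4)] A[OF d(1,3,4)] by auto
  \<comment> \<open>Incidence is read in \<open>G\<close>: a semiedge of \<open>B\<close> keeps the
    colour of the deleted vertex it came from.\<close>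
  define S where "S x \<longleftrightarrow> (the (inc G x) \<in> A \<longleftrightarrow> u \<in> A)" for x
  let ?I = "{Some u, Some w, Some v}"
  have ef: "e \<union> f = {c, mate G c, d, mate G d}"
    using c(2) d(2) by auto
  have ef_inc: "inc G x \<in> ?I" if "x \<in> e \<union> f" for x
    using that c(3,4) d(3,4) unfolding ef by auto
  have ends: "x \<in> ends B \<longleftrightarrow> x \<in> ends G \<and> x \<notin> e \<union> f" for x
    by (simp add: B remove_path_def)
  have ends_at: "ends_at B x = ends_at G x" if "x \<in> verts B" for x
  proof -
    have "y \<notin> e \<union> f \<and> inc G y \<notin> ?I" if "inc G y = Some x" for y
      using \<open>x \<in> verts B\<close> that ef_inc[of y] by (auto simp: B remove_path_def)
    then show ?thesis
      by (auto simp: ends_at_def B remove_path_def split: if_splits)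
  qed
  have matee: "mate G x \<in> e \<union> f \<longleftrightarrow> x \<in> e \<union> f" if "x \<in> ends G" for x
    using mate[OF that] mate[OF c(1)] mate[OF d(1)] unfolding ef by (metis insert_iff empty_iff)
  have inB: "inputs B = ends_at G u - {c}"
    using c d distinct by (auto simp: B remove_path_def ends_at_def)
  have resB: "residuals B = ends_at G w - {mate G c, d}"
    using c d distinct by (auto simp: B remove_path_def ends_at_def)
  have outB: "outputs B = ends_at G v - {mate G d}"
    using c d distinct by (auto simp: B remove_path_def ends_at_def)
  have semi: "semiedges B = {x \<in> ends G - (e \<union> f). inc G x \<in> ?I}"
  proof (rule set_eqI)
    fix x
    show "x \<in> semiedges B \<longleftrightarrow> x \<in> {x \<in> ends G - (e \<union> f). inc G x \<in> ?I}"
      using nosemi[of x] by (auto simp: semiedges_def B remove_path_def)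
  qed
  have "card (ends_at G u) = 3" "card (ends_at G w) = 3" "card (ends_at G v) = 3"
    using three inc c d mate by blast+
  moreover have "c \<in> ends_at G u" "mate G c \<in> ends_at G w" "d \<in> ends_at G w" "mate G d \<in> ends_at G v"
    using c d mate by (auto simp: ends_at_def)
  moreover have "mate G c \<noteq> d"
    using mate[OF c(1)] c d distinct by auto
  moreover have "finite (ends_at G x)" for x
    using fin by (simp add: ends_at_def)
  ultimately have cards: "card (inputs B) = 2" "card (residuals B) = 1" "card (outputs B) = 2"
    unfolding inB resB outB by simp_all
  have cubic: "cubic_multipole B"
    unfolding cubic_multipole_def
  proof (intro conjI ballI allI impI)
    show "finite (verts B)" "finite (ends B)"
      using fin by (simp_all add: B remove_path_def)
    show "card (ends_at B x) = 3" if "x \<in> verts B" for x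
      using ends_at[OF that] three that by (auto simp: B remove_path_def)
    show "mate B x \<in> ends B" if "x \<in> ends B" for x
      using that ends mate matee by (auto simp: B remove_path_def)
    show "mate B x \<noteq> x" "mate B (mate B x) = x" if "x \<in> ends B" for x
      using that ends mate by (auto simp: B remove_path_def)
    show "y \<in> verts B" if "x \<in> ends B" "inc B x = Some y" for x y
      using that inc by (auto simp: B remove_path_def split: if_splits)
  qed
  have io: "inputs B \<union> outputs B = {x \<in> semiedges B. S x}"
    unfolding semi using c d distinct uwv
    by (auto simp: B remove_path_def ends_at_def S_def)
  have r: "residuals B = {x \<in> semiedges B. \<not> S x}"
    unfolding semi using c d distinct uwv
    by (auto simp: B remove_path_def ends_at_def S_def)
  have "semiedges B = inputs B \<union> outputs B \<union> residuals B" "(inputs B \<union> outputs B) \<inter> residuals B = {}"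
    unfolding io r by blast+
  moreover have "inputs B \<inter> outputs B = {}"
    unfolding inB outB ends_at_def using distinct by auto
  ultimately have "pole_2_2_1 B"
    unfolding pole_2_2_r_def using cubic cards by simp
  moreover have "S (mate B x) \<longleftrightarrow> \<not> S x" if x: "x \<in> ends B" for x
  proof -
    obtain y z where "inc G x = Some y" "inc G (mate G x) = Some z"
      using x[unfolded ends] mate[of x] nosemi[of x] nosemi[of "mate G x"] by auto
    then show ?thesis
      using A[of x y z] x ends by (auto simp: S_def B remove_path_def)
  qed
  moreover have "(\<forall>d \<in> ends_at B x. S d) \<or> (\<forall>d \<in> ends_at B x. \<not> S d)" if "x \<in> verts B" for x
    unfolding ends_at[OF that] by (auto simp: S_def ends_at_def)
  ultimately show thesis
    using that[of S] io r by simp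
qed

text \<open>Each edge has one end of either colour. Counting all ends of each colour shows that the
  colour class opposite to the connectors has one vertex more; counting only the ends whose label
  contains \<open>n\<close> turns this surplus into the summand 1.\<close>

lemma bipartite_pole_count:
  assumes B: "bipartite_pole B" and h: "proper_labelling B h"
  shows "end_count (inputs B) h n + end_count (outputs B) h n = 1 + end_count (residuals B) h n"
proof -
  obtain S where pole: "pole_2_2_1 B" and io: "inputs B \<union> outputs B = {d \<in> semiedges B. S d}"
    and res: "residuals B = {d \<in> semiedges B. \<not> S d}"
    and S: "\<forall>d \<in> ends B. S (mate B d) \<longleftrightarrow> \<not> S d"
    and vert: "\<forall>v \<in> verts B. (\<forall>d \<in> ends_at B v. S d) \<or> (\<forall>d \<in> ends_at B v. \<not> S d)"
    using bipartite_poleE[OF B] .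
  have fin: "finite (verts B)" "finite (ends B)"
    and inc: "\<And>d v. d \<in> ends B \<Longrightarrow> inc B d = Some v \<Longrightarrow> v \<in> verts B"
    and three: "\<And>v. v \<in> verts B \<Longrightarrow> card (ends_at B v) = 3"
    and mate: "\<And>d. d \<in> ends B \<Longrightarrow> mate B d \<in> ends B \<and> mate B d \<noteq> d \<and> mate B (mate B d) = d"
    and disj: "inputs B \<inter> outputs B = {}"
    and cards: "card (inputs B) = 2" "card (outputs B) = 2" "card (residuals B) = 1"
    using pole unfolding pole_2_2_r_def cubic_multipole_def by auto
  define X where "X = {v \<in> verts B. \<forall>d \<in> ends_at B v. S d}"
  define Y where "Y = verts B - X"
  have XY: "verts B = X \<union> Y" "X \<inter> Y = {}" "finite X" "finite Y"
    using fin by (auto simp: X_def Y_def)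
  \<comment> \<open>Used twice: with all ends, so \<open>k\<close> is 3, and with the ends labelled
    by \<open>n\<close>, so \<open>k\<close> is 1.\<close>
  have balance: "card X * k + card {d \<in> inputs B \<union> outputs B. P d} = card Y * k + card {d \<in> residuals B. P d}"
    if P: "\<And>d. d \<in> ends B \<Longrightarrow> P (mate B d) \<longleftrightarrow> P d"
      and k: "\<And>v. v \<in> verts B \<Longrightarrow> card {d \<in> ends_at B v. P d} = k" for P k
  proof -
    have "bij_betw (mate B) {d \<in> ends B. S d \<and> P d} {d \<in> ends B. \<not> S d \<and> P d}"
      using mate S P by (intro bij_betw_byWitness[of _ "mate B"]) auto
    then have "card {d \<in> ends B. S d \<and> P d} = card {d \<in> ends B. \<not> S d \<and> P d}"
      by (rule bij_betw_same_card)
    moreover have "card {d \<in> ends B. S d \<and> P d} =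
        card X * k + card {d \<in> semiedges B. S d \<and> P d}"
    proof -
      have "card {d \<in> ends_at B v. S d \<and> P d} = k" if "v \<in> X" for v
      proof -
        have "{d \<in> ends_at B v. S d \<and> P d} = {d \<in> ends_at B v. P d}"
          using that by (auto simp: X_def)
        then show ?thesis
          using k that by (simp add: X_def)
      qed
      moreover have "card {d \<in> ends_at B v. S d \<and> P d} = 0" if "v \<in> Y" for v
      proof -
        have "{d \<in> ends_at B v. S d \<and> P d} = {}"
          using that bspec[OF vert, of v] by (auto simp: X_def Y_def)
        then show ?thesis
          by (simp only: card.empty)
      qed
      ultimately have "(\<Sum>v \<in> verts B. card {d \<in> ends_at B v. S d \<and> P d}) = card X * k"
        unfolding XY(1) using XY(2-4) by (subst sum.union_disjoint) simp_all
      then show ?thesis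
        by (subst card_ends[OF fin inc]) simp_all
    qed
    moreover have "card {d \<in> ends B. \<not> S d \<and> P d} =
        card Y * k + card {d \<in> semiedges B. \<not> S d \<and> P d}"
    proof -
      have "card {d \<in> ends_at B v. \<not> S d \<and> P d} = k" if "v \<in> Y" for v
      proof -
        have "{d \<in> ends_at B v. \<not> S d \<and> P d} = {d \<in> ends_at B v. P d}"
          using that bspec[OF vert, of v] by (auto simp: X_def Y_def)
        then show ?thesis
          using k that by (simp add: Y_def)
      qed
      moreover have "card {d \<in> ends_at B v. \<not> S d \<and> P d} = 0" if "v \<in> X" for v
      proof -
        have "{d \<in> ends_at B v. \<not> S d \<and> P d} = {}"
          using that by (auto simp: X_def)
        then show ?thesis
          by (simp only: card.empty)
      qed
      ultimately have "(\<Sum>v \<in> verts B. card {d \<in> ends_at B v. \<not> S d \<and> P d}) = card Y * k"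
        unfolding XY(1) using XY(2-4) by (subst sum.union_disjoint) simp_all
      then show ?thesis
        by (subst card_ends[OF fin inc]) simp_all
    qed
    moreover have "{d \<in> semiedges B. S d \<and> P d} = {d \<in> inputs B \<union> outputs B. P d}"
      "{d \<in> semiedges B. \<not> S d \<and> P d} = {d \<in> residuals B. P d}"
      using io res by auto
    ultimately show ?thesis
      by simp
  qed
  have fin': "finite (inputs B)" "finite (outputs B)"
    using cards by (metis card.infinite zero_neq_numeral)+
  have "card (inputs B \<union> outputs B) = 4"
    using cards disj fin' by (simp add: card_Un_disjoint)
  \<comment> \<open>From 3|X| + 4 = 3|Y| + 1.\<close>
  then have "card Y = card X + 1"
    using balance[of "\<lambda>_. True" 3] three cards(3) by (simp add: Un_def)
  moreover have "card X * 1 + card {d \<in> inputs B \<union> outputs B. n \<in> h d} = card Y * 1 + card {d \<in> residuals B. n \<in> h d}"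
    using h by (intro balance) (auto simp: proper_labelling_def mate_labelling_def card_unique)
  moreover have "card {d \<in> inputs B \<union> outputs B. n \<in> h d} =
      end_count (inputs B) h n + end_count (outputs B) h n"
  proof -
    have "{d \<in> inputs B \<union> outputs B. n \<in> h d} = {d \<in> inputs B. n \<in> h d} \<union> {d \<in> outputs B. n \<in> h d}"
      by auto
    then show ?thesis
      unfolding end_count_def using disj fin' by (simp add: card_Un_disjoint disjoint_iff)
  qed
  ultimately show ?thesis
    by (simp add: end_count_def)
qed

lemma pole_involutive: "pole_2_2_r r M \<Longrightarrow> involutive M"
  unfolding pole_2_2_r_def cubic_multipole_def involutive_def by blast

lemma pole_connectors:
  assumes "pole_2_2_r r M"
  shows "inputs M \<subseteq> semiedges M" "outputs M \<subseteq> semiedges M" "residuals M \<subseteq> semiedges M"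
  using assms unfolding pole_2_2_r_def by auto

lemma disjoint_sum_simps [simp]:
  "verts (disjoint_sum M N) = verts M <+> verts N"
  "ends (disjoint_sum M N) = ends M <+> ends N"
  "mate (disjoint_sum M N) = map_sum (mate M) (mate N)"
  "inc (disjoint_sum M N) = case_sum (map_option Inl \<circ> inc M) (map_option Inr \<circ> inc N)"
  "inputs (disjoint_sum M N) = Inl ` inputs M"
  "outputs (disjoint_sum M N) = Inr ` outputs N"
  "residuals (disjoint_sum M N) = residuals M <+> residuals N"
  by (simp_all add: disjoint_sum_def)

lemma involutive_disjoint_sum:
  assumes "involutive M" "involutive N"
  shows "involutive (disjoint_sum M N)"
  using assms unfolding involutive_def by auto

lemma ends_at_disjoint_sum:
  "ends_at (disjoint_sum M N) (Inl v) = Inl ` ends_at M v"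
  "ends_at (disjoint_sum M N) (Inr w) = Inr ` ends_at N w"
  by (auto simp: ends_at_def)

lemma connector_count_trim:
  assumes "card I = 2"
  shows "connector_count (end_count I (trim \<circ> g))"
proof -
  obtain a b where "I = {a, b}" "a \<noteq> b"
    using assms by (auto simp: card_2_iff)
  then show ?thesis
    using card_trim unfolding connector_count_def
    by (intro exI[of _ "trim (g a)"] exI[of _ "trim (g b)"]) (simp add: end_count_pair)
qed

lemma end_count_bij:
  assumes "bij_betw f I J" "\<And>d. d \<in> I \<Longrightarrow> g (f d) = h d"
  shows "end_count I h = end_count J g"
proof
  fix n
  have "bij_betw f {d \<in> I. n \<in> h d} {d \<in> J. n \<in> g d}"
    using assms unfolding bij_betw_def by (auto simp: inj_on_def)
  then show "end_count I h n = end_count J g n"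
    unfolding end_count_def by (rule bij_betw_same_card)
qed

lemma ex1_image:
  assumes "inj_on f S" "\<exists>!y. y \<in> f ` S \<and> P y"
  shows "\<exists>!x. x \<in> S \<and> P (f x)"
  using assms unfolding inj_on_def by blast

lemma is_join_junctionable:
  assumes "pole_2_2_r r M" "pole_2_2_r s N" "bij_betw \<sigma> (outputs M) (inputs N)"
    "distinct js" "set js = {(Inl b, Inr (\<sigma> b)) | b. b \<in> outputs M}"
  shows "junctionable js (ends (disjoint_sum M N))"
    "fst ` set js = Inl ` outputs M" "snd ` set js = Inr ` inputs N"
    "\<And>x y. (x, y) \<in> set js \<Longrightarrow> inc (disjoint_sum M N) x = None \<and> inc (disjoint_sum M N) y = None"
proof -
  have im: "\<sigma> ` outputs M = inputs N" and inj: "inj_on \<sigma> (outputs M)"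
    using assms(3) by (auto simp: bij_betw_def)
  show fst: "fst ` set js = Inl ` outputs M"
    unfolding assms(5) by force
  have "snd ` set js = (\<lambda>b. Inr (\<sigma> b)) ` outputs M"
    unfolding assms(5) by force
  then show snd: "snd ` set js = Inr ` inputs N"
    unfolding im[symmetric] by (simp add: image_image)
  have sub: "outputs M \<subseteq> ends M" "inputs N \<subseteq> ends N" "\<And>b. b \<in> outputs M \<Longrightarrow> inc M b = None"
    "\<And>b. b \<in> inputs N \<Longrightarrow> inc N b = None"
    using pole_connectors[OF assms(1)] pole_connectors[OF assms(2)] unfolding semiedges_def by auto
  show "junctionable js (ends (disjoint_sum M N))"
    unfolding junctionable_def fst snd
  proof (intro conjI)
    show "inj_on fst (set js)" "inj_on snd (set js)"
      using inj unfolding assms(5) inj_on_def by auto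
  qed (use assms(4) sub in auto)
  show "inc (disjoint_sum M N) x = None \<and> inc (disjoint_sum M N) y = None" if xy: "(x, y) \<in> set js" for x y
  proof -
    obtain b where "b \<in> outputs M" "x = Inl b" "y = Inr (\<sigma> b)"
      using xy unfolding assms(5) by blast
    moreover from this have "\<sigma> b \<in> inputs N"
      using im by blast
    ultimately show ?thesis
      using sub(3,4) by simp
  qed
qed

lemma halin_fragmentE:
  assumes "halin_fragment p F"
  obtains D B \<sigma> js where "decollineator p D" "pole_2_2 D" "bipartite_pole B" "pole_2_2_1 B"
    "bij_betw \<sigma> (outputs D) (inputs B)" "distinct js"
    "set js = {(Inl b, Inr (\<sigma> b)) | b. b \<in> outputs D}"
    "F = fold junction js (disjoint_sum D B)" "residuals D = {}"
proof -
  obtain D B \<sigma> js where D: "decollineator p D" and B: "bipartite_pole B" and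
    rest: "bij_betw \<sigma> (outputs D) (inputs B)" "distinct js"
    "set js = {(Inl b, Inr (\<sigma> b)) | b. b \<in> outputs D}"
    "F = fold junction js (disjoint_sum D B)"
    using assms unfolding halin_fragment_def is_join_def by blast
  have pole: "pole_2_2 D"
    using D by (simp add: decollineator_def)
  then have "finite (ends D)" "card (residuals D) = 0"
    unfolding pole_2_2_r_def cubic_multipole_def by simp_all
  moreover from this have "finite (semiedges D)"
    by (simp add: semiedges_def)
  moreover have "residuals D \<subseteq> semiedges D"
    by (rule pole_connectors[OF pole])
  ultimately have "residuals D = {}"
    by (metis card_0_eq finite_subset)
  moreover have "pole_2_2_1 B"
    by (rule bipartite_poleE[OF B])
  ultimately show thesis
    using that[OF D pole B _ rest] by blast
qed

lemma halin_fragment_pole: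
  assumes "halin_fragment p F"
  shows "involutive F" "inputs F \<subseteq> semiedges F" "outputs F \<subseteq> semiedges F" "residuals F \<subseteq> semiedges F"
    "inputs F \<inter> outputs F = {}" "inputs F \<inter> residuals F = {}" "outputs F \<inter> residuals F = {}"
    "card (inputs F) = 2" "card (outputs F) = 2" "card (residuals F) = 1"
proof -
  obtain D B \<sigma> js where "decollineator p D" and D: "pole_2_2 D" and "bipartite_pole B" and B: "pole_2_2_1 B"
    and \<sigma>: "bij_betw \<sigma> (outputs D) (inputs B)" "distinct js"
      "set js = {(Inl b, Inr (\<sigma> b)) | b. b \<in> outputs D}"
    and F: "F = fold junction js (disjoint_sum D B)" and res: "residuals D = {}"
    using halin_fragmentE[OF assms] .
  note J = is_join_junctionable[OF D B \<sigma>]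
  show "involutive F"
    unfolding F using J(1) D B
    by (intro involutive_fold_junction involutive_disjoint_sum pole_involutive)
  have D': "inputs D \<inter> outputs D = {}" "card (inputs D) = 2"
    and B': "inputs B \<inter> outputs B = {}" "(inputs B \<union> outputs B) \<inter> residuals B = {}"
      "card (outputs B) = 2" "card (residuals B) = 1"
    using D B unfolding pole_2_2_r_def by auto
  have conn: "inputs F = Inl ` inputs D" "outputs F = Inr ` outputs B" "residuals F = Inr ` residuals B"
    by (auto simp: F res)
  show "inputs F \<inter> outputs F = {}" "inputs F \<inter> residuals F = {}" "outputs F \<inter> residuals F = {}"
    unfolding conn using B' by auto
  show "card (inputs F) = 2" "card (outputs F) = 2" "card (residuals F) = 1"
    unfolding conn using D' B' by (simp_all add: card_image)
  have semi: "semiedges F = {d \<in> ends D <+> ends B. inc (disjoint_sum D B) d = None} - (Inl ` outputs D \<union> Inr ` inputs B)"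
    unfolding semiedges_def F by (auto simp: J(2,3))
  have "inputs D \<subseteq> {d \<in> ends D. inc D d = None}" "outputs B \<subseteq> {d \<in> ends B. inc B d = None}"
    "residuals B \<subseteq> {d \<in> ends B. inc B d = None}"
    using pole_connectors[OF D] pole_connectors[OF B] unfolding semiedges_def by auto
  then show "inputs F \<subseteq> semiedges F" "outputs F \<subseteq> semiedges F" "residuals F \<subseteq> semiedges F"
    unfolding conn semi using D' B' by auto
qed

text \<open>The labelling is pulled back to the decollineator and the bipartite pole separately. The
  first claim, applied to the next fragment, supplies the condition on the output in the second
  one.\<close>

lemma halin_fragment_transition:
  assumes p: "is_basis p" and "halin_fragment p F" and g: "proper_labelling F g"
    and nonempty: "\<And>d. d \<in> ends F \<Longrightarrow> g d \<noteq> {}"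
  shows "card (odd_part (end_count (inputs F) (trim \<circ> g))) \<noteq> 3"
    and "\<And>r. r \<in> residuals F \<Longrightarrow> card (odd_part (end_count (outputs F) (trim \<circ> g))) \<noteq> 3 \<Longrightarrow>
      transition (end_count (inputs F) (trim \<circ> g)) (end_count (outputs F) (trim \<circ> g)) (trim (g r))"
proof -
  obtain D B \<sigma> js where dec: "decollineator p D" and D: "pole_2_2 D" and bip: "bipartite_pole B" and B: "pole_2_2_1 B"
    and \<sigma>: "bij_betw \<sigma> (outputs D) (inputs B)" "distinct js"
      "set js = {(Inl b, Inr (\<sigma> b)) | b. b \<in> outputs D}"
    and F: "F = fold junction js (disjoint_sum D B)" and res: "residuals D = {}"
    using halin_fragmentE[OF assms(2)] .
  note J = is_join_junctionable[OF D B \<sigma>]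
  have lab: "mate_labelling (fold junction js (disjoint_sum D B)) g"
    using g unfolding F proper_labelling_def by blast
  obtain h where h: "mate_labelling (disjoint_sum D B) h" "\<forall>d \<in> ends F. h d = g d"
      "\<forall>(s, t) \<in> set js. h s = h t" "h ` ends (disjoint_sum D B) \<subseteq> insert {0} (g ` ends F)"
    using fold_junction_labelling[OF involutive_disjoint_sum[OF pole_involutive[OF D] pole_involutive[OF B]] J(1) lab,
      where x = "{0}", folded F] .
  have ne: "h d \<noteq> {}" if "d \<in> ends (disjoint_sum D B)" for d
  proof -
    have "h d \<in> insert {0} (g ` ends F)"
      using h(4) that by blast
    then show ?thesis
      using nonempty by auto
  qed
  have ends_at: "ends_at F v = ends_at (disjoint_sum D B) v" for v
    unfolding F by (rule ends_at_fold_junction[OF J(4)])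
  have hv: "\<exists>!d. d \<in> ends_at (disjoint_sum D B) v \<and> n \<in> h d" if "v \<in> verts F" for v n
  proof -
    have "\<exists>!d. d \<in> ends_at F v \<and> n \<in> g d"
      using g that unfolding proper_labelling_def by blast
    moreover have "d \<in> ends_at F v \<and> n \<in> g d \<longleftrightarrow> d \<in> ends_at F v \<and> n \<in> h d" for d
      using h(2) by (auto simp: ends_at_def)
    ultimately show ?thesis
      unfolding ends_at by simp
  qed
  have "proper_labelling D (h \<circ> Inl)"
    unfolding proper_labelling_def
  proof (intro conjI ballI allI)
    show "mate_labelling D (h \<circ> Inl)"
      using h(1) unfolding mate_labelling_def by (simp add: Plus_def ball_Un)
    fix v n assume "v \<in> verts D"
    then have "\<exists>!d. d \<in> Inl ` ends_at D v \<and> n \<in> h d"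
      using hv[of "Inl v" n] unfolding ends_at_disjoint_sum F by (simp add: InlI InrI)
    from ex1_image[OF _ this] show "\<exists>!d. d \<in> ends_at D v \<and> n \<in> (h \<circ> Inl) d"
      by simp
  qed
  then have pD: "proper_labelling D (trim \<circ> (h \<circ> Inl))"
    using D ne unfolding pole_2_2_r_def cubic_multipole_def by (intro proper_trim) auto
  have "proper_labelling B (h \<circ> Inr)"
    unfolding proper_labelling_def
  proof (intro conjI ballI allI)
    show "mate_labelling B (h \<circ> Inr)"
      using h(1) unfolding mate_labelling_def by (simp add: Plus_def ball_Un)
    fix v n assume "v \<in> verts B"
    then have "\<exists>!d. d \<in> Inr ` ends_at B v \<and> n \<in> h d"
      using hv[of "Inr v" n] unfolding ends_at_disjoint_sum F by (simp add: InlI InrI)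
    from ex1_image[OF _ this] show "\<exists>!d. d \<in> ends_at B v \<and> n \<in> (h \<circ> Inr) d"
      by simp
  qed
  then have pB: "proper_labelling B (trim \<circ> (h \<circ> Inr))"
    using B ne unfolding pole_2_2_r_def cubic_multipole_def by (intro proper_trim) auto
  let ?c = "end_count (inputs D) (trim \<circ> (h \<circ> Inl))" and ?d = "end_count (outputs D) (trim \<circ> (h \<circ> Inl))"
    and ?e = "end_count (outputs B) (trim \<circ> (h \<circ> Inr))"
  have "end_count (inputs B) (trim \<circ> (h \<circ> Inr)) = ?d"
  proof (rule end_count_bij[OF \<sigma>(1), symmetric])
    fix b assume "b \<in> outputs D"
    then have "(Inl b, Inr (\<sigma> b)) \<in> set js"
      using \<sigma>(3) by blast
    with h(3) have "h (Inl b) = h (Inr (\<sigma> b))"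
      by blast
    then show "(trim \<circ> (h \<circ> Inr)) (\<sigma> b) = (trim \<circ> (h \<circ> Inl)) b"
      by simp
  qed
  note de = bipartite_pole_count[OF bip pB, unfolded this]
  note conn = halin_fragment_pole[OF assms(2)]
  have conn_ends: "inputs F \<subseteq> ends F" "outputs F \<subseteq> ends F" "residuals F \<subseteq> ends F"
    using conn(2-4) unfolding semiedges_def by auto
  have F_conn: "inputs F = Inl ` inputs D" "outputs F = Inr ` outputs B" "residuals F = Inr ` residuals B"
    by (auto simp: F res)
  have c: "?c = end_count (inputs F) (trim \<circ> g)"
    using conn_ends(1) h(2) unfolding F_conn
    by (intro end_count_bij[of Inl]) (auto simp: bij_betw_def)
  have e: "?e = end_count (outputs F) (trim \<circ> g)"
    using conn_ends(2) h(2) unfolding F_conn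
    by (intro end_count_bij[of Inr]) (auto simp: bij_betw_def)
  have parity: "\<forall>n. even (?c n + ?d n)"
    using decollineator_parity[OF D pD] by blast
  have coll: "\<not> (collinear_count ?c \<and> collinear_count ?d)"
    using decollineator_collinear[OF p dec pD] card_trim by simp
  have count: "connector_count ?c" "connector_count ?d" "connector_count ?e"
    using D B unfolding pole_2_2_r_def by (simp_all only: connector_count_trim)
  show "card (odd_part (end_count (inputs F) (trim \<circ> g))) \<noteq> 3"
    using no_half_line_input[OF parity coll count(1,2)] unfolding c .
  fix r assume r: "r \<in> residuals F" and e3: "card (odd_part (end_count (outputs F) (trim \<circ> g))) \<noteq> 3"
  then obtain r' where r': "r' \<in> residuals B" "r = Inr r'"
    unfolding F_conn by blast
  then have "residuals B = {r'}"
    using B unfolding pole_2_2_r_def by (metis card_1_singletonE singletonD)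
  then have "end_count (residuals B) (trim \<circ> (h \<circ> Inr)) n = of_bool (n \<in> trim (h r))" for n
    using r'(2) by (simp add: end_count_def Collect_conv_if)
  then have "\<forall>n. ?d n + ?e n = 1 + of_bool (n \<in> trim (h r))"
    using de by simp
  then have "transition ?c ?e (trim (h r))"
    using card_trim e3 by (intro fragment_transition[OF parity coll _ count]) (auto simp: e)
  moreover have "h r = g r"
    using h(2) conn_ends(3) r by blast
  ultimately show "transition (end_count (inputs F) (trim \<circ> g)) (end_count (outputs F) (trim \<circ> g)) (trim (g r))"
    unfolding c e by simp
qed

section \<open>Halin snarks\<close>

lemma leaf_neighbour_eq:
  assumes "degree E x = 1" "{x, y} \<in> E"
  shows "leaf_neighbour E x = y"
  unfolding leaf_neighbour_def using assms leaf_neighbour_unique[OF assms(1)] by blast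

lemma leaf_neighbour_edge:
  assumes "is_tree V E" "degree E x = 1"
  shows "{x, leaf_neighbour E x} \<in> E"
proof -
  obtain e where "{e \<in> E. x \<in> e} = {e}"
    using card_1_singletonE[OF assms(2)[unfolded degree_def]] by metis
  then have e: "e \<in> E" "x \<in> e"
    by blast+
  moreover have "card e = 2"
    using assms(1) e(1) unfolding is_tree_def simple_graph_def by blast
  ultimately obtain y where "e = {x, y}"
    by (auto simp: card_2_iff)
  with e have "{x, y} \<in> E"
    by simp
  with leaf_neighbour_eq[OF assms(2) this] show ?thesis
    by simp
qed

lemma halin_sum_simps [simp]:
  "verts (halin_sum V E vs F) = (SIGMA i : {..<length vs}. verts (F i)) <+> (V - set vs)"
  "ends (halin_sum V E vs F) = (SIGMA i : {..<length vs}. ends (F i)) <+>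
     {(x, y). {x, y} \<in> E \<and> x \<notin> set vs \<and> y \<notin> set vs}"
  "mate (halin_sum V E vs F) = map_sum (\<lambda>(i, d). (i, mate (F i) d)) (\<lambda>(x, y). (y, x))"
  "inc (halin_sum V E vs F) = case_sum
     (\<lambda>(i, d). if d \<in> residuals (F i) then Some (Inr (leaf_neighbour E (vs ! i)))
        else map_option (\<lambda>v. Inl (i, v)) (inc (F i) d))
     (\<lambda>(x, y). Some (Inr x))"
  by (simp_all add: halin_sum_def)

lemma involutive_halin_sum:
  assumes "is_tree V E" "\<And>i. i < length vs \<Longrightarrow> involutive (F i)"
  shows "involutive (halin_sum V E vs F)"
  unfolding involutive_def
proof
  fix d assume d: "d \<in> ends (halin_sum V E vs F)"
  let ?m = "mate (halin_sum V E vs F)"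
  show "?m d \<in> ends (halin_sum V E vs F) \<and> ?m d \<noteq> d \<and> ?m (?m d) = d"
  proof (cases d)
    case (Inl z)
    then show ?thesis
      using d assms(2)[of "fst z"] unfolding involutive_def by (cases z) auto
  next
    case (Inr z)
    obtain x y where "z = (x, y)"
      by force
    then show ?thesis
      using Inr d tree_edge(3)[OF assms(1), of x y] by (auto simp: insert_commute)
  qed
qed

lemma ends_at_halin_sum_fragment:
  assumes "i < length vs" "residuals (F i) \<subseteq> semiedges (F i)"
  shows "ends_at (halin_sum V E vs F) (Inl (i, v)) = (\<lambda>d. Inl (i, d)) ` ends_at (F i) v"
proof (rule set_eqI)
  fix d
  have "r \<notin> residuals (F i)" if "inc (F i) r = Some v" for r
    using assms(2) that unfolding semiedges_def by auto
  then show "d \<in> ends_at (halin_sum V E vs F) (Inl (i, v)) \<longleftrightarrow> d \<in> (\<lambda>d. Inl (i, d)) ` ends_at (F i) v"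
    using assms(1) by (cases d) (auto simp: ends_at_def split: if_splits)
qed

text \<open>For a leaf \<open>y\<close> this is the residual end of the fragment that replaces \<open>y\<close>.\<close>

definition tree_end :: "'t list \<Rightarrow> (nat \<Rightarrow> ('v, 'd) pole) \<Rightarrow> 't \<Rightarrow> 't \<Rightarrow> nat \<times> 'd + 't \<times> 't" where
  "tree_end vs F x y =
     (if y \<in> set vs then let i = THE i. i < length vs \<and> vs ! i = y in Inl (i, the_elem (residuals (F i)))
      else Inr (x, y))"

lemma tree_end_leaf:
  assumes "distinct vs" "i < length vs"
  shows "tree_end vs F x (vs ! i) = Inl (i, the_elem (residuals (F i)))"
proof -
  have "(THE j. j < length vs \<and> vs ! j = vs ! i) = i"
    using assms nth_eq_iff_index_eq by (intro the_equality) auto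
  then show ?thesis
    using assms(2) by (simp add: tree_end_def)
qed

lemma inj_tree_end:
  assumes "distinct vs"
  shows "inj (tree_end vs F x)"
proof (rule injI)
  fix y z assume eq: "tree_end vs F x y = tree_end vs F x z"
  show "y = z"
  proof (cases "y \<in> set vs \<and> z \<in> set vs")
    case True
    then obtain i j where ij: "i < length vs" "j < length vs" "y = vs ! i" "z = vs ! j"
      by (auto simp: in_set_conv_nth)
    then show ?thesis
      using eq tree_end_leaf[OF assms ij(1), of F x] tree_end_leaf[OF assms ij(2), of F x] by simp
  next
    case False
    then show ?thesis
      using eq by (auto simp: tree_end_def Let_def split: if_splits)
  qed
qed

text \<open>Translates the matching condition at an inner tree vertex from edge ends into a
  condition on its neighbours in the tree, leaves included.\<close>

lemma ends_at_halin_sum_tree: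
  assumes halin: "cubic_halin V E vs" and x: "x \<in> V - set vs"
    and F: "\<And>i. i < length vs \<Longrightarrow> card (residuals (F i)) = 1"
      "\<And>i. i < length vs \<Longrightarrow> residuals (F i) \<subseteq> semiedges (F i)"
  shows "ends_at (halin_sum V E vs F) (Inr x) = tree_end vs F x ` {y. {x, y} \<in> E}"
proof (intro equalityI subsetI)
  have tree: "is_tree V E" and dist: "distinct vs" and leaf: "\<And>y. y \<in> set vs \<Longrightarrow> degree E y = 1"
    using halin unfolding cubic_halin_def by auto
  have res: "residuals (F i) = {the_elem (residuals (F i))}" if "i < length vs" for i
    using F(1)[OF that] by (metis card_1_singletonE the_elem_eq)
  show "d \<in> tree_end vs F x ` {y. {x, y} \<in> E}" if d: "d \<in> ends_at (halin_sum V E vs F) (Inr x)" for d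
  proof (cases d)
    case (Inl z)
    obtain i c where z: "z = (i, c)"
      by force
    then have i: "i < length vs" "c \<in> residuals (F i)" "leaf_neighbour E (vs ! i) = x"
      using d Inl by (auto simp: ends_at_def split: if_splits)
    then have "{vs ! i, x} \<in> E"
      using leaf_neighbour_edge[OF tree leaf[OF nth_mem[OF i(1)]]] by simp
    moreover have "c = the_elem (residuals (F i))"
      using res[OF i(1)] i(2) by (metis singletonD)
    then have "d = tree_end vs F x (vs ! i)"
      using tree_end_leaf[OF dist i(1), of F x] Inl z by simp
    ultimately show ?thesis
      by (auto simp: insert_commute)
  next
    case (Inr z)
    then show ?thesis
      using d by (auto simp: ends_at_def tree_end_def)
  qed
  show "d \<in> ends_at (halin_sum V E vs F) (Inr x)" if d: "d \<in> tree_end vs F x ` {y. {x, y} \<in> E}" for d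
  proof -
    obtain y where y: "{x, y} \<in> E" "d = tree_end vs F x y"
      using d by blast
    show ?thesis
    proof (cases "y \<in> set vs")
      case True
      then obtain i where i: "i < length vs" "y = vs ! i"
        by (auto simp: in_set_conv_nth)
      let ?r = "the_elem (residuals (F i))"
      have "?r \<in> residuals (F i)"
        using res[OF i(1)] by blast
      moreover from this have "?r \<in> ends (F i)"
        using F(2)[OF i(1)] unfolding semiedges_def by blast
      moreover have "leaf_neighbour E y = x"
        using leaf_neighbour_eq[OF leaf[OF True]] y(1) by (simp add: insert_commute)
      ultimately show ?thesis
        using y(2) i tree_end_leaf[OF dist i(1), of F x] by (auto simp: ends_at_def)
    next
      case False
      then show ?thesis
        using y x by (auto simp: ends_at_def tree_end_def)
    qed
  qed
qed

text \<open>The junctions are pairwise disjoint because the cyclic successor and every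
  \<open>\<sigma> i\<close> are injective and inputs differ from outputs. They use no residual end,
  so the ends at each vertex are unchanged.\<close>

lemma halin_snarkE:
  assumes "halin_snark p H"
  obtains V E vs F \<sigma> js where "cubic_halin V E vs" "\<forall>i<length vs. halin_fragment p (F i)"
    "\<forall>i<length vs. bij_betw (\<sigma> i) (outputs (F i)) (inputs (F (Suc i mod length vs)))"
    "\<forall>i<length vs. \<forall>b \<in> outputs (F i). (Inl (i, b), Inl (Suc i mod length vs, \<sigma> i b)) \<in> set js"
    "junctionable js (ends (halin_sum V E vs F))" "involutive (halin_sum V E vs F)"
    "H = fold junction js (halin_sum V E vs F)"
    "\<forall>v. ends_at H v = ends_at (halin_sum V E vs F) v"
proof -
  obtain V E vs F \<sigma> js where halin: "cubic_halin V E vs" and frag: "\<forall>i<length vs. halin_fragment p (F i)"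
    and \<sigma>: "\<forall>i<length vs. bij_betw (\<sigma> i) (outputs (F i)) (inputs (F (Suc i mod length vs)))"
    and js: "distinct js" "set js = {(Inl (i, b), Inl (Suc i mod length vs, \<sigma> i b)) | i b.
        i < length vs \<and> b \<in> outputs (F i)}"
    and H: "H = fold junction js (halin_sum V E vs F)"
    using assms unfolding halin_snark_def by blast
  let ?G = "halin_sum V E vs F" and ?nxt = "\<lambda>i. Suc i mod length vs"
  have tree: "is_tree V E"
    using halin unfolding cubic_halin_def by simp
  note pole = halin_fragment_pole[OF frag[rule_format]]
  have nxt: "?nxt i < length vs" if "i < length vs" for i
    using that by (intro mod_less_divisor) linarith
  have nxt_inj: "i = j" if "i < length vs" "j < length vs" "?nxt i = ?nxt j" for i j
    using that by (auto simp: mod_Suc split: if_splits)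
  have \<sigma>_in: "\<sigma> i b \<in> inputs (F (?nxt i))" if "i < length vs" "b \<in> outputs (F i)" for i b
    using \<sigma> that unfolding bij_betw_def by blast
  have \<sigma>_inj: "b = c" if "i < length vs" "b \<in> outputs (F i)" "c \<in> outputs (F i)" "\<sigma> i b = \<sigma> i c" for i b c
    using \<sigma> that unfolding bij_betw_def inj_on_def by blast
  have io: "b \<noteq> c" if "i < length vs" "b \<in> outputs (F i)" "c \<in> inputs (F i)" for i b c
    using pole(5) that by blast
  have free: "b \<in> ends (F i)" "inc ?G (Inl (i, b)) = None"
    if "i < length vs" "b \<in> inputs (F i) \<union> outputs (F i)" for i b
  proof -
    have "b \<in> semiedges (F i)" "b \<notin> residuals (F i)"
      using pole(2,3,6,7) that by blast+
    then show "b \<in> ends (F i)" "inc ?G (Inl (i, b)) = None"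
      by (simp_all add: semiedges_def)
  qed
  have "junctionable js (ends ?G)"
    unfolding junctionable_def
  proof (intro conjI)
    show "distinct js"
      by fact
    show "inj_on fst (set js)"
      unfolding js(2) inj_on_def by auto
    show "inj_on snd (set js)"
    proof (rule inj_onI)
      fix v w assume "v \<in> set js" "w \<in> set js" and eq: "snd v = snd w"
      then obtain i b j c where v: "v = (Inl (i, b), Inl (?nxt i, \<sigma> i b))" "i < length vs" "b \<in> outputs (F i)"
        and w: "w = (Inl (j, c), Inl (?nxt j, \<sigma> j c))" "j < length vs" "c \<in> outputs (F j)"
        unfolding js(2) by blast
      have "i = j"
        using nxt_inj[OF v(2) w(2)] eq v(1) w(1) by simp
      moreover from this have "b = c"
        using \<sigma>_inj[OF v(2,3)] w(3) eq v(1) w(1) by simp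
      ultimately show "v = w"
        using v(1) w(1) by simp
    qed
    show "fst ` set js \<inter> snd ` set js = {}"
    proof (rule ccontr)
      assume "fst ` set js \<inter> snd ` set js \<noteq> {}"
      then obtain z where z: "z \<in> fst ` set js" "z \<in> snd ` set js"
        by blast
      obtain i b where 1: "z = Inl (i, b)" "i < length vs" "b \<in> outputs (F i)"
        using z(1) unfolding js(2) by auto
      obtain j c where 2: "z = Inl (?nxt j, \<sigma> j c)" "j < length vs" "c \<in> outputs (F j)"
        using z(2) unfolding js(2) by auto
      show False
        using io[OF 1(2,3), of b] \<sigma>_in[OF 2(2,3)] 1(1) 2(1) by simp
    qed
    show "fst ` set js \<union> snd ` set js \<subseteq> ends ?G"
      unfolding js(2) using free(1) nxt \<sigma>_in by auto
  qed
  moreover have "ends_at H v = ends_at ?G v" for v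
    unfolding H
  proof (rule ends_at_fold_junction)
    fix s t assume "(s, t) \<in> set js"
    then obtain i b where "i < length vs" "b \<in> outputs (F i)" "s = Inl (i, b)" "t = Inl (?nxt i, \<sigma> i b)"
      unfolding js(2) by blast
    then show "inc ?G s = None \<and> inc ?G t = None"
      using free(2)[of i b] free(2)[of "?nxt i" "\<sigma> i b"] nxt \<sigma>_in by simp
  qed
  moreover have "\<forall>i<length vs. \<forall>b \<in> outputs (F i). (Inl (i, b), Inl (Suc i mod length vs, \<sigma> i b)) \<in> set js"
    unfolding js(2) by blast
  ultimately show thesis
    using that[OF halin frag \<sigma> _ _ involutive_halin_sum[OF tree pole(1)] H] by blast
qed

text \<open>Excludes the empty family of matchings, which could not be listed as four matchings with
  repetition.\<close>

lemma halin_snark_edges_nonempty: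
  assumes "halin_snark p H"
  shows "edges H \<noteq> {}"
proof -
  obtain V E vs F \<sigma> js where halin: "cubic_halin V E vs" and frag: "\<forall>i<length vs. halin_fragment p (F i)"
    and "\<forall>i<length vs. bij_betw (\<sigma> i) (outputs (F i)) (inputs (F (Suc i mod length vs)))"
    "\<forall>i<length vs. \<forall>b \<in> outputs (F i). (Inl (i, b), Inl (Suc i mod length vs, \<sigma> i b)) \<in> set js"
    "junctionable js (ends (halin_sum V E vs F))" "involutive (halin_sum V E vs F)"
    "H = fold junction js (halin_sum V E vs F)"
    and ends_at: "\<forall>v. ends_at H v = ends_at (halin_sum V E vs F) v"
    using halin_snarkE[OF assms] .
  note pole = halin_fragment_pole[OF frag[rule_format]]
  obtain x where x: "x \<in> V" "degree E x = 3"
    using halin unfolding cubic_halin_def by blast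
  then have "x \<in> V - set vs"
    using halin unfolding cubic_halin_def by auto
  then have "ends_at H (Inr x) = tree_end vs F x ` {y. {x, y} \<in> E}"
    using ends_at_halin_sum_tree[OF halin, of x F] pole(10,4) ends_at by simp
  moreover have "{y. {x, y} \<in> E} \<noteq> {}"
  proof -
    have "card {e \<in> E. x \<in> e} \<noteq> 0"
      using x(2) by (simp add: degree_def)
    then obtain e where e: "e \<in> E" "x \<in> e"
      by (metis (no_types, lifting) card_eq_0_iff empty_Collect_eq)
    moreover have "card e = 2"
      using halin e(1) unfolding cubic_halin_def is_tree_def simple_graph_def by blast
    ultimately obtain y where "e = {x, y}"
      by (auto simp: card_2_iff)
    with e show ?thesis
      by blast
  qed
  ultimately have "ends_at H (Inr x) \<noteq> {}"
    by simp
  then show ?thesis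
    by (auto simp: edges_def ends_at_def)
qed

text \<open>Indexing the matchings by the type \<open>4\<close> lets repetitions occur and makes the
  label of an edge a \<open>4 set\<close>; covering means that no label is empty.\<close>

lemma halin_snark_not_covered:
  fixes M :: "4 \<Rightarrow> (nat \<times> ('d + 'e) + 't \<times> 't) set set"
    and H :: "(nat \<times> ('v + 'w) + 't, nat \<times> ('d + 'e) + 't \<times> 't) multipole"
  assumes p: "is_basis p" and snark: "halin_snark p H"
    and M: "\<And>n. perfect_matching H (M n)" "(\<Union>n. M n) = edges H"
  shows False
proof -
  obtain V E vs F \<sigma> js where halin: "cubic_halin V E vs" and frag: "\<forall>i<length vs. halin_fragment p (F i)"
    and \<sigma>: "\<forall>i<length vs. bij_betw (\<sigma> i) (outputs (F i)) (inputs (F (Suc i mod length vs)))"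
    and js: "\<forall>i<length vs. \<forall>b \<in> outputs (F i). (Inl (i, b), Inl (Suc i mod length vs, \<sigma> i b)) \<in> set js"
    and junc: "junctionable js (ends (halin_sum V E vs F))" and inv: "involutive (halin_sum V E vs F)"
    and H: "H = fold junction js (halin_sum V E vs F)"
    and ends_at: "\<forall>v. ends_at H v = ends_at (halin_sum V E vs F) v"
    using halin_snarkE[OF snark] .
  let ?G = "halin_sum V E vs F" and ?nxt = "\<lambda>i. Suc i mod length vs"
  have tree: "is_tree V E" and dist: "distinct vs"
    using halin unfolding cubic_halin_def by auto
  note pole = halin_fragment_pole[OF frag[rule_format]]
  define lab where "lab d = {n. edge_ends H d \<in> M n}" for d
  have "involutive H"
    unfolding H by (rule involutive_fold_junction[OF inv junc])
  then have "mate_labelling H lab"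
    unfolding mate_labelling_def involutive_def lab_def edge_ends_def by (auto simp: insert_commute)
  then have mlab: "mate_labelling (fold junction js ?G) lab"
    unfolding H .
  obtain g where g: "mate_labelling ?G g" "\<forall>d \<in> ends H. g d = lab d" "\<forall>(s, t) \<in> set js. g s = g t"
      "g ` ends ?G \<subseteq> insert {0} (lab ` ends H)"
    using fold_junction_labelling[OF inv junc mlab, where x = "{0}", folded H] .
  have lab_ne: "lab d \<noteq> {}" if "d \<in> ends H" for d
  proof -
    have "edge_ends H d \<in> (\<Union>n. M n)"
      unfolding M(2) edges_def using that by blast
    then show ?thesis
      by (auto simp: lab_def)
  qed
  have ne: "g d \<noteq> {}" if "d \<in> ends ?G" for d
  proof -
    have "g d \<in> insert {0} (lab ` ends H)"
      using g(4) that by blast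
    then show ?thesis
      using lab_ne by auto
  qed
  have gv: "\<exists>!d. d \<in> ends_at ?G v \<and> n \<in> g d" if "v \<in> verts ?G" for v n
  proof -
    have "v \<in> verts H"
      using that by (simp add: H)
    then have "\<exists>!d. d \<in> ends_at H v \<and> edge_ends H d \<in> M n"
      using M(1)[of n] unfolding perfect_matching_def by blast
    moreover have "d \<in> ends_at H v \<and> edge_ends H d \<in> M n \<longleftrightarrow> d \<in> ends_at H v \<and> n \<in> g d" for d
      using g(2) by (auto simp: ends_at_def lab_def)
    ultimately show ?thesis
      using ends_at by simp
  qed
  define f where "f i d = g (Inl (i, d))" for i d
  have f: "proper_labelling (F i) (f i)" if i: "i < length vs" for i
    unfolding proper_labelling_def
  proof (intro conjI ballI allI)
    show "mate_labelling (F i) (f i)"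
      unfolding mate_labelling_def
    proof
      fix d assume "d \<in> ends (F i)"
      then have "Inl (i, d) \<in> ends ?G"
        using i by (simp add: InlI)
      with g(1) have "g (mate ?G (Inl (i, d))) = g (Inl (i, d))"
        unfolding mate_labelling_def by blast
      then show "f i (mate (F i) d) = f i d"
        by (simp add: f_def)
    qed
    fix v n assume "v \<in> verts (F i)"
    then have "\<exists>!d. d \<in> (\<lambda>d. Inl (i, d)) ` ends_at (F i) v \<and> n \<in> g d"
      using gv[of "Inl (i, v)" n] i ends_at_halin_sum_fragment[where F = F, OF i pole(4)[OF i]]
      by (simp add: InlI)
    from ex1_image[OF _ this] show "\<exists>!d. d \<in> ends_at (F i) v \<and> n \<in> f i d"
      by (simp add: f_def inj_on_def)
  qed
  have f_ne: "f i d \<noteq> {}" if "i < length vs" "d \<in> ends (F i)" for i d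
    unfolding f_def using that by (intro ne) (simp add: InlI)
  define t where "t i = end_count (inputs (F i)) (trim \<circ> f i)" for i
  have nxt: "?nxt i < length vs" if "i < length vs" for i
    using that by (intro mod_less_divisor) linarith
  have out: "end_count (outputs (F i)) (trim \<circ> f i) = t (?nxt i)" if i: "i < length vs" for i
    unfolding t_def
  proof (rule end_count_bij)
    show "bij_betw (\<sigma> i) (outputs (F i)) (inputs (F (?nxt i)))"
      using \<sigma> i by blast
    fix b assume "b \<in> outputs (F i)"
    then have "g (Inl (i, b)) = g (Inl (?nxt i, \<sigma> i b))"
      using g(3) js i by blast
    then show "(trim \<circ> f (?nxt i)) (\<sigma> i b) = (trim \<circ> f i) b"
      by (simp add: f_def)
  qed
  have t3: "card (odd_part (t i)) \<noteq> 3" if "i < length vs" for i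
    unfolding t_def by (rule halin_fragment_transition(1)[OF p frag[rule_format, OF that] f[OF that] f_ne[OF that]])
  have trans: "transition (t i) (t (?nxt i)) (trim (f i (the_elem (residuals (F i)))))" if i: "i < length vs" for i
  proof -
    have "the_elem (residuals (F i)) \<in> residuals (F i)"
      using pole(10)[OF i] by (metis card_1_singletonE singletonI the_elem_eq)
    then show ?thesis
      using halin_fragment_transition(2)[OF p frag[rule_format, OF i] f[OF i] f_ne[OF i]] t3[OF nxt[OF i]]
      unfolding out[OF i] t_def[symmetric] by blast
  qed
  \<comment> \<open>At a leaf the end is the residual one of its fragment, seen from either side of
    the edge. Every tree edge has an inner end, where trimming changes nothing.\<close>
  define l where "l x y = trim (g (if x \<in> set vs then tree_end vs F y x else tree_end vs F x y))" for x y
  have ends_tree: "ends_at ?G (Inr x) = tree_end vs F x ` {y. {x, y} \<in> E}" if "x \<in> V - set vs" for x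
    by (rule ends_at_halin_sum_tree[OF halin that]) (use pole(10,4) in auto)
  have vertex: "\<exists>!y. y \<in> {y. {x, y} \<in> E} \<and> n \<in> g (tree_end vs F x y)" if x: "x \<in> V - set vs" for x n
  proof -
    have "inj_on (tree_end vs F x) {y. {x, y} \<in> E}"
      using inj_tree_end[OF dist] by (rule inj_on_subset) simp
    moreover have "\<exists>!d. d \<in> ends_at ?G (Inr x) \<and> n \<in> g d"
      using x by (intro gv) (simp add: InrI)
    then have "\<exists>!d. d \<in> tree_end vs F x ` {y. {x, y} \<in> E} \<and> n \<in> g d"
      unfolding ends_tree[OF x] .
    ultimately show ?thesis
      by (rule ex1_image)
  qed
  have l: "l x y = g (tree_end vs F x y)" "l x y \<noteq> {}" if x: "x \<in> V - set vs" and xy: "{x, y} \<in> E" for x y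
  proof -
    have "degree E x = 3"
      using halin_degree[OF halin xy] x by blast
    then obtain a b where "a \<noteq> b" "a \<noteq> y" "b \<noteq> y" "{z. {x, z} \<in> E} = {y, a, b}"
      using cubic_neighbours[OF tree _ xy] by metis
    then have three: "card {z. {x, z} \<in> E} = 3"
      by simp
    have "g (tree_end vs F x z) \<noteq> {}" if "z \<in> {z. {x, z} \<in> E}" for z
    proof -
      have "tree_end vs F x z \<in> ends_at ?G (Inr x)"
        unfolding ends_tree[OF x] using that by blast
      then show ?thesis
        using ne by (simp add: ends_at_def)
    qed
    then have "card (g (tree_end vs F x y)) \<in> {1, 2}"
      using partition_labels_card[OF three vertex[OF x]] xy by blast
    then show "l x y = g (tree_end vs F x y)"
      using x by (simp add: l_def trim_def)
    show "l x y \<noteq> {}"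
      using card_trim unfolding l_def by (metis card.empty one_neq_zero zero_neq_numeral)
  qed
  show False
  proof (rule no_halin_transitions[OF halin])
    show "transition (t i) (t (?nxt i)) (l (vs ! i) y)" if "i < length vs" "{vs ! i, y} \<in> E" for i y
      using trans[OF that(1)] tree_end_leaf[OF dist that(1), of F y] that(1) by (simp add: l_def f_def)
    show "l x y = l y x" if x: "x \<in> V - set vs" and xy: "{x, y} \<in> E" for x y
    proof (cases "y \<in> set vs")
      case True
      then show ?thesis
        using x by (simp add: l_def)
    next
      case False
      then have "Inr (x, y) \<in> ends ?G"
        using x xy by (simp add: InrI)
      with g(1) have "g (mate ?G (Inr (x, y))) = g (Inr (x, y))"
        unfolding mate_labelling_def by blast
      then show ?thesis
        using False x by (simp add: l_def tree_end_def)
    qed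
    show "l x y \<noteq> {}" if "x \<in> V - set vs" "{x, y} \<in> E" for x y
      using l(2)[OF that] .
    show "\<exists>!y. {x, y} \<in> E \<and> n \<in> l x y" if x: "x \<in> V - set vs" for x n
    proof -
      have "{x, y} \<in> E \<and> n \<in> l x y \<longleftrightarrow> y \<in> {y. {x, y} \<in> E} \<and> n \<in> g (tree_end vs F x y)" for y
        using l(1)[OF x] by auto
      then show ?thesis
        using vertex[OF x, of n] by simp
    qed
  qed
qed

theorem theorem8p9:
  fixes p :: "4 \<Rightarrow> bit ^ 4"
    and H :: "(nat \<times> ('v + 'w) + 't, nat \<times> ('d + 'e) + 't \<times> 't) multipole"
  assumes "is_basis p" and "halin_snark p H"
  shows "5 \<le> perfect_matching_index H \<and>
    (\<nexists>M\<^sub>1 M\<^sub>2 M\<^sub>3 M\<^sub>4. perfect_matching H M\<^sub>1 \<and> perfect_matching H M\<^sub>2 \<and>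
       perfect_matching H M\<^sub>3 \<and> perfect_matching H M\<^sub>4 \<and> M\<^sub>1 \<union> M\<^sub>2 \<union> M\<^sub>3 \<union> M\<^sub>4 = edges H)"
proof -
  have few: False
    if P: "finite P" "card P \<le> 4" "\<forall>M \<in> P. perfect_matching H M" "\<Union> P = edges H" for P
  proof -
    have "P \<noteq> {}"
      using P(4) halin_snark_edges_nonempty[OF assms(2)] by auto
    \<comment> \<open>A family of at most four matchings injects into \<open>4\<close>; being
      nonempty, it is then also an image of \<open>4\<close>, that is, a list of four matchings with
      repetitions.\<close>
    moreover obtain f :: "_ \<Rightarrow> 4" where "inj_on f P"
      using card_le_inj[of P "UNIV :: 4 set"] P(1,2) by auto
    ultimately obtain M :: "4 \<Rightarrow> _" where M: "range M = P"
      using inj_on_iff_surj[of P "UNIV :: 4 set"] by (metis subset_UNIV)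
    have "perfect_matching H (M n)" for n
      using P(3) M by blast
    then show False
      using halin_snark_not_covered[OF assms] M P(4) by metis
  qed
  have "5 \<le> perfect_matching_index H"
    unfolding perfect_matching_index_def
  proof (rule Inf_greatest)
    fix m
    assume "m \<in> {enat (card P) | P. finite P \<and> (\<forall>M \<in> P. perfect_matching H M) \<and> \<Union> P = edges H}"
    then obtain P where P: "m = enat (card P)" "finite P" "\<forall>M \<in> P. perfect_matching H M" "\<Union> P = edges H"
      by (elim CollectE exE conjE)
    have "\<not> card P \<le> 4"
      using few[OF P(2) _ P(3,4)] by auto
    then show "5 \<le> m"
      unfolding P(1) by (simp add: numeral_eq_enat)
  qed
  moreover have False if "perfect_matching H M\<^sub>1" "perfect_matching H M\<^sub>2" "perfect_matching H M\<^sub>3"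
    "perfect_matching H M\<^sub>4" "M\<^sub>1 \<union> M\<^sub>2 \<union> M\<^sub>3 \<union> M\<^sub>4 = edges H" for M\<^sub>1 M\<^sub>2 M\<^sub>3 M\<^sub>4
  proof (rule few)
    \<comment> \<open>The four matchings may coincide, so only an upper bound holds.\<close>
    show "card {M\<^sub>1, M\<^sub>2, M\<^sub>3, M\<^sub>4} \<le> 4"
      using card_length[of "[M\<^sub>1, M\<^sub>2, M\<^sub>3, M\<^sub>4]"] by simp
  qed (use that in auto)
  ultimately show ?thesis
    by blast
qed

end
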